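(* Let $Y\to X$ be a dominant morphism of finite type between two irreducible affine algebraic varieties over $\mathbb{R}$. Then the central seminormalization $X^{s_c,*}_Y$ of $X$ in $Y$ exists, and its coordinate ring is the central seminormalization of $\mathbb{R}[X]$ in $\mathbb{R}[Y]$: $$\mathbb{R}[X^{s_c,*}_Y]=\mathbb{R}[X]^{s_c,*}_{\mathbb{R}[Y]}.$$
   Context: An irreducible affine algebraic variety $X$ over $\mathbb{R}$ is $\mathrm{Spec}$ of a domain $\mathbb{R}[X]$ finitely generated over $\mathbb{R}$; a dominant morphism $Y\to X$ corresponds to an injective $\mathbb{R}$-algebra homomorphism $\mathbb{R}[X]\to\mathbb{R}[Y]$. Rings and varieties are considered up to isomorphism. For a domain $A$ containing $\mathbb{Q}$, $\mathcal{K}(A)$ is its fraction field and $\sum\mathcal{K}(A)^2$ the set of finite sums of squares in $\mathcal{K}(A)$. An ideal $I\subset A$ is central if for all $a\in A$, $b\in\sum\mathcal{K}(A)^2$, $a^2+b\in I$ implies $a\in I$. $\text{C-Spec}\,A$ is the set of central prime ideals of $A$; contraction gives a well-defined map $\text{C-Spec}\,B\to\text{C-Spec}\,A$ for an extension of domains $A\to B$. $A\to B$ is $s_c$-subintegral (centrally subintegral) if it is integral and $\text{C-Spec}\,B\to\text{C-Spec}\,A$ is bijective with isomorphic residue fields ($k(\mathfrak q\cap A)\to k(\mathfrak q)$ is an isomorphism for every $\mathfrak q\in\text{C-Spec}\,B$). The central seminormalization $A^{s_c,*}_B$ of $A$ in $B$ is the unique maximal element among the intermediate domains $A\subset C\subset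 B$ such that $A\to C$ is $s_c$-subintegral (it always exists). A dominant morphism $V\to X$ of irreducible affine varieties over $\mathbb{R}$ is centrally subintegral if $\mathbb{R}[X]\to\mathbb{R}[V]$ is $s_c$-subintegral. An affine variety $V$ is intermediate between $X$ and $Y$ if $\mathbb{R}[V]$ is an intermediate ring $\mathbb{R}[X]\subset\mathbb{R}[V]\subset\mathbb{R}[Y]$, i.e. $Y\to X$ factorizes through $V$. The central seminormalization $X^{s_c,*}_Y$ of $X$ in $Y$ is, when it exists, the unique maximal element (for inclusion of coordinate rings) among the intermediate varieties $V$ between $X$ and $Y$ such that $V\to X$ is centrally subintegral. *)

theory Defs
  imports
    Complex_Main
    "HOL-Algebra.Algebraic_Closure_Type"
    "HOL-Algebra.Generated_Rings"
    "HOL-Computational_Algebra.Fraction_Field"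
    "HOL-Computational_Algebra.Polynomial"
begin

text \<open>
  Rings are subrings of one ambient domain \<open>'b\<close>, viewed as a
  record of HOL-Algebra. The coordinate ring of an irreducible affine variety over the reals is
  a domain that is an algebra over the reals (class \<open>real_algebra_1\<close>) and of finite type
  over the constants \<open>\<real>\<close>.
\<close>

abbreviation subring_record :: "'b::comm_ring_1 set \<Rightarrow> 'b ring" where
  "subring_record C \<equiv> ring_of_type_algebra \<lparr>carrier := C\<rparr>"

definition intermediate_ring :: "'b::comm_ring_1 set \<Rightarrow> 'b set \<Rightarrow> 'b set \<Rightarrow> bool" where
  "intermediate_ring A B C \<longleftrightarrow> subring C ring_of_type_algebra \<and> A \<subseteq> C \<and> C \<subseteq> B"

definition finite_type :: "'b::comm_ring_1 set \<Rightarrow> 'b set \<Rightarrow> bool" where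
  "finite_type A C \<longleftrightarrow>
     (\<exists>S. finite S \<and> S \<subseteq> C \<and> A \<subseteq> C \<and> C = generate_ring ring_of_type_algebra (A \<union> S))"

definition integral_extension :: "'b::comm_ring_1 set \<Rightarrow> 'b set \<Rightarrow> bool" where
  "integral_extension A C \<longleftrightarrow>
     (\<forall>c\<in>C. \<exists>p. (\<forall>i. coeff p i \<in> A) \<and> lead_coeff p = 1 \<and> poly p c = 0)"

text \<open>The fraction field of a subring, realised inside the fraction field of the ambient domain.\<close>

definition fraction_field_of :: "'b::idom set \<Rightarrow> 'b fract set" where
  "fraction_field_of A = {Fraction_Field.Fract a b | a b. a \<in> A \<and> b \<in> A \<and> b \<noteq> 0}"

definition sums_of_squares :: "'k::comm_semiring_1 set \<Rightarrow> 'k set" where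
  "sums_of_squares K = {\<Sum>i<n. (f i)\<^sup>2 | (n::nat) f. \<forall>i<n. f i \<in> K}"

text \<open>
  In the next definition \<open>a\<^sup>2 + b\<close> lives in the fraction field, so membership in \<open>I\<close> means
  membership in the image of \<open>I\<close> there.
\<close>

definition central_ideal :: "'b::idom set \<Rightarrow> 'b set \<Rightarrow> bool" where
  "central_ideal A I \<longleftrightarrow> ideal I (subring_record A) \<and>
     (\<forall>a\<in>A. \<forall>b\<in>sums_of_squares (fraction_field_of A).
        (Fraction_Field.Fract a 1)\<^sup>2 + b \<in> (\<lambda>x. Fraction_Field.Fract x 1) ` I \<longrightarrow> a \<in> I)"

definition C_Spec :: "'b::idom set \<Rightarrow> 'b set set" where
  "C_Spec A = {\<qq>. primeideal \<qq> (subring_record A) \<and> central_ideal A \<qq>}"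

text \<open>
  The residue field \<open>k(\<qq>)\<close> at a prime \<open>\<qq>\<close> of \<open>C\<close>, that is, the fraction field of \<open>C / \<qq>\<close>.
  A fraction is represented by a numerator in \<open>C\<close> and a denominator in \<open>C - \<qq>\<close>;
  \<open>a/s = b/t\<close> holds over \<open>C / \<qq>\<close> iff \<open>a t - b s \<in> \<qq>\<close>.
\<close>

definition residue_rel :: "'b::comm_ring_1 set \<Rightarrow> 'b set \<Rightarrow> (('b \<times> 'b) \<times> ('b \<times> 'b)) set" where
  "residue_rel C \<qq> =
     {((a, s), (b, t)). a \<in> C \<and> s \<in> C - \<qq> \<and> b \<in> C \<and> t \<in> C - \<qq> \<and> a * t - b * s \<in> \<qq>}"

definition residue_field :: "'b::comm_ring_1 set \<Rightarrow> 'b set \<Rightarrow> ('b \<times> 'b) set ring" where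
  "residue_field C \<qq> =
     \<lparr>carrier = (C \<times> (C - \<qq>)) // residue_rel C \<qq>,
      monoid.mult = (\<lambda>U V. \<Union>(a, s)\<in>U. \<Union>(b, t)\<in>V. residue_rel C \<qq> `` {(a * b, s * t)}),
      one = residue_rel C \<qq> `` {(1, 1)},
      ring.zero = residue_rel C \<qq> `` {(0, 1)},
      add = (\<lambda>U V. \<Union>(a, s)\<in>U. \<Union>(b, t)\<in>V. residue_rel C \<qq> `` {(a * t + b * s, s * t)})\<rparr>"

text \<open>
  For a subring \<open>A\<close> of \<open>C\<close>, the canonical map \<open>k(\<qq> \<inter> A) \<rightarrow> k(\<qq>)\<close> sends the class of
  \<open>(a, s)\<close> over \<open>A\<close> to its class over \<open>C\<close>; as equivalence classes, this is the saturation of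
  a class under the relation over \<open>C\<close>.
\<close>

definition residue_map :: "'b::comm_ring_1 set \<Rightarrow> 'b set \<Rightarrow> ('b \<times> 'b) set \<Rightarrow> ('b \<times> 'b) set" where
  "residue_map C \<qq> U = residue_rel C \<qq> `` U"

definition centrally_subintegral :: "'b::idom set \<Rightarrow> 'b set \<Rightarrow> bool" where
  "centrally_subintegral A C \<longleftrightarrow>
     integral_extension A C \<and>
     bij_betw (\<lambda>\<qq>. \<qq> \<inter> A) (C_Spec C) (C_Spec A) \<and>
     (\<forall>\<qq>\<in>C_Spec C. residue_map C \<qq> \<in> ring_iso (residue_field A (\<qq> \<inter> A)) (residue_field C \<qq>))"

definition unique_maximal :: "'c set set \<Rightarrow> 'c set \<Rightarrow> bool" where
  "unique_maximal \<S> M \<longleftrightarrow>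
     (\<forall>N. (N \<in> \<S> \<and> (\<forall>N'\<in>\<S>. N \<subseteq> N' \<longrightarrow> N' = N)) \<longleftrightarrow> N = M)"

definition central_seminormalization_ring :: "'b::idom set \<Rightarrow> 'b set \<Rightarrow> 'b set \<Rightarrow> bool" where
  "central_seminormalization_ring A B C \<longleftrightarrow>
     unique_maximal {D. intermediate_ring A B D \<and> centrally_subintegral A D} C"

text \<open>
  Varieties are given by their coordinate rings. An intermediate variety is an intermediate ring
  that is moreover of finite type over the reals; it is automatically a domain.
\<close>

definition intermediate_variety :: "'b::{idom,real_algebra_1} set \<Rightarrow> 'b set \<Rightarrow> 'b set \<Rightarrow> bool" where
  "intermediate_variety A B V \<longleftrightarrow> intermediate_ring A B V \<and> finite_type \<real> V"

definition central_seminormalization_variety ::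
    "'b::{idom,real_algebra_1} set \<Rightarrow> 'b set \<Rightarrow> 'b set \<Rightarrow> bool" where
  "central_seminormalization_variety A B V \<longleftrightarrow>
     unique_maximal {W. intermediate_variety A B W \<and> centrally_subintegral A W} V"

end

theory Submission
  imports Defs
begin

text \<open>
  Let \<open>A\<close> be the image of \<open>\<real>[X]\<close> in \<open>\<real>[Y]\<close>, and let \<open>M\<close> be the ring generated by all intermediate rings
  centrally subintegral over \<open>A\<close>. If the zero ideal of \<open>A\<close> is not central, then \<open>-1\<close> is a sum of squares in the
  fraction field, central spectra are empty and every integral extension is centrally subintegral.
  Otherwise every centrally subintegral extension is birational. Then elements of \<open>M\<close> have representatives in \<open>A\<close>
  modulo any two central primes over the same prime of \<open>A\<close>, since such elements form a subring; this
  gives injectivity on central spectra and the isomorphisms of residue fields. Surjectivity is central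
  lying over for integral birational extensions. So \<open>M\<close> is the greatest centrally subintegral extension.

  It is an algebra of finite type because it is integral over \<open>A\<close> inside a finitely generated domain:
  \<open>A\<close> is integral over a polynomial ring \<open>N\<close> (Noether normalization), and the integral closure of
  the Noetherian normal ring \<open>N\<close> in a finitely generated field extension is a finite \<open>N\<close>-module. The latter
  goes by induction over the field generators: a transcendental generator is adjoined to \<open>N\<close>, and an algebraic one
  replaces \<open>N\<close> by its integral closure in a simple algebraic extension.
\<close>

text \<open>A ring between two finitely generated algebras need not be finitely generated, or even
  Noetherian, so the finite type of \<open>M\<close> cannot come from the outer ring alone:
  integrality over \<open>A\<close> has to enter. As \<open>A\<close> is not normal in general,
  finiteness is proved over a polynomial subring \<open>N\<close>. The argument needs the conjugates
  of a field generator and separable minimal polynomials; hence domains are embedded in the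
  algebraic closure of their fraction field, and the instance below carries characteristic zero
  along.

  On the central side, the sums of squares in the definition of a central ideal of \<open>M\<close>
  are taken in the fraction field of \<open>M\<close>. A central prime of \<open>A\<close> can
  control them because this field is also the fraction field of \<open>A\<close>. Birationality
  itself comes from the bijection on central primes: the central prime above {0} is again {0}, and
  the isomorphism of residue fields there is one of fraction fields.\<close>

instance fract :: ("{idom,ring_char_0}") field_char_0
proof
  show "inj (of_nat :: nat \<Rightarrow> 'a fract)"
    by (intro injI) (simp add: of_nat_fract eq_fract)
qed

section \<open>Subrings and spans\<close>

text \<open>Subrings are handled as plain sets; \<open>subring_iff_is_subring\<close> links them to
  the records of the statement.\<close>

definition is_subring :: "'a::comm_ring_1 set \<Rightarrow> bool" where
  "is_subring R \<longleftrightarrow> 1 \<in> R \<and> (\<forall>x\<in>R. \<forall>y\<in>R. x - y \<in> R \<and> x * y \<in> R)"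

lemma is_subringD:
  assumes "is_subring R"
  shows "0 \<in> R" "1 \<in> R" "x \<in> R \<Longrightarrow> -x \<in> R" "x \<in> R \<Longrightarrow> y \<in> R \<Longrightarrow> x + y \<in> R"
    "x \<in> R \<Longrightarrow> y \<in> R \<Longrightarrow> x - y \<in> R" "x \<in> R \<Longrightarrow> y \<in> R \<Longrightarrow> x * y \<in> R"
proof -
  show 1: "1 \<in> R" and m: "\<And>x y. x \<in> R \<Longrightarrow> y \<in> R \<Longrightarrow> x - y \<in> R"
    and "x \<in> R \<Longrightarrow> y \<in> R \<Longrightarrow> x * y \<in> R"
    using assms by (auto simp: is_subring_def)
  show 0: "0 \<in> R" using m[OF 1 1] by simp
  show n: "-x \<in> R" if "x \<in> R" for x using m[OF 0 that] by simp
  show "x + y \<in> R" if "x \<in> R" "y \<in> R" for x y using m[OF that(1) n[OF that(2)]] by simp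
qed

lemma is_subring_sum: "is_subring R \<Longrightarrow> (\<And>i. i \<in> I \<Longrightarrow> f i \<in> R) \<Longrightarrow> sum f I \<in> R"
  by (induction I rule: infinite_finite_induct) (auto simp: is_subringD)

lemma is_subring_prod: "is_subring R \<Longrightarrow> (\<And>i. i \<in> I \<Longrightarrow> f i \<in> R) \<Longrightarrow> prod f I \<in> R"
  by (induction I rule: infinite_finite_induct) (auto simp: is_subringD)

lemma is_subring_power: "is_subring R \<Longrightarrow> x \<in> R \<Longrightarrow> x ^ n \<in> R"
  by (induction n) (auto simp: is_subringD)

lemma is_subring_of_nat: "is_subring R \<Longrightarrow> of_nat n \<in> R"
  by (induction n) (auto simp: is_subringD)

definition ring_hull :: "'a::comm_ring_1 set \<Rightarrow> 'a set" where
  "ring_hull S = is_subring hull S"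

lemma is_subring_ring_hull: "is_subring (ring_hull S)"
  unfolding ring_hull_def by (rule hull_in) (auto simp: is_subring_def)

lemma ring_hull_subset: "S \<subseteq> ring_hull S"
  unfolding ring_hull_def by (rule hull_subset)

lemma ring_hull_least: "S \<subseteq> R \<Longrightarrow> is_subring R \<Longrightarrow> ring_hull S \<subseteq> R"
  unfolding ring_hull_def by (rule hull_minimal)

lemma ring_hull_mono: "S \<subseteq> T \<Longrightarrow> ring_hull S \<subseteq> ring_hull T"
  by (meson is_subring_ring_hull order_trans ring_hull_least ring_hull_subset)

lemma ring_hull_eq: "is_subring R \<Longrightarrow> ring_hull R = R"
  by (simp add: ring_hull_least ring_hull_subset subset_antisym)

text \<open>Linear combinations grow term by term, so facts about them follow by induction without
  index sets. For a subring \<open>R\<close> and \<open>V \<subseteq> R\<close> this is the ideal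
  generated by \<open>V\<close>.\<close>

inductive_set lspan :: "'a::comm_ring_1 set \<Rightarrow> 'a set \<Rightarrow> 'a set" for R V where
  zero: "0 \<in> lspan R V"
| step: "r \<in> R \<Longrightarrow> v \<in> V \<Longrightarrow> x \<in> lspan R V \<Longrightarrow> r * v + x \<in> lspan R V"

lemma lspan_scaled_base: "r \<in> R \<Longrightarrow> v \<in> V \<Longrightarrow> r * v \<in> lspan R V"
  using lspan.step[OF _ _ lspan.zero] by fastforce

lemma lspan_base: "is_subring R \<Longrightarrow> v \<in> V \<Longrightarrow> v \<in> lspan R V"
  using lspan_scaled_base[of 1 R v V] by (simp add: is_subringD)

lemma lspan_add: "x \<in> lspan R V \<Longrightarrow> y \<in> lspan R V \<Longrightarrow> x + y \<in> lspan R V"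
  by (induction rule: lspan.induct) (auto simp: add.assoc lspan.step)

lemma lspan_scale:
  assumes "is_subring R" "r \<in> R" "x \<in> lspan R V"
  shows "r * x \<in> lspan R V"
  using assms(3)
proof induction
  case (step s v x)
  then have "(r * s) * v + r * x \<in> lspan R V" using assms by (intro lspan.step) (auto simp: is_subringD)
  then show ?case by (simp add: algebra_simps)
qed (auto intro: lspan.zero)

lemma lspan_uminus: "is_subring R \<Longrightarrow> x \<in> lspan R V \<Longrightarrow> - x \<in> lspan R V"
  using lspan_scale[of R "-1" x V] by (simp add: is_subringD)

lemma lspan_diff: "is_subring R \<Longrightarrow> x \<in> lspan R V \<Longrightarrow> y \<in> lspan R V \<Longrightarrow> x - y \<in> lspan R V"
  using lspan_add[of x R V "-y"] lspan_uminus[of R y V] by simp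

lemma lspan_sum: "(\<And>i. i \<in> I \<Longrightarrow> f i \<in> lspan R V) \<Longrightarrow> sum f I \<in> lspan R V"
  by (induction I rule: infinite_finite_induct) (auto intro: lspan.zero lspan_add)

lemma lspan_least:
  assumes "\<And>r v. r \<in> R \<Longrightarrow> v \<in> V \<Longrightarrow> r * v \<in> M" "0 \<in> M" "\<And>x y. x \<in> M \<Longrightarrow> y \<in> M \<Longrightarrow> x + y \<in> M"
  shows "lspan R V \<subseteq> M"
proof
  fix x assume "x \<in> lspan R V"
  then show "x \<in> M" by induction (use assms in auto)
qed

lemma lspan_mono: "R \<subseteq> R' \<Longrightarrow> V \<subseteq> V' \<Longrightarrow> lspan R V \<subseteq> lspan R' V'"
  by (rule lspan_least) (auto intro: lspan.zero lspan_add lspan_scaled_base)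

lemma lspan_trans: "is_subring R \<Longrightarrow> V \<subseteq> lspan R W \<Longrightarrow> lspan R V \<subseteq> lspan R W"
  by (rule lspan_least) (auto intro: lspan.zero lspan_add lspan_scale)

lemma lspan_subset_subring: "is_subring R \<Longrightarrow> N \<subseteq> R \<Longrightarrow> V \<subseteq> R \<Longrightarrow> lspan N V \<subseteq> R"
  by (rule lspan_least) (auto simp: is_subringD subset_iff)

lemma lspan_one: "is_subring R \<Longrightarrow> R \<subseteq> lspan R {1}"
  using lspan_scaled_base[of _ R 1 "{1}"] by auto

definition prod_set :: "'a::comm_ring_1 set \<Rightarrow> 'a set \<Rightarrow> 'a set" where
  "prod_set V W = (\<lambda>(v, w). v * w) ` (V \<times> W)"

lemma finite_prod_set: "finite V \<Longrightarrow> finite W \<Longrightarrow> finite (prod_set V W)"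
  by (simp add: prod_set_def)

lemma prod_setI: "v \<in> V \<Longrightarrow> w \<in> W \<Longrightarrow> v * w \<in> prod_set V W"
  by (force simp: prod_set_def)

lemma lspan_mult:
  assumes R: "is_subring R" and x: "x \<in> lspan R V" and y: "y \<in> lspan R W"
  shows "x * y \<in> lspan R (prod_set V W)"
proof -
  have *: "v * y \<in> lspan R (prod_set V W)" if "v \<in> V" for v
    using y
  proof induction
    case (step r w y)
    have "r * (v * w) + v * y \<in> lspan R (prod_set V W)"
      using step that by (intro lspan.step prod_setI)
    then show ?case by (simp add: algebra_simps)
  qed (auto intro: lspan.zero)
  show ?thesis using x
  proof induction
    case (step r v x)
    have "r * (v * y) + x * y \<in> lspan R (prod_set V W)"
      using step * by (intro lspan_add[OF lspan_scale[OF R]])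
    then show ?case by (simp add: algebra_simps)
  qed (auto intro: lspan.zero)
qed

text \<open>Transitivity of module finiteness: products of generators generate.\<close>

lemma lspan_tower:
  assumes R: "is_subring R" and "R' \<subseteq> lspan R V"
  shows "lspan R' W \<subseteq> lspan R (prod_set V W)"
  by (rule lspan_least) (use assms lspan_base[OF R] in \<open>auto intro: lspan.zero lspan_add intro!: lspan_mult\<close>)

lemma lspan_finite_subset:
  assumes "finite F" "F \<subseteq> lspan R P"
  shows "\<exists>W. finite W \<and> W \<subseteq> P \<and> F \<subseteq> lspan R W"
proof -
  have *: "\<exists>W. finite W \<and> W \<subseteq> P \<and> x \<in> lspan R W" if "x \<in> lspan R P" for x
    using that
  proof induction
    case zero
    show ?case by (rule exI[of _ "{}"]) (auto intro: lspan.zero)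
  next
    case (step r v x)
    then obtain W where W: "finite W" "W \<subseteq> P" "x \<in> lspan R W" by auto
    have "x \<in> lspan R (insert v W)" using W(3) lspan_mono[of R R W "insert v W"] by auto
    then show ?case using W step by (intro exI[of _ "insert v W"]) (auto intro: lspan.step)
  qed
  show ?thesis using assms
  proof (induction F)
    case (insert x F)
    then obtain W W' where "finite W" "W \<subseteq> P" "F \<subseteq> lspan R W" "finite W'" "W' \<subseteq> P" "x \<in> lspan R W'"
      using * by (metis insert_subset)
    then show ?case using lspan_mono[of R R W "W \<union> W'"] lspan_mono[of R R W' "W \<union> W'"]
      by (intro exI[of _ "W \<union> W'"]) auto
  qed auto
qed

lemma lspan_insertE:
  assumes R: "is_subring R" and "x \<in> lspan R (insert v V)"
  obtains r y where "r \<in> R" "y \<in> lspan R V" "x = r * v + y"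
proof -
  have "\<exists>r y. r \<in> R \<and> y \<in> lspan R V \<and> x = r * v + y" using assms(2)
  proof induction
    case zero
    show ?case using is_subringD[OF R] by (intro exI[of _ 0]) (auto intro: lspan.zero)
  next
    case (step s w x)
    then obtain r y where *: "r \<in> R" "y \<in> lspan R V" "x = r * v + y" by auto
    show ?case
    proof (cases "w = v")
      case True
      then show ?thesis using * step is_subringD(4)[OF R]
        by (intro exI[of _ "s + r"] exI[of _ y]) (auto simp: algebra_simps)
    next
      case False
      then show ?thesis using * step
        by (intro exI[of _ "r"] exI[of _ "s * w + y"]) (simp add: algebra_simps lspan.step lspan.step[simplified add.commute])
    qed
  qed
  then show ?thesis using that by blast
qed

section \<open>Noetherian subrings\<close>

text \<open>Phrased for arbitrary subsets instead of ideals: finitely many generators of the ideal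
  generated by \<open>S\<close> can be picked from \<open>S\<close> itself, a choice that later
  proofs rely on.\<close>

definition noetherian :: "'a::comm_ring_1 set \<Rightarrow> bool" where
  "noetherian R \<longleftrightarrow> (\<forall>S\<subseteq>R. \<exists>W. finite W \<and> W \<subseteq> S \<and> S \<subseteq> lspan R W)"

text \<open>Induction on the number of generators: the coefficients of \<open>S\<close> along
  \<open>v\<close> form a subset of \<open>R\<close>, so finitely many elements of \<open>S\<close>
  suffice to cancel the \<open>v\<close>-part of all others, and the differences live on one
  generator fewer.\<close>

lemma noetherian_module:
  assumes R: "is_subring R" "noetherian R" and "finite V" "S \<subseteq> lspan R V"
  shows "\<exists>W. finite W \<and> W \<subseteq> S \<and> S \<subseteq> lspan R W"
  using assms(3,4)
proof (induction V arbitrary: S rule: finite_induct)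
  case empty
  have "lspan R {} \<subseteq> {0}" by (rule lspan_least) auto
  then show ?case using empty by (intro exI[of _ "{}"]) (auto intro: lspan.zero)
next
  case (insert v V)
  have "\<forall>s\<in>S. \<exists>r y. r \<in> R \<and> y \<in> lspan R V \<and> s = r * v + y"
    using insert.prems lspan_insertE[OF R(1)] by (metis subsetD)
  then obtain c y where c: "\<And>s. s \<in> S \<Longrightarrow> c s \<in> R" "\<And>s. s \<in> S \<Longrightarrow> y s \<in> lspan R V"
      "\<And>s. s \<in> S \<Longrightarrow> s = c s * v + y s" by metis
  obtain C where C: "finite C" "C \<subseteq> c ` S" "c ` S \<subseteq> lspan R C"
    using R(2) c(1) unfolding noetherian_def by (metis image_subsetI)
  obtain U where U: "finite U" "U \<subseteq> S" "C = c ` U" using C by (meson finite_subset_image)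
  \<comment> \<open>Combining the elements of \<open>U\<close> in the way their coefficients combine
    to \<open>x\<close> reaches \<open>x * v\<close> up to the span of \<open>V\<close>.\<close>
  have lift: "\<exists>u\<in>lspan R U. x * v - u \<in> lspan R V" if "x \<in> lspan R C" for x
    using that
  proof induction
    case zero
    show ?case by (rule bexI[of _ 0]) (auto intro: lspan.zero)
  next
    case (step r k x)
    obtain u where u: "u \<in> lspan R U" "x * v - u \<in> lspan R V" using step by auto
    obtain s where s: "s \<in> U" "k = c s" using step U by auto
    have "k * v - s = - y s" using c(3)[of s] s U(2) by (auto simp: algebra_simps)
    then have "k * v - s \<in> lspan R V" using lspan_uminus[OF R(1) c(2)[of s]] s U(2) by auto
    then have "r * (k * v - s) + (x * v - u) \<in> lspan R V" using step u R by (intro lspan_add lspan_scale)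
    then have "r * k * v + x * v - (r * s + u) \<in> lspan R V" by (simp add: algebra_simps)
    then show ?case using lspan.step[OF step(1) s(1) u(1)]
      by (intro bexI[of _ "r * s + u"]) (simp_all add: algebra_simps)
  qed
  have "\<exists>u\<in>lspan R U. s - u \<in> lspan R V" if s: "s \<in> S" for s
  proof -
    obtain u where u: "u \<in> lspan R U" "c s * v - u \<in> lspan R V" using lift[of "c s"] C s by auto
    have "(c s * v - u) + y s \<in> lspan R V" using u c(2)[OF s] lspan_add by auto
    moreover have "(c s * v - u) + y s = s - u" using c(3)[OF s] by (simp add: algebra_simps)
    ultimately show ?thesis using u by auto
  qed
  then obtain u where u: "\<And>s. s \<in> S \<Longrightarrow> u s \<in> lspan R U" "\<And>s. s \<in> S \<Longrightarrow> s - u s \<in> lspan R V" by metis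
  obtain W where W: "finite W" "W \<subseteq> (\<lambda>s. s - u s) ` S" "(\<lambda>s. s - u s) ` S \<subseteq> lspan R W"
    using insert.IH[of "(\<lambda>s. s - u s) ` S"] u(2) by auto
  then obtain T where T: "finite T" "T \<subseteq> S" "W = (\<lambda>s. s - u s) ` T" by (meson finite_subset_image)
  have U': "lspan R U \<subseteq> lspan R (U \<union> T)" by (rule lspan_mono) auto
  have "W \<subseteq> lspan R (U \<union> T)"
    using T(2,3) u(1) U' lspan_base[OF R(1), of _ "U \<union> T"] by (auto intro!: lspan_diff[OF R(1)])
  then have W': "lspan R W \<subseteq> lspan R (U \<union> T)" by (rule lspan_trans[OF R(1)])
  have "s \<in> lspan R (U \<union> T)" if "s \<in> S" for s
  proof -
    have "s - u s \<in> lspan R (U \<union> T)" "u s \<in> lspan R (U \<union> T)" using W W' U' u(1) that by auto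
    from lspan_add[OF this] show ?thesis by simp
  qed
  then show ?case using U T by (intro exI[of _ "U \<union> T"]) auto
qed

lemma noetherian_finite_extension:
  assumes "is_subring R" "noetherian R" "finite V" "R' \<subseteq> lspan R V" "R \<subseteq> R'"
  shows "noetherian R'"
  unfolding noetherian_def
proof (intro allI impI)
  fix S assume "S \<subseteq> R'"
  then obtain W where "finite W" "W \<subseteq> S" "S \<subseteq> lspan R W" using noetherian_module assms by (metis order_trans)
  then show "\<exists>W. finite W \<and> W \<subseteq> S \<and> S \<subseteq> lspan R' W"
    using lspan_mono[OF assms(5), of W W] by blast
qed

definition subfield_set :: "'a::field set \<Rightarrow> bool" where
  "subfield_set K \<longleftrightarrow> is_subring K \<and> (\<forall>x\<in>K. inverse x \<in> K)"

lemma subfield_set_divide: "subfield_set K \<Longrightarrow> x \<in> K \<Longrightarrow> y \<in> K \<Longrightarrow> x / y \<in> K"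
  by (simp add: subfield_set_def divide_inverse is_subringD)

lemma noetherian_subfield:
  assumes "subfield_set K"
  shows "noetherian K"
  unfolding noetherian_def
proof (intro allI impI)
  fix S assume S: "S \<subseteq> K"
  show "\<exists>W. finite W \<and> W \<subseteq> S \<and> S \<subseteq> lspan K W"
  proof (cases "S \<subseteq> {0}")
    case True
    then show ?thesis by (intro exI[of _ "{}"]) (auto intro: lspan.zero)
  next
    case False
    then obtain w where w: "w \<in> S" "w \<noteq> 0" by auto
    have "(s / w) * w \<in> lspan K {w}" if "s \<in> S" for s
      using that S w assms by (intro lspan_scaled_base subfield_set_divide) auto
    then show ?thesis using w by (intro exI[of _ "{w}"]) auto
  qed
qed

section \<open>Ring homomorphisms and images of subrings and spans\<close>

definition is_hom :: "('a::comm_ring_1 \<Rightarrow> 'b::comm_ring_1) \<Rightarrow> bool" where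
  "is_hom f \<longleftrightarrow> f 1 = 1 \<and> (\<forall>x y. f (x + y) = f x + f y) \<and> (\<forall>x y. f (x * y) = f x * f y)"

lemma is_homD:
  assumes "is_hom f"
  shows "f 1 = 1" "f (x + y) = f x + f y" "f (x * y) = f x * f y" "f 0 = 0" "f (-x) = - f x" "f (x - y) = f x - f y"
proof -
  show 1: "f 1 = 1" "f (x + y) = f x + f y" "f (x * y) = f x * f y" for x y
    using assms by (auto simp: is_hom_def)
  show 0: "f 0 = 0" using 1(2)[of 0 0] by simp
  show 2: "f (-x) = - f x" for x using 1(2)[of x "-x"] 0 by (simp add: eq_neg_iff_add_eq_0 add.commute)
  show "f (x - y) = f x - f y" using 1(2)[of x "-y"] 2 by simp
qed

lemma is_subring_image:
  assumes f: "is_hom f" and R: "is_subring R"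
  shows "is_subring (f ` R)"
  unfolding is_subring_def
proof (intro conjI ballI)
  show "1 \<in> f ` R" using is_homD(1)[OF f] is_subringD(2)[OF R] by (metis imageI)
  fix x y assume "x \<in> f ` R" "y \<in> f ` R"
  then obtain a b where ab: "a \<in> R" "b \<in> R" "x = f a" "y = f b" by blast
  have "x - y = f (a - b)" "x * y = f (a * b)" using ab by (simp_all add: is_homD[OF f])
  moreover have "a - b \<in> R" "a * b \<in> R" using ab is_subringD[OF R] by auto
  ultimately show "x - y \<in> f ` R" "x * y \<in> f ` R" by auto
qed

lemma is_subring_vimage: "is_hom f \<Longrightarrow> is_subring R \<Longrightarrow> is_subring (f -` R)"
  by (auto simp: is_subring_def is_homD)

lemma lspan_image:
  assumes "is_hom f"
  shows "f ` lspan R V = lspan (f ` R) (f ` V)"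
proof
  show "f ` lspan R V \<subseteq> lspan (f ` R) (f ` V)"
  proof
    fix y assume "y \<in> f ` lspan R V"
    then obtain x where "x \<in> lspan R V" "y = f x" by auto
    from this(1) have "f x \<in> lspan (f ` R) (f ` V)"
      by induction (auto simp: is_homD[OF assms] lspan.step intro: lspan.zero)
    then show "y \<in> lspan (f ` R) (f ` V)" using \<open>y = f x\<close> by simp
  qed
  show "lspan (f ` R) (f ` V) \<subseteq> f ` lspan R V"
  proof (rule lspan_least)
    show "0 \<in> f ` lspan R V" using is_homD(4)[OF assms] lspan.zero by (metis imageI)
    show "r * v \<in> f ` lspan R V" if "r \<in> f ` R" "v \<in> f ` V" for r v
      using that by (auto intro!: imageI lspan_scaled_base simp flip: is_homD(3)[OF assms])
    show "x + y \<in> f ` lspan R V" if "x \<in> f ` lspan R V" "y \<in> f ` lspan R V" for x y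
      using that by (auto intro!: imageI lspan_add simp flip: is_homD(2)[OF assms])
  qed
qed

lemma ring_hull_image:
  assumes f: "is_hom f"
  shows "f ` ring_hull S = ring_hull (f ` S)"
proof
  have "ring_hull S \<subseteq> f -` ring_hull (f ` S)"
    using f ring_hull_subset[of "f ` S"] by (intro ring_hull_least is_subring_vimage is_subring_ring_hull) auto
  then show "f ` ring_hull S \<subseteq> ring_hull (f ` S)" by auto
  show "ring_hull (f ` S) \<subseteq> f ` ring_hull S"
    using f by (intro ring_hull_least is_subring_image is_subring_ring_hull image_mono ring_hull_subset)
qed

lemma noetherian_image:
  assumes "is_hom f" "noetherian R"
  shows "noetherian (f ` R)"
  unfolding noetherian_def
proof (intro allI impI)
  fix S assume S: "S \<subseteq> f ` R"
  obtain W where W: "finite W" "W \<subseteq> {r \<in> R. f r \<in> S}" "{r \<in> R. f r \<in> S} \<subseteq> lspan R W"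
    using assms(2) unfolding noetherian_def by (metis (lifting) mem_Collect_eq subsetI)
  have "S \<subseteq> f ` {r \<in> R. f r \<in> S}" using S by auto
  also have "\<dots> \<subseteq> lspan (f ` R) (f ` W)" using W(3) lspan_image[OF assms(1)] by blast
  finally show "\<exists>W. finite W \<and> W \<subseteq> S \<and> S \<subseteq> lspan (f ` R) W"
    using W by (intro exI[of _ "f ` W"]) auto
qed

section \<open>Polynomials with coefficients in a subring, and Hilbert's basis theorem\<close>

definition pol :: "'a::comm_ring_1 set \<Rightarrow> 'a poly set" where
  "pol R = {p. \<forall>i. coeff p i \<in> R}"

lemma coeff_pol: "p \<in> pol R \<Longrightarrow> coeff p i \<in> R"
  by (simp add: pol_def)

lemma pol_mono: "R \<subseteq> S \<Longrightarrow> pol R \<subseteq> pol S"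
  by (auto simp: pol_def)

lemma is_subring_pol: "is_subring R \<Longrightarrow> is_subring (pol R)"
  unfolding is_subring_def[of "pol R"]
  by (auto simp: pol_def coeff_mult is_subringD intro!: is_subring_sum)

lemma monom_pol: "is_subring R \<Longrightarrow> r \<in> R \<Longrightarrow> monom r n \<in> pol R"
  by (simp add: pol_def is_subringD)

lemma pCons_pol: "pCons a p \<in> pol R \<longleftrightarrow> a \<in> R \<and> p \<in> pol R"
  by (auto simp: pol_def coeff_pCons split: nat.splits)

lemma zero_pol: "is_subring R \<Longrightarrow> 0 \<in> pol R"
  by (simp add: is_subringD is_subring_pol)

lemma const_pol: "is_subring R \<Longrightarrow> r \<in> R \<Longrightarrow> [:r:] \<in> pol R"
  by (simp add: pCons_pol zero_pol)

lemma smult_pol: "is_subring R \<Longrightarrow> r \<in> R \<Longrightarrow> p \<in> pol R \<Longrightarrow> smult r p \<in> pol R"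
  by (simp add: pol_def is_subringD)

lemma pderiv_pol: "is_subring R \<Longrightarrow> p \<in> pol R \<Longrightarrow> pderiv p \<in> pol R"
  by (simp add: pol_def coeff_pderiv is_subringD is_subring_of_nat del: of_nat_Suc)

lemma pcompose_pol: "is_subring R \<Longrightarrow> p \<in> pol R \<Longrightarrow> q \<in> pol R \<Longrightarrow> pcompose p q \<in> pol R"
proof (induction p)
  case (pCons a p)
  then show ?case using is_subringD[OF is_subring_pol[of R]]
    by (simp add: pcompose_pCons pCons_pol const_pol)
qed simp

lemma poly_in_subring: "is_subring R \<Longrightarrow> p \<in> pol R \<Longrightarrow> x \<in> R \<Longrightarrow> poly p x \<in> R"
  by (induction p) (auto simp: pCons_pol is_subringD)

lemma is_hom_poly: "is_hom (\<lambda>p. poly p x)"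
  by (simp add: is_hom_def)

lemma is_hom_const: "is_hom (\<lambda>r. [:r:])"
  by (simp add: is_hom_def pCons_one)

text \<open>Multiplying each \<open>g\<close> by the monomial that raises it to degree
  \<open>n\<close> realises a combination of leading coefficients as one coefficient of a
  combination of polynomials; this cancels top terms in Hilbert's argument.\<close>

lemma lead_coeff_span_lift:
  fixes R :: "'a::comm_ring_1 set"
  assumes R: "is_subring R" and G: "\<And>g. g \<in> G \<Longrightarrow> degree g \<le> n" and c: "c \<in> lspan R (lead_coeff ` G)"
  shows "\<exists>q\<in>lspan (pol R) G. degree q \<le> n \<and> coeff q n = c"
  using c
proof induction
  case zero
  show ?case by (rule bexI[of _ 0]) (auto intro: lspan.zero)
next
  case (step r v c)
  obtain q where q: "q \<in> lspan (pol R) G" "degree q \<le> n" "coeff q n = c" using step by auto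
  obtain g where g: "g \<in> G" "v = lead_coeff g" using step by auto
  define h where "h = monom r (n - degree g) * g"
  have "degree h \<le> degree (monom r (n - degree g)) + degree g"
    unfolding h_def by (rule degree_mult_le)
  also have "\<dots> \<le> n" using degree_monom_le[of r "n - degree g"] G[OF g(1)] by simp
  finally have "degree (h + q) \<le> n" using q by (simp add: degree_add_le)
  moreover have "coeff (h + q) n = r * v + c"
    using q g G[OF g(1)] by (simp add: h_def coeff_monom_mult)
  moreover have "h + q \<in> lspan (pol R) G"
    unfolding h_def using step q g monom_pol[OF R] by (intro lspan.step) auto
  ultimately show ?case by blast
qed

text \<open>Finitely many polynomials \<open>G\<close> account for all leading coefficients of the
  ideal \<open>I\<close>, so subtracting combinations of them reduces any element of
  \<open>I\<close> to degree at most \<open>d\<close>; what is left lies in a finite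
  \<open>R\<close>-module.\<close>

theorem noetherian_pol:
  fixes R :: "'a::comm_ring_1 set"
  assumes R: "is_subring R" "noetherian R"
  shows "noetherian (pol R)"
  unfolding noetherian_def
proof (intro allI impI)
  fix S assume S: "S \<subseteq> pol R"
  note P = is_subring_pol[OF R(1)]
  define I where "I = lspan (pol R) S"
  have I: "I \<subseteq> pol R" unfolding I_def using P S by (intro lspan_subset_subring) auto
  have "lead_coeff ` I \<subseteq> R" using I by (auto simp: coeff_pol)
  then obtain C where C: "finite C" "C \<subseteq> lead_coeff ` I" "lead_coeff ` I \<subseteq> lspan R C"
    using R(2) unfolding noetherian_def by metis
  then obtain G where G: "finite G" "G \<subseteq> I" "C = lead_coeff ` G" by (meson finite_subset_image)
  define d where "d = (\<Sum>g\<in>G. degree g)"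
  have d: "degree g \<le> d" if "g \<in> G" for g
    unfolding d_def using that G(1) by (intro member_le_sum) auto
  \<comment> \<open>A copy of \<open>R\<close> as constant polynomials, since scalars and vectors of
    \<open>lspan\<close> have the same type.\<close>
  let ?R = "(\<lambda>r. [:r:]) ` R"
  have R': "is_subring ?R" "noetherian ?R"
    using R is_hom_const by (auto intro: is_subring_image noetherian_image)
  define I' where "I' = {p \<in> I. degree p \<le> d}"
  have "I' \<subseteq> lspan ?R ((\<lambda>i. monom 1 i) ` {..d})"
  proof
    fix p assume p: "p \<in> I'"
    have "p = (\<Sum>i\<le>d. [:coeff p i:] * monom 1 i)"
      using p poly_as_sum_of_monoms'[of p d] by (simp add: I'_def smult_monom)
    also have "\<dots> \<in> lspan ?R ((\<lambda>i. monom 1 i) ` {..d})"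
      using p I by (intro lspan_sum lspan_scaled_base) (auto simp: I'_def coeff_pol)
    finally show "p \<in> lspan ?R ((\<lambda>i. monom 1 i) ` {..d})" .
  qed
  then obtain U where U: "finite U" "U \<subseteq> I'" "I' \<subseteq> lspan ?R U"
    using noetherian_module[OF R'] by (metis finite_atMost finite_imageI)
  have "lspan ?R U \<subseteq> lspan (pol R) (G \<union> U)"
    using R(1) by (intro lspan_mono) (auto simp: const_pol)
  then have U': "I' \<subseteq> lspan (pol R) (G \<union> U)" using U by auto
  have GU: "G \<union> U \<subseteq> I" using G U by (auto simp: I'_def)
  have main: "p \<in> I \<Longrightarrow> p \<in> lspan (pol R) (G \<union> U)" for p
  proof (induction "degree p" arbitrary: p rule: less_induct)
    case less
    show ?case
    proof (cases "degree p \<le> d")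
      case True
      then show ?thesis using U' less.prems by (auto simp: I'_def)
    next
      case False
      have "lead_coeff p \<in> lspan R (lead_coeff ` G)" using C G less.prems by auto
      then obtain q where q: "q \<in> lspan (pol R) G" "degree q \<le> degree p" "coeff q (degree p) = lead_coeff p"
        using lead_coeff_span_lift[OF R(1), of G "degree p"] d False by (metis le_trans nat_le_linear)
      have "q \<in> I" using q(1) lspan_trans[OF P, of G S] G(2) by (auto simp: I_def)
      then have "p - q \<in> I" using less.prems P lspan_diff unfolding I_def by blast
      moreover have "degree (p - q) \<le> degree p" using q by (simp add: degree_diff_le)
      moreover have "coeff (p - q) (degree p) = 0" using q by simp
      ultimately have "p - q \<in> lspan (pol R) (G \<union> U)"
        using less.hyps[of "p - q"] False
        by (metis eq_zero_or_degree_less lspan.zero)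
      moreover have "q \<in> lspan (pol R) (G \<union> U)" using q(1) lspan_mono[of "pol R" "pol R" G "G \<union> U"] by auto
      ultimately show ?thesis using lspan_add[of "p - q" "pol R" "G \<union> U" q] by simp
    qed
  qed
  \<comment> \<open>The generators found so far lie in \<open>I\<close>, not in \<open>S\<close>;
    each is a combination of finitely many elements of \<open>S\<close>.\<close>
  obtain W where W: "finite W" "W \<subseteq> S" "G \<union> U \<subseteq> lspan (pol R) W"
    using lspan_finite_subset[of "G \<union> U" "pol R" S] G U GU unfolding I_def by auto
  have "S \<subseteq> lspan (pol R) (G \<union> U)" using main lspan_base[OF P] by (auto simp: I_def)
  also have "\<dots> \<subseteq> lspan (pol R) W" using lspan_trans[OF P W(3)] .
  finally show "\<exists>W. finite W \<and> W \<subseteq> S \<and> S \<subseteq> lspan (pol R) W" using W by auto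
qed

section \<open>Adjoining elements to a subring\<close>

definition adjoin :: "'a::comm_ring_1 set \<Rightarrow> 'a \<Rightarrow> 'a set" where
  "adjoin R x = (\<lambda>p. poly p x) ` pol R"

lemma is_subring_adjoin: "is_subring R \<Longrightarrow> is_subring (adjoin R x)"
  unfolding adjoin_def by (intro is_subring_image is_hom_poly is_subring_pol)

lemma noetherian_adjoin: "is_subring R \<Longrightarrow> noetherian R \<Longrightarrow> noetherian (adjoin R x)"
  unfolding adjoin_def by (intro noetherian_image is_hom_poly noetherian_pol)

lemma adjoin_base: "is_subring R \<Longrightarrow> R \<subseteq> adjoin R x"
  unfolding adjoin_def by (auto intro!: image_eqI[of _ _ "[:_:]"] const_pol)

lemma adjoin_gen: "is_subring R \<Longrightarrow> x \<in> adjoin R x"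
  unfolding adjoin_def by (auto intro!: image_eqI[of _ _ "[:0, 1:]"] simp: pCons_pol zero_pol is_subringD)

lemma adjoin_least: "is_subring S \<Longrightarrow> R \<subseteq> S \<Longrightarrow> x \<in> S \<Longrightarrow> adjoin R x \<subseteq> S"
  unfolding adjoin_def using poly_in_subring[of S] pol_mono[of R S] by auto

lemma ring_hull_insert: "ring_hull (insert x S) = adjoin (ring_hull S) x"
proof
  show "ring_hull (insert x S) \<subseteq> adjoin (ring_hull S) x"
    using adjoin_base[of "ring_hull S" x] adjoin_gen[of "ring_hull S" x] ring_hull_subset[of S]
    by (intro ring_hull_least is_subring_adjoin) (auto simp: is_subring_ring_hull)
  show "adjoin (ring_hull S) x \<subseteq> ring_hull (insert x S)"
    using ring_hull_subset[of "insert x S"] by (intro adjoin_least is_subring_ring_hull ring_hull_mono) auto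
qed

lemma noetherian_ring_hull:
  assumes "is_subring R" "noetherian R" "finite E"
  shows "noetherian (ring_hull (R \<union> E))"
  using assms(3)
  by induction (use assms in \<open>auto simp: ring_hull_eq ring_hull_insert intro!: noetherian_adjoin is_subring_ring_hull\<close>)

section \<open>Integral elements\<close>

definition is_integral :: "'a::comm_ring_1 set \<Rightarrow> 'a \<Rightarrow> bool" where
  "is_integral R x \<longleftrightarrow> (\<exists>p\<in>pol R. lead_coeff p = 1 \<and> poly p x = 0)"

lemma is_integral_mono: "is_integral R x \<Longrightarrow> R \<subseteq> S \<Longrightarrow> is_integral S x"
  using pol_mono unfolding is_integral_def by blast

lemma is_integral_base: "is_subring R \<Longrightarrow> x \<in> R \<Longrightarrow> is_integral R x"
  unfolding is_integral_def by (intro bexI[of _ "[:-x, 1:]"]) (auto simp: pCons_pol zero_pol is_subringD)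

text \<open>The monic equation rewrites \<open>x ^ n\<close> in lower powers, so the span of the
  powers below the degree \<open>n\<close> is stable under multiplication by
  \<open>x\<close>.\<close>

lemma adjoin_integral_span:
  assumes R: "is_subring R" and x: "is_integral R x"
  shows "\<exists>V. finite V \<and> adjoin R x \<subseteq> lspan R V"
proof -
  obtain p where p: "p \<in> pol R" "lead_coeff p = 1" "poly p x = 0" using x by (auto simp: is_integral_def)
  define n where "n = degree p"
  define V where "V = (\<lambda>i. x ^ i) ` {..<n}"
  have "0 = (\<Sum>i\<le>n. coeff p i * x ^ i)" using p(3) by (simp add: poly_altdef n_def)
  also have "{..n} = insert n {..<n}" by auto
  finally have xn: "x ^ n = - (\<Sum>i<n. coeff p i * x ^ i)" using p(2) by (simp add: n_def eq_neg_iff_add_eq_0)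
  have "(\<Sum>i<n. coeff p i * x ^ i) \<in> lspan R V"
    using p(1) by (intro lspan_sum lspan_scaled_base) (auto simp: V_def coeff_pol)
  then have xn': "x ^ n \<in> lspan R V" unfolding xn using R lspan_uminus by blast
  have shift: "x * y \<in> lspan R V" if "y \<in> lspan R V" for y
    using that
  proof induction
    case (step r v y)
    obtain i where i: "i < n" "v = x ^ i" using step by (auto simp: V_def)
    have "x * v \<in> lspan R V"
    proof (cases "Suc i = n")
      case True
      then show ?thesis using xn' i by auto
    next
      case False
      then have "x * v \<in> V" using i by (auto simp: V_def intro!: image_eqI[of _ _ "Suc i"])
      then show ?thesis using R lspan_base by blast
    qed
    then have "r * (x * v) + x * y \<in> lspan R V" using step R by (intro lspan_add[OF lspan_scale]) auto
    then show ?case by (simp add: algebra_simps)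
  qed (auto intro: lspan.zero)
  \<comment> \<open>Positive degree is what puts \<open>1 = x ^ 0\<close> into
    \<open>V\<close>.\<close>
  have "n \<noteq> 0"
  proof
    assume "n = 0"
    then have "p = [:1:]" using p(2) by (metis degree_eq_zeroE lead_coeff_pCons(2) n_def)
    then show False using p(3) by simp
  qed
  then have one: "1 \<in> V" by (auto simp: V_def intro!: image_eqI[of _ _ 0])
  have "poly q x \<in> lspan R V" if "q \<in> pol R" for q
    using that
  proof (induction q)
    case (pCons a q)
    then show ?case using lspan_add[OF _ shift, of "a * 1" "poly q x"] lspan_scaled_base[of a R 1 V] one
      by (auto simp: pCons_pol)
  qed (auto intro: lspan.zero)
  then show ?thesis by (intro exI[of _ V]) (auto simp: V_def adjoin_def)
qed

lemma lspan_powers_poly: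
  assumes R: "is_subring R" and y: "y \<in> lspan R ((\<lambda>i. x ^ i) ` {..<n})"
  shows "\<exists>q\<in>pol R. (\<forall>i\<ge>n. coeff q i = 0) \<and> y = poly q x"
  using y
proof induction
  case zero
  show ?case using zero_pol[OF R] by (intro bexI[of _ 0]) auto
next
  case (step r v y)
  then obtain q i where q: "q \<in> pol R" "\<forall>i\<ge>n. coeff q i = 0" "y = poly q x" "i < n" "v = x ^ i" by auto
  show ?case using q step is_subringD(4)[OF is_subring_pol[OF R] monom_pol[OF R]]
    by (intro bexI[of _ "monom r i + q"]) (auto simp: poly_monom)
qed

text \<open>Noetherianity replaces the determinant trick: finitely many powers span all powers, so
  some \<open>x ^ n\<close> is a combination of lower ones. The vectors in \<open>V\<close> may have
  denominators, as in the use for leading coefficients below.\<close>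

lemma integral_if_powers_in_span:
  assumes R: "is_subring R" "noetherian R" and V: "finite V" "\<And>k. x ^ k \<in> lspan R V"
  shows "is_integral R x"
proof -
  have "range (\<lambda>k. x ^ k) \<subseteq> lspan R V" using V(2) by blast
  from noetherian_module[OF R V(1) this] obtain W
    where W: "finite W" "W \<subseteq> range (\<lambda>k. x ^ k)" "range (\<lambda>k. x ^ k) \<subseteq> lspan R W"
    by blast
  then obtain J where J: "finite J" "W = (\<lambda>k. x ^ k) ` J" by (meson finite_subset_image)
  then obtain n where "J \<subseteq> {..<n}" using finite_nat_iff_bounded by auto
  then have "lspan R W \<subseteq> lspan R ((\<lambda>i. x ^ i) ` {..<n})" using J by (intro lspan_mono) auto
  then have "x ^ n \<in> lspan R ((\<lambda>i. x ^ i) ` {..<n})" using W(3) by blast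
  then obtain q where q: "q \<in> pol R" "\<forall>i\<ge>n. coeff q i = 0" "x ^ n = poly q x"
    using lspan_powers_poly[OF R(1)] by blast
  define p where "p = monom 1 n - q"
  have cn: "coeff p n = 1" using q by (simp add: p_def)
  have "coeff p i = 0" if "i > n" for i using q that by (simp add: p_def)
  then have "degree p \<le> n" by (intro degree_le) auto
  then have "degree p = n" using cn le_degree[of p n] by simp
  moreover have "p \<in> pol R"
    unfolding p_def using is_subringD(5)[OF is_subring_pol[OF R(1)] monom_pol[OF R(1)]] q R(1) is_subringD(2) by blast
  ultimately show ?thesis unfolding is_integral_def using cn q
    by (intro bexI[of _ p]) (auto simp: p_def poly_monom)
qed

lemma integral_if_in_finite_ring:
  assumes "is_subring R" "noetherian R" "finite V" "R' \<subseteq> lspan R V" "is_subring R'" "x \<in> R'"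
  shows "is_integral R x"
  using assms is_subring_power[of R' x] by (intro integral_if_powers_in_span) auto

lemma ring_hull_integral_span:
  assumes R: "is_subring R" and "finite E" "\<And>e. e \<in> E \<Longrightarrow> is_integral R e"
  shows "\<exists>V. finite V \<and> ring_hull (R \<union> E) \<subseteq> lspan R V"
  using assms(2,3)
proof (induction E rule: finite_induct)
  case empty
  then show ?case using lspan_one[OF R] ring_hull_eq[OF R] by (intro exI[of _ "{1}"]) auto
next
  case (insert e E)
  let ?R = "ring_hull (R \<union> E)"
  obtain V where V: "finite V" "?R \<subseteq> lspan R V" using insert by auto
  have "R \<subseteq> ?R" using ring_hull_subset[of "R \<union> E"] by blast
  then have "is_integral ?R e" using insert.prems is_integral_mono by blast
  from adjoin_integral_span[OF is_subring_ring_hull this]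
  obtain W where W: "finite W" "adjoin ?R e \<subseteq> lspan ?R W" by blast
  have "ring_hull (R \<union> insert e E) \<subseteq> lspan R (prod_set V W)"
    using W lspan_tower[OF R V(2), of W] by (simp add: ring_hull_insert)
  with finite_prod_set[OF V(1) W(1)] show ?case by (intro exI conjI)
qed

lemma integral_ring_hull:
  assumes "is_subring R" "noetherian R" "finite E" "\<And>e. e \<in> E \<Longrightarrow> is_integral R e" "x \<in> ring_hull (R \<union> E)"
  shows "is_integral R x"
  using ring_hull_integral_span[OF assms(1,3,4)] integral_if_in_finite_ring[OF assms(1,2)]
    is_subring_ring_hull assms(5) by blast

lemma is_subring_integral:
  assumes "is_subring R" "noetherian R"
  shows "is_subring {x. is_integral R x}"
  unfolding is_subring_def
proof (intro conjI ballI CollectI; (elim CollectE)?)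
  show "is_integral R 1" using assms is_integral_base is_subringD by blast
  fix x y assume xy: "is_integral R x" "is_integral R y"
  have "x \<in> ring_hull (R \<union> {x, y})" "y \<in> ring_hull (R \<union> {x, y})" using ring_hull_subset[of "R \<union> {x, y}"] by auto
  then show "is_integral R (x - y)" "is_integral R (x * y)"
    using xy is_subringD(5,6)[OF is_subring_ring_hull[of "R \<union> {x, y}"]]
    by (auto intro!: integral_ring_hull[OF assms, of "{x, y}"])
qed

text \<open>The finitely many coefficients of \<open>p\<close> generate a ring that is a finite
  \<open>R\<close>-module, and adjoining \<open>x\<close> to it keeps it finite.\<close>

lemma integral_trans_poly:
  assumes R: "is_subring R" "noetherian R" and p: "\<And>i. is_integral R (coeff p i)" "lead_coeff p = 1" "poly p x = 0"
  shows "is_integral R x"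
proof -
  let ?E = "range (coeff p)"
  let ?R = "ring_hull (R \<union> ?E)"
  have E: "finite ?E" by (simp add: range_coeff)
  then obtain V where V: "finite V" "?R \<subseteq> lspan R V" using ring_hull_integral_span[OF R(1), of ?E] p(1) by auto
  have "is_integral ?R x"
    unfolding is_integral_def using p ring_hull_subset[of "R \<union> ?E"] by (intro bexI[of _ p]) (auto simp: pol_def)
  from adjoin_integral_span[OF is_subring_ring_hull this]
  obtain W where W: "finite W" "adjoin ?R x \<subseteq> lspan ?R W" by blast
  have "adjoin ?R x \<subseteq> lspan R (prod_set V W)" using W lspan_tower[OF R(1) V(2)] by auto
  then show ?thesis
    using integral_if_in_finite_ring[OF R finite_prod_set[OF V(1) W(1)]] is_subring_adjoin adjoin_gen
      is_subring_ring_hull by blast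
qed

lemma integral_trans:
  assumes "is_subring R" "noetherian R" "\<And>s. s \<in> S \<Longrightarrow> is_integral R s" "is_integral S x"
  shows "is_integral R x"
  using assms(4) integral_trans_poly[OF assms(1,2)] assms(3) unfolding is_integral_def
  by (metis coeff_pol)

lemma pol_division:
  assumes R: "is_subring R" and m: "m \<in> pol R" "lead_coeff m = 1" and p: "p \<in> pol R"
  shows "\<exists>q\<in>pol R. \<exists>r\<in>pol R. p = m * q + r \<and> (r = 0 \<or> degree r < degree m)"
  using p
proof (induction "degree p" arbitrary: p rule: less_induct)
  case less
  note P = is_subring_pol[OF R]
  show ?case
  proof (cases "p = 0 \<or> degree p < degree m")
    case True
    then show ?thesis using less.prems zero_pol[OF R] by (intro bexI[of _ 0] bexI[of _ p]) auto
  next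
    case False
    define h where "h = monom (lead_coeff p) (degree p - degree m)"
    have h: "h \<in> pol R" unfolding h_def using R less.prems by (intro monom_pol) (auto simp: coeff_pol)
    define p' where "p' = p - h * m"
    have p': "p' \<in> pol R" unfolding p'_def using h m less.prems is_subringD[OF P] by auto
    have "degree (h * m) \<le> degree p"
      using degree_mult_le[of h m] degree_monom_le[of "lead_coeff p" "degree p - degree m"] False
      unfolding h_def by linarith
    then have "degree p' \<le> degree p" by (simp add: p'_def degree_diff_le)
    moreover have "coeff p' (degree p) = 0"
      using False m(2) by (simp add: p'_def h_def coeff_monom_mult)
    ultimately have "p' = 0 \<or> degree p' < degree p" by (metis eq_zero_or_degree_less)
    then obtain q r where qr: "q \<in> pol R" "r \<in> pol R" "p' = m * q + r" "r = 0 \<or> degree r < degree m"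
    proof
      assume "p' = 0"
      then show ?thesis using that[of 0 0] zero_pol[OF R] by simp
    qed (use less.hyps[OF _ p'] in blast)
    have "p = m * (q + h) + r" using qr(3) by (simp add: p'_def algebra_simps)
    then show ?thesis using qr h is_subringD(4)[OF P] by blast
  qed
qed

section \<open>Fraction fields and minimal polynomials inside a field\<close>

text \<open>The denominator may be zero, which is harmless because the quotient is then 0;
  \<open>FracE\<close> supplies a nonzero denominator.\<close>

definition Frac :: "'a::field set \<Rightarrow> 'a set" where
  "Frac R = {a / b | a b. a \<in> R \<and> b \<in> R}"

lemma FracI: "a \<in> R \<Longrightarrow> b \<in> R \<Longrightarrow> a / b \<in> Frac R"
  by (auto simp: Frac_def)

lemma FracE:
  assumes "x \<in> Frac R" "is_subring R"
  obtains a b where "a \<in> R" "b \<in> R" "b \<noteq> 0" "x = a / b"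
proof -
  obtain a b where ab: "a \<in> R" "b \<in> R" "x = a / b" using assms(1) by (auto simp: Frac_def)
  show ?thesis
  proof (cases "b = 0")
    case True
    then show ?thesis using that[of 0 1] ab is_subringD[OF assms(2)] by simp
  qed (use that ab in auto)
qed

lemma subfield_setD: "subfield_set K \<Longrightarrow> is_subring K"
  by (simp add: subfield_set_def)

lemma subfield_Frac:
  assumes R: "is_subring R"
  shows "subfield_set (Frac R)"
  unfolding subfield_set_def is_subring_def
proof (intro conjI ballI)
  show "1 \<in> Frac R" using FracI[of 1 R 1] is_subringD[OF R] by simp
  fix x assume x: "x \<in> Frac R"
  obtain a b where ab: "a \<in> R" "b \<in> R" "b \<noteq> 0" "x = a / b" by (rule FracE[OF x R])
  show "inverse x \<in> Frac R" using ab FracI[of b R a] by simp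
  fix y assume y: "y \<in> Frac R"
  obtain c d where cd: "c \<in> R" "d \<in> R" "d \<noteq> 0" "y = c / d" by (rule FracE[OF y R])
  have "x - y = (a * d - c * b) / (b * d)" "x * y = (a * c) / (b * d)" using ab cd by (auto simp: field_simps)
  then show "x - y \<in> Frac R" "x * y \<in> Frac R" using ab cd is_subringD[OF R] by (auto intro!: FracI)
qed

lemma Frac_base: "is_subring R \<Longrightarrow> R \<subseteq> Frac R"
  using FracI[of _ R 1] is_subringD(2)[of R] by auto

lemma Frac_least: "subfield_set K \<Longrightarrow> R \<subseteq> K \<Longrightarrow> Frac R \<subseteq> K"
  by (auto simp: Frac_def intro!: subfield_set_divide)

lemma Frac_mono: "R \<subseteq> S \<Longrightarrow> Frac R \<subseteq> Frac S"
  by (auto simp: Frac_def)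

lemma Frac_pol_denominator:
  assumes R: "is_subring R" and "p \<in> pol (Frac R)"
  shows "\<exists>d\<in>R. d \<noteq> 0 \<and> smult d p \<in> pol R"
  using assms(2)
proof (induction p)
  case 0
  show ?case using is_subringD[OF R] zero_pol[OF R] by (intro bexI[of _ 1]) auto
next
  case (pCons a p)
  then obtain d where d: "d \<in> R" "d \<noteq> 0" "smult d p \<in> pol R" by (auto simp: pCons_pol)
  have "a \<in> Frac R" using pCons.prems by (simp add: pCons_pol)
  then obtain u v where uv: "u \<in> R" "v \<in> R" "v \<noteq> 0" "a = u / v" using FracE R by metis
  have "smult (v * d) p = smult v (smult d p)" by simp
  then have "smult (v * d) p \<in> pol R" using smult_pol[OF R uv(2) d(3)] by simp
  moreover have "v * d * a \<in> R" using uv d is_subringD[OF R] by simp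
  ultimately show ?case using uv d is_subringD[OF R]
    by (intro bexI[of _ "v * d"]) (auto simp: pCons_pol)
qed

definition is_algebraic :: "'a::field set \<Rightarrow> 'a \<Rightarrow> bool" where
  "is_algebraic R x \<longleftrightarrow> (\<exists>p\<in>pol R. p \<noteq> 0 \<and> poly p x = 0)"

lemma algebraic_if_integral: "is_integral R x \<Longrightarrow> is_algebraic R x"
  unfolding is_integral_def is_algebraic_def by (erule bexE) (rule bexI, auto)

lemma algebraic_mono: "is_algebraic R x \<Longrightarrow> R \<subseteq> S \<Longrightarrow> is_algebraic S x"
  using pol_mono unfolding is_algebraic_def by blast

lemma algebraic_Frac:
  assumes "is_subring R" "is_algebraic (Frac R) x"
  shows "is_algebraic R x"
proof -
  obtain p where p: "p \<in> pol (Frac R)" "p \<noteq> 0" "poly p x = 0" using assms(2) by (auto simp: is_algebraic_def)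
  obtain d where "d \<in> R" "d \<noteq> 0" "smult d p \<in> pol R" using Frac_pol_denominator[OF assms(1) p(1)] by blast
  then show ?thesis using p unfolding is_algebraic_def by (intro bexI[of _ "smult d p"]) auto
qed

lemma integral_iff_algebraic:
  assumes "subfield_set K"
  shows "is_integral K x \<longleftrightarrow> is_algebraic K x"
proof
  assume "is_algebraic K x"
  then obtain p where p: "p \<in> pol K" "p \<noteq> 0" "poly p x = 0" by (auto simp: is_algebraic_def)
  have "inverse (lead_coeff p) \<in> K" using p assms coeff_pol by (auto simp: subfield_set_def)
  then show "is_integral K x" using p smult_pol subfield_setD[OF assms]
    unfolding is_integral_def by (intro bexI[of _ "smult (inverse (lead_coeff p)) p"]) auto
qed (rule algebraic_if_integral)

lemma integral_monicI:
  assumes R: "is_subring R" and "\<And>i. i < n \<Longrightarrow> f i \<in> R" and "(\<Sum>i<n. f i * y ^ i) + y ^ n = 0"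
  shows "is_integral R y"
proof -
  define p where "p = (\<Sum>i<n. monom (f i) i) + monom 1 n"
  have "p \<in> pol R" unfolding p_def
    using R assms(2) is_subringD(2)[OF R]
    by (intro is_subringD(4)[OF is_subring_pol] is_subring_sum[OF is_subring_pol] monom_pol) auto
  moreover have "coeff p n = 1" by (simp add: p_def coeff_sum)
  moreover have "degree p \<le> n" by (rule degree_le) (auto simp: p_def coeff_sum)
  ultimately have "lead_coeff p = 1" using le_degree[of p n] by (simp add: le_antisym)
  moreover have "poly p y = 0" using assms(3) by (simp add: p_def poly_sum poly_monom)
  ultimately show ?thesis unfolding is_integral_def using \<open>p \<in> pol R\<close> by blast
qed

text \<open>With \<open>c\<close> the leading coefficient and \<open>n\<close> the degree,
  multiplying the equation of \<open>x\<close> by \<open>c ^ (n - 1)\<close> makes it a monic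
  equation for \<open>c * x\<close>.\<close>

lemma algebraic_scaled_integral:
  assumes R: "is_subring R" and x: "is_algebraic R x"
  shows "\<exists>d\<in>R. d \<noteq> 0 \<and> is_integral R (d * x)"
proof -
  obtain p where p: "p \<in> pol R" "p \<noteq> 0" "poly p x = 0" using x by (auto simp: is_algebraic_def)
  define n where "n = degree p"
  define c where "c = lead_coeff p"
  have c: "c \<in> R" "c \<noteq> 0" using p coeff_pol by (auto simp: c_def)
  have "n \<noteq> 0"
  proof
    assume "n = 0"
    then obtain a where "p = [:a:]" using degree_eq_zeroE unfolding n_def by blast
    then show False using p by simp
  qed
  have "is_integral R (c * x)"
  proof (rule integral_monicI[OF R])
    \<comment> \<open>The coefficient of \<open>(c * x) ^ i\<close> after that multiplication:
      \<open>i\<close> of the \<open>n - 1\<close> factors \<open>c\<close> are absorbed into the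
      power.\<close>
    show "coeff p i * c ^ (n - 1 - i) \<in> R" for i
      by (intro is_subringD(6)[OF R] is_subring_power[OF R] c coeff_pol[OF p(1)])
    have "(\<Sum>i<n. coeff p i * c ^ (n - 1 - i) * (c * x) ^ i) = (\<Sum>i<n. c ^ (n - 1) * (coeff p i * x ^ i))"
    proof (rule sum.cong)
      fix i assume "i \<in> {..<n}"
      then have "c ^ (n - 1) = c ^ (n - 1 - i) * c ^ i" by (simp flip: power_add)
      then show "coeff p i * c ^ (n - 1 - i) * (c * x) ^ i = c ^ (n - 1) * (coeff p i * x ^ i)"
        by (simp add: power_mult_distrib)
    qed simp
    also have "\<dots> = c ^ (n - 1) * (\<Sum>i<n. coeff p i * x ^ i)" by (simp add: sum_distrib_left)
    finally have "(\<Sum>i<n. coeff p i * c ^ (n - 1 - i) * (c * x) ^ i) = c ^ (n - 1) * (\<Sum>i<n. coeff p i * x ^ i)" .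
    moreover have "(c * x) ^ n = c ^ (n - 1) * (c * x ^ n)"
      using \<open>n \<noteq> 0\<close> by (cases n) (auto simp: power_mult_distrib)
    moreover have "(\<Sum>i<n. coeff p i * x ^ i) + c * x ^ n = poly p x"
    proof -
      have "{..n} = insert n {..<n}" by auto
      then show ?thesis by (simp add: poly_altdef c_def n_def[symmetric] add.commute)
    qed
    ultimately show "(\<Sum>i<n. coeff p i * c ^ (n - 1 - i) * (c * x) ^ i) + (c * x) ^ n = 0"
      using p(3) by (simp flip: distrib_left)
  qed
  then show ?thesis using c by blast
qed

section \<open>Minimal polynomials over a subfield\<close>

text \<open>Given through the ideal of relations instead of least degree: this form moves a relation
  over \<open>K\<close> from one root to another.\<close>

definition min_pol :: "'a::field set \<Rightarrow> 'a \<Rightarrow> 'a poly \<Rightarrow> bool" where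
  "min_pol K x m \<longleftrightarrow> m \<in> pol K \<and> lead_coeff m = 1 \<and>
     (\<forall>p\<in>pol K. poly p x = 0 \<longleftrightarrow> (\<exists>h\<in>pol K. p = m * h))"

lemma min_pol_root: "is_subring K \<Longrightarrow> min_pol K x m \<Longrightarrow> poly m x = 0"
  unfolding min_pol_def using is_subringD(2)[OF is_subring_pol] by (metis mult.right_neutral)

lemma min_pol_exists:
  assumes K: "subfield_set K" and x: "is_algebraic K x"
  shows "\<exists>m. min_pol K x m"
proof -
  have KR: "is_subring K" using K subfield_setD by blast
  let ?P = "\<lambda>p. p \<in> pol K \<and> lead_coeff p = 1 \<and> poly p x = 0"
  have "\<exists>p. ?P p" using x unfolding integral_iff_algebraic[OF K, symmetric] is_integral_def by blast
  then obtain m where m: "?P m" "\<And>p. ?P p \<Longrightarrow> degree m \<le> degree p"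
    using ex_has_least_nat[of ?P _ degree] by blast
  have "\<exists>h\<in>pol K. p = m * h" if p: "p \<in> pol K" "poly p x = 0" for p
  proof -
    obtain q r where qr: "q \<in> pol K" "r \<in> pol K" "p = m * q + r" "r = 0 \<or> degree r < degree m"
      using pol_division[OF KR _ _ p(1)] m(1) by metis
    have "r = 0"
    proof (rule ccontr)
      assume "r \<noteq> 0"
      have "poly r x = 0" using qr p m(1) by simp
      moreover have "inverse (lead_coeff r) \<in> K" using qr K coeff_pol by (auto simp: subfield_set_def)
      ultimately have "?P (smult (inverse (lead_coeff r)) r)" using \<open>r \<noteq> 0\<close> qr smult_pol[OF KR] by auto
      from m(2)[OF this] show False using qr \<open>r \<noteq> 0\<close> by simp
    qed
    then show ?thesis using qr by auto
  qed
  then show ?thesis using m(1) by (intro exI[of _ m]) (auto simp: min_pol_def)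
qed

text \<open>Irreducibility seen through roots: if \<open>n\<close> is the minimal polynomial of
  \<open>a\<close> and \<open>m = n * h\<close>, then \<open>x\<close> is a root of \<open>n\<close>
  or of \<open>h\<close>. In the first case \<open>h = 1\<close>; in the second \<open>n\<close>
  would be a unit, although it vanishes at \<open>a\<close>.\<close>

lemma min_pol_of_root:
  assumes K: "subfield_set K" and m: "min_pol K x m" and a: "poly m a = 0"
  shows "min_pol K a m"
proof -
  have KR: "is_subring K" using K subfield_setD by blast
  have mK: "m \<in> pol K" "lead_coeff m = 1" "m \<noteq> 0" using m by (auto simp: min_pol_def)
  then have "is_algebraic K a" using a by (auto simp: is_algebraic_def)
  then obtain n where n: "min_pol K a n" using min_pol_exists[OF K] by blast
  then have nK: "n \<in> pol K" "lead_coeff n = 1" "n \<noteq> 0" by (auto simp: min_pol_def)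
  obtain h where h: "h \<in> pol K" "m = n * h" using n mK a unfolding min_pol_def by blast
  have "poly (n * h) x = 0" using min_pol_root[OF KR m] h by simp
  then consider "poly n x = 0" | "poly h x = 0" by auto
  then show ?thesis
  proof cases
    case 1
    then obtain g where g: "g \<in> pol K" "n = m * g" using m nK unfolding min_pol_def by blast
    have "m * (g * h) = m * 1" using g(2) h(2) by (metis mult.assoc mult.right_neutral)
    then have gh: "g * h = 1" using mK(3) mult_left_cancel by blast
    then have "degree g + degree h = 0" using degree_mult_eq[of g h] by (metis degree_1 mult_zero_left mult_zero_right zero_neq_one)
    then obtain b where "h = [:b:]" using degree_eq_zeroE by (metis add_is_0)
    moreover have "lead_coeff h = 1" using lead_coeff_mult[of n h] h(2) mK(2) nK(2) by simp
    ultimately have "h = 1" by (simp add: one_pCons)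
    then show ?thesis using n h by simp
  next
    case 2
    then obtain g where g: "g \<in> pol K" "h = m * g" using m h unfolding min_pol_def by blast
    have "m * (g * n) = m * 1" using g(2) h(2) by (metis mult.assoc mult.commute mult.right_neutral)
    then have gh: "g * n = 1" using mK(3) mult_left_cancel by blast
    then have "poly (g * n) a = 1" by simp
    then show ?thesis using min_pol_root[OF KR n] by simp
  qed
qed

text \<open>For \<open>y \<noteq> 0\<close> the minimal polynomial has a nonzero constant
  coefficient \<open>a\<close>, and \<open>a + y * q(y) = 0\<close> can be solved for the
  inverse.\<close>

lemma inverse_algebraic:
  assumes K: "subfield_set K" and y: "is_algebraic K y"
  shows "inverse y \<in> adjoin K y"
proof (cases "y = 0")
  case True
  then show ?thesis using is_subringD(1)[OF is_subring_adjoin] subfield_setD[OF K] by auto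
next
  case False
  have KR: "is_subring K" using K subfield_setD by blast
  obtain m where m: "min_pol K y m" using min_pol_exists[OF K y] by blast
  obtain a q where aq: "m = pCons a q" by (cases m)
  have q: "q \<in> pol K" "a \<in> K" using m aq by (auto simp: min_pol_def pCons_pol)
  have root: "a + y * poly q y = 0" using min_pol_root[OF KR m] aq by simp
  have "a \<noteq> 0"
  proof
    assume "a = 0"
    then have "poly q y = 0" using root False by simp
    then obtain h where h: "q = m * h" using m q by (auto simp: min_pol_def)
    have "q \<noteq> 0" using m aq \<open>a = 0\<close> by (auto simp: min_pol_def)
    then have "degree q = degree m + degree h" using h by (simp add: degree_mult_eq)
    moreover have "degree m = Suc (degree q)" using aq \<open>q \<noteq> 0\<close> by simp
    ultimately show False by simp
  qed
  have "y * poly q y = - a" using root by (simp add: eq_neg_iff_add_eq_0 add.commute)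
  then have "y * poly (smult (- inverse a) q) y = 1" using \<open>a \<noteq> 0\<close> by (simp add: field_simps)
  then have "inverse y = poly (smult (- inverse a) q) y" by (rule inverse_unique)
  moreover have "- inverse a \<in> K" using K q is_subringD[OF KR] by (auto simp: subfield_set_def)
  ultimately show ?thesis unfolding adjoin_def using smult_pol[OF KR _ q(1)] by (intro image_eqI)
qed

lemma subfield_adjoin:
  assumes K: "subfield_set K" and x: "is_algebraic K x"
  shows "subfield_set (adjoin K x)" and "y \<in> adjoin K x \<Longrightarrow> is_integral K y"
proof -
  have KR: "is_subring K" using K subfield_setD by blast
  show int: "is_integral K y" if "y \<in> adjoin K x" for y
    using adjoin_least[OF is_subring_integral[OF KR noetherian_subfield[OF K]], of K x]
      is_integral_base[OF KR] x integral_iff_algebraic[OF K] that by blast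
  have "inverse y \<in> adjoin K x" if "y \<in> adjoin K x" for y
  proof -
    have "is_algebraic K y" using int[OF that] algebraic_if_integral by blast
    then have "inverse y \<in> adjoin K y" by (rule inverse_algebraic[OF K])
    also have "\<dots> \<subseteq> adjoin K x" using that by (intro adjoin_least is_subring_adjoin KR adjoin_base)
    finally show ?thesis .
  qed
  then show "subfield_set (adjoin K x)" using is_subring_adjoin[OF KR] by (auto simp: subfield_set_def)
qed

lemma subfield_integral:
  assumes K: "subfield_set K"
  shows "subfield_set {x. is_integral K x}"
proof -
  have KR: "is_subring K" using K subfield_setD by blast
  have "is_integral K (inverse y)" if "is_integral K y" for y
    using inverse_algebraic[OF K algebraic_if_integral[OF that]]
      subfield_adjoin(2)[OF K algebraic_if_integral[OF that]] by blast
  then show ?thesis using is_subring_integral[OF KR noetherian_subfield[OF K]] by (auto simp: subfield_set_def)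
qed

section \<open>Integrally closed subrings\<close>

definition int_closed :: "'a::field set \<Rightarrow> bool" where
  "int_closed N \<longleftrightarrow> (\<forall>x\<in>Frac N. is_integral N x \<longrightarrow> x \<in> N)"

text \<open>\<open>m\<close> is the product of linear factors over a multiset of roots; a repeated
  root would be a zero of the derivative, so the multiset is a set.\<close>

lemma separable_factorization:
  fixes m :: "'a::alg_closed_field poly"
  assumes m: "lead_coeff m = 1" and sep: "\<And>a. poly m a = 0 \<Longrightarrow> poly (pderiv m) a \<noteq> 0"
  defines "Z \<equiv> {a. poly m a = 0}"
  shows "finite Z" "card Z = degree m" "m = (\<Prod>a\<in>Z. [:-a, 1:])"
proof -
  have "m \<noteq> 0" using m by auto
  then show fin: "finite Z" unfolding Z_def by (rule poly_roots_finite)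
  obtain A where A: "size A = degree m" "m = (\<Prod>x\<in>#A. [:-x, 1:])"
    using alg_closed_imp_factorization[OF \<open>m \<noteq> 0\<close>] m by auto
  have Z: "set_mset A = Z" unfolding Z_def by (subst A(2)) (auto simp: poly_prod_mset)
  have "count A a \<le> 1" for a
  proof (rule ccontr)
    assume "\<not> count A a \<le> 1"
    then have "{#a, a#} \<subseteq># A" by (auto simp: subseteq_mset_def)
    then obtain B where "A = {#a, a#} + B" by (metis subset_mset.add_diff_inverse)
    then have mm: "m = [:-a, 1:] * ([:-a, 1:] * (\<Prod>x\<in>#B. [:-x, 1:]))" using A(2) by simp
    have "poly m a = 0" "poly (pderiv m) a = 0"
      by (simp_all add: mm pderiv_mult del: mult_pCons_left)
    then show False using sep by blast
  qed
  then have "A = mset_set Z"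
    using Z fin by (intro multiset_eqI) (metis count_mset_set(1,3) count_greater_eq_one_iff le_antisym not_in_iff)
  then show "card Z = degree m" "m = (\<Prod>a\<in>Z. [:-a, 1:])" using A by (auto simp: prod_unfold_prod_mset)
qed

text \<open>With \<open>m\<close> the minimal polynomial of \<open>\<theta>\<close>, an integral element \<open>y = g(\<theta>)\<close> satisfies
  \<open>y m'(\<theta>) = G(\<theta>)\<close>, where \<open>G = \<Sum> g(a) m / (X - a)\<close> over the roots \<open>a\<close> of \<open>m\<close>
  has integral coefficients. Since \<open>G\<close> is the remainder of \<open>g m'\<close> modulo \<open>m\<close>, its coefficients also lie
  in the fraction field, hence in \<open>N\<close>.\<close>

lemma simple_integral_closure_finite:
  fixes N :: "'a::{alg_closed_field,field_char_0} set"
  assumes N: "is_subring N" "noetherian N" "int_closed N" and t: "is_integral N t"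
  shows "\<exists>V. finite V \<and> {y \<in> adjoin (Frac N) t. is_integral N y} \<subseteq> lspan N V"
proof -
  define K where "K = Frac N"
  define J where "J = {x. is_integral N x}"
  have K: "subfield_set K" unfolding K_def using N subfield_Frac by blast
  have KR: "is_subring K" using K subfield_setD by blast
  have NK: "N \<subseteq> K" unfolding K_def using N Frac_base by blast
  have J: "is_subring J" unfolding J_def using N is_subring_integral by blast
  \<comment> \<open>Normality of \<open>N\<close> enters here; it will bring the coefficients of
    \<open>G\<close> into \<open>N\<close>.\<close>
  have JK: "J \<inter> K = N" using N NK is_integral_base by (auto simp: J_def K_def int_closed_def)
  have "is_algebraic K t" using t NK algebraic_if_integral algebraic_mono by blast
  then obtain m where m: "min_pol K t m" using min_pol_exists[OF K] by blast
  have mK: "m \<in> pol K" "lead_coeff m = 1" "m \<noteq> 0" using m by (auto simp: min_pol_def)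
  define Z where "Z = {a. poly m a = 0}"
  have minZ: "min_pol K a m" if "a \<in> Z" for a using min_pol_of_root[OF K m] that by (simp add: Z_def)
  have tZ: "t \<in> Z" using min_pol_root[OF KR m] by (simp add: Z_def)
  have deg: "degree m \<noteq> 0"
  proof
    assume "degree m = 0"
    then obtain b where "m = [:b:]" using degree_eq_zeroE by blast
    then show False using tZ mK by (simp add: Z_def)
  qed
  \<comment> \<open>Characteristic zero: a multiple root would make \<open>m\<close> divide its
    derivative, which is nonzero of smaller degree.\<close>
  have sep: "poly (pderiv m) a \<noteq> 0" if "poly m a = 0" for a
  proof
    assume "poly (pderiv m) a = 0"
    then have "m dvd pderiv m"
      using minZ[of a] that pderiv_pol[OF KR mK(1)] unfolding min_pol_def Z_def by fastforce
    then show False using deg by simp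
  qed
  note fac = separable_factorization[OF mK(2) sep, folded Z_def]
  \<comment> \<open>If \<open>P\<close> is a monic equation of \<open>g(t)\<close>, the composite of
    \<open>P\<close> with \<open>g\<close> vanishes at \<open>t\<close>, hence at every conjugate
    \<open>a\<close>; so \<open>P\<close> also annihilates \<open>g(a)\<close>.\<close>
  have conj_integral: "poly g a \<in> J" if g: "g \<in> pol K" "is_integral N (poly g t)" and a: "a \<in> Z" for g a
  proof -
    obtain P where P: "P \<in> pol N" "lead_coeff P = 1" "poly P (poly g t) = 0"
      using g(2) by (auto simp: is_integral_def)
    have "pcompose P g \<in> pol K" using pcompose_pol[OF KR] P(1) pol_mono[OF NK] g by blast
    moreover have "poly (pcompose P g) t = 0" using P by (simp add: poly_pcompose)
    ultimately have "poly (pcompose P g) a = 0"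
      using m minZ[OF a] unfolding min_pol_def by blast
    then show ?thesis using P by (auto simp: J_def is_integral_def poly_pcompose)
  qed
  have ZJ: "Z \<subseteq> J"
    using conj_integral[of "[:0, 1:]"] t is_subringD[OF KR] by (auto simp: pCons_pol zero_pol[OF KR])
  \<comment> \<open>The coefficients of \<open>G\<close> will be the coordinates of \<open>y\<close>
    with respect to these elements.\<close>
  define V where "V = (\<lambda>i. t ^ i / poly (pderiv m) t) ` {..<degree m}"
  have "y \<in> lspan N V" if y: "y \<in> adjoin K t" "is_integral N y" for y
  proof -
    obtain g where g: "g \<in> pol K" "y = poly g t" using y by (auto simp: adjoin_def)
    \<comment> \<open>This is \<open>m / (X - a)\<close>: its value at \<open>a\<close> is that of
      the derivative of \<open>m\<close>, and it vanishes at the other roots.\<close>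
    define L where "L a = (\<Prod>b\<in>Z - {a}. [:-b, 1:])" for a
    define G where "G = (\<Sum>a\<in>Z. smult (poly g a) (L a))"
    have LJ: "L a \<in> pol J" for a
      unfolding L_def using ZJ J
      by (intro is_subring_prod[OF is_subring_pol]) (auto simp: pCons_pol zero_pol is_subringD)
    have GJ: "G \<in> pol J"
      unfolding G_def using LJ conj_integral[OF g(1)] y g J
      by (intro is_subring_sum[OF is_subring_pol] smult_pol) auto
    have degL: "degree (L a) = degree m - 1" if "a \<in> Z" for a
      unfolding L_def using that fac by (subst degree_prod_sum_eq) auto
    have "degree G \<le> degree m - 1"
      unfolding G_def using order_trans[OF degree_smult_le eq_refl[OF degL]] by (intro degree_sum_le fac(1))
    then have degG: "degree G < degree m" using deg by simp
    obtain q r where r: "q \<in> pol K" "r \<in> pol K" "g * pderiv m = m * q + r" "r = 0 \<or> degree r < degree m"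
      using pol_division[OF KR mK(1,2) is_subringD(6)[OF is_subring_pol[OF KR] g(1) pderiv_pol[OF KR mK(1)]]]
      by metis
    have "poly r a = poly G a" if a: "a \<in> Z" for a
    proof -
      have ml: "m = [:-a, 1:] * L a"
        unfolding L_def using fac(3) prod.remove[OF fac(1) a, of "\<lambda>a. [:-a, 1:]"] by simp
      have "poly (pderiv m) a = poly (L a) a"
        by (subst ml) (simp add: pderiv_mult pderiv_pCons del: mult_pCons_left)
      moreover have "poly (L b) a = 0" if "b \<in> Z" "b \<noteq> a" for b
        unfolding L_def using fac(1) that a by (auto simp: poly_prod)
      then have "poly G a = (\<Sum>b\<in>Z. if b = a then poly g a * poly (L a) a else 0)"
        unfolding G_def by (auto simp: poly_sum intro!: sum.cong)
      ultimately have "poly G a = poly g a * poly (pderiv m) a" using fac(1) a by simp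
      moreover have "poly (g * pderiv m) a = poly r a" using r(3) a by (simp add: Z_def)
      ultimately show ?thesis by simp
    qed
    \<comment> \<open>Both have degree below the number of roots and agree on all of them.\<close>
    then have "r = G" using r(4) degG deg fac(2) by (intro poly_eqI_degree[of Z]) auto
    then have rN: "coeff r i \<in> N" for i using JK coeff_pol[OF r(2)] coeff_pol[OF GJ] by blast
    have degr: "degree r < degree m" using r(4) deg by auto
    have "y * poly (pderiv m) t = poly (m * q + r) t" using r(3)[symmetric] g by simp
    also have "\<dots> = poly r t" using tZ by (simp add: Z_def)
    also have "\<dots> = (\<Sum>i<degree m. coeff r i * t ^ i)"
      unfolding poly_altdef using degr by (intro sum.mono_neutral_left) (auto simp: coeff_eq_0)
    finally have "y = (\<Sum>i<degree m. coeff r i * t ^ i) / poly (pderiv m) t"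
      using sep[of t] tZ by (simp add: Z_def field_simps)
    also have "\<dots> = (\<Sum>i<degree m. coeff r i * (t ^ i / poly (pderiv m) t))"
      by (simp add: sum_divide_distrib)
    also have "\<dots> \<in> lspan N V" by (intro lspan_sum lspan_scaled_base) (auto simp: rN V_def)
    finally show ?thesis .
  qed
  then show ?thesis by (intro exI[of _ V]) (auto simp: V_def K_def)
qed

section \<open>Normality of \<open>N[x]\<close> for transcendental \<open>x\<close>\<close>

text \<open>A root of \<open>q\<close> is also one of \<open>p\<close>; splitting off its linear
  factor from both lowers the degree of \<open>q\<close> and preserves the comparison of
  multiplicities.\<close>

lemma dvd_if_order_le:
  fixes p q :: "'a::alg_closed_field poly"
  assumes "p \<noteq> 0" "q \<noteq> 0" "\<And>a. order a q \<le> order a p"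
  shows "q dvd p"
  using assms
proof (induction "degree q" arbitrary: p q rule: less_induct)
  case less
  show ?case
  proof (cases "degree q = 0")
    case True
    then obtain c where "q = [:c:]" using degree_eq_zeroE by blast
    then show ?thesis using less.prems by (simp add: const_poly_dvd_iff dvd_field_iff)
  next
    case False
    then obtain a where a: "poly q a = 0" using alg_closed_imp_poly_has_root[of q] by auto
    then have "order a q \<noteq> 0" using less.prems by (simp add: order_root)
    then have "order a p \<noteq> 0" using less.prems(3)[of a] by simp
    then have "poly p a = 0" by (simp add: order_root)
    then obtain p' where p': "p = [:-a, 1:] * p'" by (auto simp: poly_eq_0_iff_dvd)
    obtain q' where q': "q = [:-a, 1:] * q'" using a by (auto simp: poly_eq_0_iff_dvd)
    have nz: "p' \<noteq> 0" "q' \<noteq> 0" using p' q' less.prems by auto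
    have "order b q' \<le> order b p'" for b
    proof -
      have "order b p = order b [:-a, 1:] + order b p'" "order b q = order b [:-a, 1:] + order b q'"
        using less.prems(1,2) p' q' order_mult by metis+
      then show ?thesis using less.prems(3)[of b] by simp
    qed
    moreover have "degree q' < degree q" using q' nz by (simp add: degree_mult_eq del: mult_pCons_left)
    ultimately have "q' dvd p'" using less.hyps nz by blast
    then show ?thesis unfolding p' q' by (rule mult_dvd_mono[OF dvd_refl])
  qed
qed

lemma order_power_mult:
  fixes p q :: "'a::field poly"
  assumes "p \<noteq> 0" "q \<noteq> 0"
  shows "order a (p * q ^ k) = order a p + k * order a q"
proof (induction k)
  case (Suc k)
  have eq: "p * q ^ Suc k = q * (p * q ^ k)" by simp
  have "order a (q * (p * q ^ k)) = order a q + order a (p * q ^ k)"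
    using assms by (intro order_mult) simp
  then show ?case using Suc unfolding eq by simp
qed simp

text \<open>Divisibility over the ambient field descends to \<open>K\<close>: division by
  \<open>q\<close>, made monic, stays over \<open>K\<close> and leaves a remainder that
  \<open>q\<close> divides, hence 0.\<close>

lemma pol_dvd_quotient:
  assumes K: "subfield_set K" and pq: "p \<in> pol K" "q \<in> pol K" "q \<noteq> 0" "q dvd p"
  shows "\<exists>h\<in>pol K. p = q * h"
proof -
  have KR: "is_subring K" using K subfield_setD by blast
  let ?c = "inverse (lead_coeff q)"
  have c: "?c \<in> K" "?c \<noteq> 0" using K pq coeff_pol by (auto simp: subfield_set_def)
  have "smult ?c q \<in> pol K" "lead_coeff (smult ?c q) = 1" using c pq smult_pol[OF KR] by auto
  then obtain h r where hr: "h \<in> pol K" "r \<in> pol K" "p = smult ?c q * h + r" "r = 0 \<or> degree r < degree (smult ?c q)"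
    using pol_division[OF KR _ _ pq(1)] by blast
  have "q dvd r"
    using pq(4) unfolding hr(3) by (metis dvd_add_right_iff dvd_triv_left mult_smult_left dvd_smult)
  then have "r = 0" using hr(4) c dvd_imp_degree_le[of q r] by fastforce
  then show ?thesis using hr c smult_pol[OF KR] by (intro bexI[of _ "smult ?c h"]) auto
qed

lemma Frac_finite_denominator:
  assumes R: "is_subring R" and "finite V" "V \<subseteq> Frac R"
  shows "\<exists>d\<in>R. d \<noteq> 0 \<and> (\<forall>v\<in>V. d * v \<in> R)"
  using assms(2,3)
proof (induction V rule: finite_induct)
  case empty
  show ?case using is_subringD(2)[OF R] by (intro bexI[of _ 1]) auto
next
  case (insert v V)
  then obtain d where d: "d \<in> R" "d \<noteq> 0" "\<forall>v\<in>V. d * v \<in> R" by auto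
  obtain a b where ab: "a \<in> R" "b \<in> R" "b \<noteq> 0" "v = a / b" using insert.prems FracE R by (metis insert_subset)
  have "b * d * v = d * a" using ab by simp
  moreover have "b * d * w \<in> R" if "w \<in> V" for w
    using is_subringD(6)[OF R ab(2), of "d * w"] d(3) that by (simp add: mult.assoc)
  ultimately show ?case using ab d is_subringD(6)[OF R] by (intro bexI[of _ "b * d"]) auto
qed

text \<open>\<open>R[f]\<close> is a finite module inside the fraction field, so one denominator
  serves its generators and with them all powers of \<open>f\<close>. This controls poles and
  leading coefficients in the next proof.\<close>

lemma integral_common_denominator:
  assumes R: "is_subring R" "noetherian R" and f: "f \<in> Frac R" "is_integral R f"
  shows "\<exists>d\<in>R. d \<noteq> 0 \<and> (\<forall>k. d * f ^ k \<in> R)"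
proof -
  obtain V where V: "finite V" "adjoin R f \<subseteq> lspan R V" using adjoin_integral_span[OF R(1) f(2)] by auto
  obtain W where W: "finite W" "W \<subseteq> adjoin R f" "adjoin R f \<subseteq> lspan R W" using noetherian_module[OF R V] by auto
  have "adjoin R f \<subseteq> Frac R"
    using subfield_setD[OF subfield_Frac[OF R(1)]] Frac_base[OF R(1)] f by (intro adjoin_least)
  then obtain d where d: "d \<in> R" "d \<noteq> 0" "\<forall>v\<in>W. d * v \<in> R"
    using Frac_finite_denominator[OF R(1) W(1)] W(2) by (meson order_trans)
  have "lspan R W \<subseteq> {y. d * y \<in> R}"
    using d is_subringD[OF R(1)] by (intro lspan_least) (auto simp: mult.left_commute[of d] distrib_left)
  moreover have "f ^ k \<in> adjoin R f" for k
    using R by (intro is_subring_power is_subring_adjoin adjoin_gen)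
  ultimately show ?thesis using d W(3) by blast
qed

text \<open>Two stages. An integral \<open>f = p(x) / q(x)\<close> has no poles, since their order
  would grow with the powers of \<open>f\<close> beyond any common denominator; so \<open>f\<close>
  is a polynomial over \<open>K\<close>. The powers of its leading coefficient then have a common
  denominator in \<open>N\<close>, so this coefficient is integral over \<open>N\<close> and lies in
  \<open>N\<close>; the leading term is subtracted and the degree drops.\<close>

lemma int_closed_adjoin_transcendental:
  fixes N :: "'a::alg_closed_field set"
  assumes N: "is_subring N" "noetherian N" "int_closed N" and x: "\<not> is_algebraic N x"
  shows "int_closed (adjoin N x)"
proof -
  define K where "K = Frac N"
  have K: "subfield_set K" unfolding K_def using N subfield_Frac by blast
  have KR: "is_subring K" using K subfield_setD by blast
  have NK: "N \<subseteq> K" unfolding K_def using N Frac_base by blast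
  define R where "R = adjoin N x"
  have R: "is_subring R" "noetherian R"
    unfolding R_def using N is_subring_adjoin noetherian_adjoin by auto
  have FR: "subfield_set (Frac R)" using R subfield_Frac by blast
  have "x \<in> Frac R" using adjoin_gen[OF N(1)] Frac_base[OF R(1)] unfolding R_def by blast
  moreover have "K \<subseteq> Frac R" unfolding K_def R_def using N by (intro Frac_mono adjoin_base)
  ultimately have KF: "adjoin K x \<subseteq> Frac R" using subfield_setD[OF FR] by (intro adjoin_least)
  \<comment> \<open>\<open>x\<close> is transcendental over \<open>K\<close> too, so identities
    between values at \<open>x\<close> lift to polynomials.\<close>
  have inj: "p = q" if "p \<in> pol K" "q \<in> pol K" "poly p x = poly q x" for p q
  proof (rule ccontr)
    assume "p \<noteq> q"
    then have "is_algebraic K x"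
      using that is_subringD(5)[OF is_subring_pol[OF KR]] unfolding is_algebraic_def
      by (intro bexI[of _ "p - q"]) auto
    then show False using x algebraic_Frac[OF N(1)] by (simp add: K_def)
  qed
  have polynomial: "\<exists>h\<in>pol K. f = poly h x" if f: "f \<in> Frac R" "is_integral R f" for f
  proof -
    obtain u v where uv: "u \<in> R" "v \<in> R" "v \<noteq> 0" "f = u / v" using FracE[OF f(1) R(1)] by blast
    obtain p q where p: "p \<in> pol N" "u = poly p x" and q: "q \<in> pol N" "v = poly q x"
      using uv unfolding R_def adjoin_def by blast
    have q0: "q \<noteq> 0" using q uv by auto
    obtain d where d: "d \<in> R" "d \<noteq> 0" "\<forall>k. d * f ^ k \<in> R" using integral_common_denominator[OF R f] by blast
    obtain D where D: "D \<in> pol N" "d = poly D x" using d unfolding R_def adjoin_def by blast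
    have D0: "D \<noteq> 0" using D d by auto
    show ?thesis
    proof (cases "p = 0")
      case True
      then show ?thesis using uv p zero_pol[OF KR] by (intro bexI[of _ 0]) auto
    next
      case False
      have "order a q \<le> order a p" for a
      proof (rule ccontr)
        assume *: "\<not> order a q \<le> order a p"
        \<comment> \<open>Large enough that \<open>k\<close> excess zeros of the denominator cannot
          be compensated by those of \<open>D\<close>.\<close>
        define k where "k = Suc (order a D)"
        obtain E where E: "E \<in> pol N" "d * f ^ k = poly E x" using d(3) unfolding R_def adjoin_def by blast
        have "poly (D * p ^ k) x = poly (E * q ^ k) x"
          using E(2) uv p q D by (simp add: power_divide field_simps)
        moreover have "D * p ^ k \<in> pol K" "E * q ^ k \<in> pol K"
          using D E p q pol_mono[OF NK] is_subringD(6)[OF is_subring_pol[OF KR]] is_subring_power[OF is_subring_pol[OF KR]]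
          by (meson subsetD)+
        ultimately have eq: "D * p ^ k = E * q ^ k" using inj by blast
        then have "E \<noteq> 0" using D0 False by auto
        have "order a D + k * order a p = order a E + k * order a q"
          using arg_cong[OF eq, of "order a"] order_power_mult D0 False q0 \<open>E \<noteq> 0\<close> by metis
        moreover have "k * order a q \<ge> k * order a p + k" using * mult_le_mono2[of "Suc (order a p)" "order a q" k] by simp
        ultimately show False by (simp add: k_def)
      qed
      then have "q dvd p" using dvd_if_order_le False q0 by blast
      then obtain h where "h \<in> pol K" "p = q * h" using pol_dvd_quotient[OF K] p q q0 pol_mono[OF NK] by blast
      then show ?thesis using uv p q by (intro bexI[of _ h]) auto
    qed
  qed
  have coeffs: "h \<in> pol N" if "h \<in> pol K" "is_integral R (poly h x)" for h
    using that
  proof (induction "degree h" arbitrary: h rule: less_induct)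
    case less
    show ?case
    proof (cases "h = 0")
      case True
      then show ?thesis using zero_pol[OF N(1)] by simp
    next
      case False
      have "poly h x \<in> adjoin K x" using less.prems by (auto simp: adjoin_def)
      then have "poly h x \<in> Frac R" using KF by blast
      then obtain d where d: "d \<in> R" "d \<noteq> 0" "\<forall>k. d * poly h x ^ k \<in> R"
        using integral_common_denominator[OF R] less.prems by blast
      obtain D where D: "D \<in> pol N" "d = poly D x" using d unfolding R_def adjoin_def by blast
      have D0: "D \<noteq> 0" using D d by auto
      define c where "c = lead_coeff h"
      have "lead_coeff D * c ^ k \<in> N" for k
      proof -
        obtain E where E: "E \<in> pol N" "d * poly h x ^ k = poly E x" using d(3) unfolding R_def adjoin_def by blast
        have "D * h ^ k \<in> pol K"
          using D less.prems pol_mono[OF NK] is_subringD(6)[OF is_subring_pol[OF KR]] is_subring_power[OF is_subring_pol[OF KR]]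
          by (meson subsetD)
        then have "D * h ^ k = E" using inj E D pol_mono[OF NK] by (metis poly_mult poly_power subsetD)
        then have "lead_coeff E = lead_coeff D * c ^ k" by (auto simp: lead_coeff_mult lead_coeff_power c_def)
        then show ?thesis using coeff_pol[OF E(1)] by metis
      qed
      then have "c ^ k \<in> lspan N {1 / lead_coeff D}" for k
        using lspan_scaled_base[of "lead_coeff D * c ^ k" N "1 / lead_coeff D"] D0 by simp
      then have "is_integral N c" using integral_if_powers_in_span[OF N(1,2)] by blast
      moreover have "c \<in> K" using less.prems by (simp add: c_def coeff_pol)
      ultimately have c: "c \<in> N" using N(3) unfolding int_closed_def K_def by blast
      define M where "M = monom c (degree h)"
      have M: "M \<in> pol N" unfolding M_def using c N by (simp add: monom_pol)
      have "h - M \<in> pol N"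
      proof (cases "h - M = 0")
        case True
        then show ?thesis using zero_pol[OF N(1)] by simp
      next
        case nz: False
        have "degree (h - M) \<le> degree h" unfolding M_def by (intro degree_diff_le degree_monom_le) simp
        moreover have "coeff (h - M) (degree h) = 0" by (simp add: M_def c_def)
        ultimately have "degree (h - M) < degree h" using nz by (metis eq_zero_or_degree_less)
        moreover have "h - M \<in> pol K" using less.prems M pol_mono[OF NK] is_subringD(5)[OF is_subring_pol[OF KR]] by blast
        moreover have "poly M x \<in> R" using M by (auto simp: R_def adjoin_def)
        then have "is_integral R (poly (h - M) x)"
          using less.prems is_integral_base[OF R(1)] is_subringD(5)[OF is_subring_integral[OF R]] by auto
        ultimately show ?thesis using less.hyps by blast
      qed
      then show ?thesis using is_subringD(4)[OF is_subring_pol[OF N(1)] _ M] by force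
    qed
  qed
  show ?thesis
    unfolding int_closed_def R_def[symmetric] using polynomial coeffs by (force simp: R_def adjoin_def)
qed

section \<open>Finiteness of integral closure\<close>

text \<open>Replacing scalars from \<open>N[x]\<close> by their constant terms turns an
  \<open>N[x]\<close>-combination of \<open>W\<close> into an \<open>N\<close>-combination;
  \<open>F\<close> records both, one as its value at \<open>x\<close> and one as its constant
  term.\<close>

lemma lspan_adjoin_constant_coeff:
  assumes N: "is_subring N" and J: "is_subring J" "N \<subseteq> J" "W \<subseteq> J" and s: "s \<in> lspan (adjoin N x) W"
  shows "\<exists>F\<in>pol J. poly F x = s \<and> coeff F 0 \<in> lspan N W"
  using s
proof induction
  case zero
  show ?case using zero_pol[OF J(1)] by (intro bexI[of _ 0]) (auto intro: lspan.zero)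
next
  case (step r w y)
  then obtain F where F: "F \<in> pol J" "poly F x = y" "coeff F 0 \<in> lspan N W" by auto
  obtain p where p: "p \<in> pol N" "r = poly p x" using step by (auto simp: adjoin_def)
  have "smult w p \<in> pol J" using p pol_mono[OF J(2)] J step smult_pol[OF J(1)] by blast
  then have "smult w p + F \<in> pol J" using F is_subringD(4)[OF is_subring_pol[OF J(1)]] by blast
  moreover have "coeff (smult w p + F) 0 \<in> lspan N W"
    using lspan.step[OF coeff_pol[OF p(1), of 0] step(2) F(3)] by (simp add: mult.commute)
  ultimately show ?case using p F by (intro bexI[of _ "smult w p + F"]) (auto simp: mult.commute)
qed

text \<open>For a transcendental \<open>x\<close>, an element algebraic over \<open>N\<close> in the \<open>N[x]\<close>-span of other such elements
  lies in their \<open>N\<close>-span, by comparing constant coefficients.\<close>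

theorem integral_closure_finite:
  fixes N :: "'a::{alg_closed_field,field_char_0} set"
  assumes "is_subring N" "noetherian N" "int_closed N"
  shows "\<exists>V. finite V \<and> {s \<in> Frac (ring_hull (N \<union> set xs)). is_integral N s} \<subseteq> lspan N V"
  using assms
proof (induction xs arbitrary: N)
  case Nil
  have "{s \<in> Frac N. is_integral N s} \<subseteq> lspan N {1}"
    using Nil lspan_one unfolding int_closed_def by blast
  then show ?case using ring_hull_eq[OF Nil(1)] by (intro exI[of _ "{1}"]) auto
next
  case (Cons x xs)
  note N = Cons.prems
  define K where "K = Frac N"
  have K: "subfield_set K" unfolding K_def using N subfield_Frac by blast
  have KR: "is_subring K" using K subfield_setD by blast
  have NK: "N \<subseteq> K" unfolding K_def using N Frac_base by blast
  define S where "S = {s \<in> Frac (ring_hull (N \<union> set (x # xs))). is_integral N s}"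
  show ?case
  proof (cases "is_algebraic N x")
    case False
    define R where "R = adjoin N x"
    have R: "is_subring R" "noetherian R" "int_closed R"
      unfolding R_def using N False is_subring_adjoin noetherian_adjoin int_closed_adjoin_transcendental by auto
    have "ring_hull (N \<union> set (x # xs)) \<subseteq> ring_hull (R \<union> set xs)"
      using adjoin_base[OF N(1), of x] adjoin_gen[OF N(1), of x] unfolding R_def by (intro ring_hull_mono) auto
    then have "S \<subseteq> {s \<in> Frac (ring_hull (R \<union> set xs)). is_integral R s}"
      unfolding S_def using Frac_mono is_integral_mono[of N _ R] adjoin_base[OF N(1), of x] unfolding R_def by blast
    then obtain V where "finite V" "S \<subseteq> lspan R V" using Cons.IH[OF R] by (meson order_trans)
    \<comment> \<open>\<open>V\<close> may involve \<open>x\<close>. Generators inside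
      \<open>S\<close> are integral over \<open>N\<close>, hence lie in \<open>J\<close>, as the
      comparison of constant terms requires.\<close>
    then obtain W where W: "finite W" "W \<subseteq> S" "S \<subseteq> lspan R W" using noetherian_module[OF R(1,2)] by meson
    define J where "J = {x. is_integral K x}"
    have J: "subfield_set J" unfolding J_def by (rule subfield_integral[OF K])
    have JR: "is_subring J" using J subfield_setD by blast
    have NJ: "N \<subseteq> J" using NK is_integral_base[OF KR] by (auto simp: J_def)
    have SJ: "S \<subseteq> J" using is_integral_mono[OF _ NK] by (auto simp: J_def S_def)
    have trans: "\<not> is_algebraic J x"
    proof
      assume "is_algebraic J x"
      then have "is_integral J x" using integral_iff_algebraic[OF J] by blast
      then have "is_integral K x"
        using integral_trans[OF KR noetherian_subfield[OF K], of J] by (auto simp: J_def)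
      then show False using False algebraic_if_integral algebraic_Frac[OF N(1)] unfolding K_def by blast
    qed
    have "s \<in> lspan N W" if s: "s \<in> S" for s
    proof -
      obtain F where F: "F \<in> pol J" "poly F x = s" "coeff F 0 \<in> lspan N W"
        using lspan_adjoin_constant_coeff[OF N(1) JR NJ, of W s x] W SJ s unfolding R_def by blast
      \<comment> \<open>\<open>F\<close> and the constant \<open>s\<close> agree at
        \<open>x\<close>, which is transcendental over \<open>J\<close>, so they are equal.\<close>
      have "F - [:s:] \<in> pol J" using F s SJ is_subringD(5)[OF is_subring_pol[OF JR] F(1) const_pol[OF JR]] by blast
      moreover have "poly (F - [:s:]) x = 0" using F by simp
      ultimately have "F = [:s:]" using trans by (auto simp: is_algebraic_def)
      then show ?thesis using F by simp
    qed
    then show ?thesis using W unfolding S_def by blast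
  next
    case True
    \<comment> \<open>Over \<open>K\<close>, an integral multiple of \<open>x\<close> generates the
      same field as \<open>x\<close>.\<close>
    obtain d where d: "d \<in> N" "d \<noteq> 0" "is_integral N (d * x)" using algebraic_scaled_integral[OF N(1) True] by blast
    define L where "L = adjoin K (d * x)"
    have alg: "is_algebraic K (d * x)" using d(3) algebraic_if_integral algebraic_mono NK by blast
    have L: "subfield_set L" unfolding L_def by (rule subfield_adjoin[OF K alg])
    have KL: "K \<subseteq> L" unfolding L_def by (rule adjoin_base[OF KR])
    \<comment> \<open>The integral closure of \<open>N\<close> in \<open>L\<close>. Being finite
      over \<open>N\<close> it is again Noetherian and normal, and serves as the base for the
      remaining generators.\<close>
    define R where "R = {y \<in> L. is_integral N y}"
    have NR: "N \<subseteq> R" using is_integral_base[OF N(1)] NK KL by (auto simp: R_def)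
    have "is_subring R"
      using is_subring_integral[OF N(1,2)] subfield_setD[OF L] unfolding R_def is_subring_def by auto
    moreover obtain V where V: "finite V" "R \<subseteq> lspan N V"
      using simple_integral_closure_finite[OF N d(3)] unfolding R_def L_def K_def by blast
    moreover have "noetherian R" using noetherian_finite_extension[OF N(1,2) V NR] .
    moreover have "int_closed R"
      unfolding int_closed_def
    proof (intro ballI impI)
      fix z assume z: "z \<in> Frac R" "is_integral R z"
      have "z \<in> L" using z Frac_least[OF L, of R] by (auto simp: R_def)
      moreover have "is_integral N z" using integral_trans[OF N(1,2) _ z(2)] by (auto simp: R_def)
      ultimately show "z \<in> R" by (simp add: R_def)
    qed
    ultimately have R: "is_subring R" "noetherian R" "int_closed R" by auto
    obtain W where W: "finite W" "{s \<in> Frac (ring_hull (R \<union> set xs)). is_integral R s} \<subseteq> lspan R W"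
      using Cons.IH[OF R] by blast
    have F: "subfield_set (Frac (ring_hull (R \<union> set xs)))" by (intro subfield_Frac is_subring_ring_hull)
    have sub: "R \<union> set xs \<subseteq> Frac (ring_hull (R \<union> set xs))"
      using Frac_base[OF is_subring_ring_hull, of "R \<union> set xs"] ring_hull_subset[of "R \<union> set xs"] by blast
    have "d * x \<in> R" using d(3) adjoin_gen[OF KR] by (auto simp: R_def L_def)
    then have "(d * x) / d \<in> Frac (ring_hull (R \<union> set xs))"
      using sub d(1) NR by (intro subfield_set_divide[OF F]) auto
    then have "x \<in> Frac (ring_hull (R \<union> set xs))" using d(2) by simp
    then have "ring_hull (N \<union> set (x # xs)) \<subseteq> Frac (ring_hull (R \<union> set xs))"
      using sub NR by (intro ring_hull_least subfield_setD[OF F]) auto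
    then have "S \<subseteq> {s \<in> Frac (ring_hull (R \<union> set xs)). is_integral R s}"
      unfolding S_def using Frac_least[OF F] is_integral_mono[OF _ NR] by blast
    also have "\<dots> \<subseteq> lspan N (prod_set V W)" using W(2) lspan_tower[OF N(1) V(2)] by blast
    finally have "S \<subseteq> lspan N (prod_set V W)" .
    with finite_prod_set[OF V(1) W(1)] show ?thesis unfolding S_def by blast
  qed
qed

section \<open>Noether normalization\<close>

text \<open>Exponent vectors of length \<open>n\<close> are continued by zeros, so that equal
  vectors are equal functions. A finite set of them with a coefficient function encodes a polynomial
  in \<open>n\<close> variables.\<close>

definition exps :: "nat \<Rightarrow> (nat \<Rightarrow> nat) set" where
  "exps n = {e. \<forall>i\<ge>n. e i = 0}"

definition mono_val :: "nat \<Rightarrow> (nat \<Rightarrow> 'a::comm_ring_1) \<Rightarrow> (nat \<Rightarrow> nat) \<Rightarrow> 'a" where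
  "mono_val n x e = (\<Prod>i<n. x i ^ e i)"

definition alg_indep :: "'a::comm_ring_1 set \<Rightarrow> nat \<Rightarrow> (nat \<Rightarrow> 'a) \<Rightarrow> bool" where
  "alg_indep k n x \<longleftrightarrow> (\<forall>S c. finite S \<and> S \<subseteq> exps n \<and> (\<forall>e\<in>S. c e \<in> k) \<and>
     (\<Sum>e\<in>S. c e * mono_val n x e) = 0 \<longrightarrow> (\<forall>e\<in>S. c e = 0))"

lemma ring_hull_subset_lspan_monomials:
  assumes k: "is_subring k"
  shows "ring_hull (k \<union> x ` {..<n}) \<subseteq> lspan k (mono_val n x ` exps n)"
proof (rule ring_hull_least)
  let ?L = "lspan k (mono_val n x ` exps n)"
  have one: "1 \<in> mono_val n x ` exps n"
    by (rule image_eqI[of _ _ "\<lambda>_. 0"]) (auto simp: mono_val_def exps_def)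
  have "a \<in> ?L" if "a \<in> k" for a using lspan_scaled_base[OF that one] by simp
  moreover have "x i \<in> ?L" if "i < n" for i
  proof -
    have "mono_val n x (\<lambda>j. if j = i then 1 else 0) = (\<Prod>j<n. if j = i then x i else 1)"
      unfolding mono_val_def by (intro prod.cong) auto
    also have "\<dots> = x i" using that by simp
    finally have "x i \<in> mono_val n x ` exps n"
      using that by (intro image_eqI[of _ _ "\<lambda>j. if j = i then 1 else 0"]) (auto simp: exps_def)
    then show ?thesis by (rule lspan_base[OF k])
  qed
  ultimately show "k \<union> x ` {..<n} \<subseteq> ?L" by auto
  show "is_subring ?L"
    unfolding is_subring_def
  proof (intro conjI ballI)
    show "1 \<in> ?L" using lspan_base[OF k one] .
    fix y z assume yz: "y \<in> ?L" "z \<in> ?L"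
    show "y - z \<in> ?L" using lspan_diff[OF k yz] .
    have "prod_set (mono_val n x ` exps n) (mono_val n x ` exps n) \<subseteq> mono_val n x ` exps n"
    proof
      fix w assume "w \<in> prod_set (mono_val n x ` exps n) (mono_val n x ` exps n)"
      then obtain e f where ef: "e \<in> exps n" "f \<in> exps n" "w = mono_val n x e * mono_val n x f"
        by (auto simp: prod_set_def)
      then have "w = mono_val n x (\<lambda>i. e i + f i)" by (simp add: mono_val_def power_add prod.distrib)
      then show "w \<in> mono_val n x ` exps n" using ef by (auto simp: exps_def)
    qed
    then show "y * z \<in> ?L" using lspan_mult[OF k yz] lspan_mono[of k k] by blast
  qed
qed

lemma lspan_monomials_sum:
  assumes k: "is_subring k" and y: "y \<in> lspan k (mono_val n x ` exps n)"
  shows "\<exists>S c. finite S \<and> S \<subseteq> exps n \<and> (\<forall>e\<in>S. c e \<in> k) \<and> y = (\<Sum>e\<in>S. c e * mono_val n x e)"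
  using y
proof induction
  case zero
  show ?case by (intro exI[of _ "{}"]) auto
next
  case (step r v y)
  then obtain S c where S: "finite S" "S \<subseteq> exps n" "\<forall>e\<in>S. c e \<in> k" "y = (\<Sum>e\<in>S. c e * mono_val n x e)"
    by auto
  obtain f where f: "f \<in> exps n" "v = mono_val n x f" using step by auto
  \<comment> \<open>The monomial \<open>f\<close> may already occur in the sum; then the
    coefficients add.\<close>
  define c' where "c' = c(f := r + (if f \<in> S then c f else 0))"
  have "(\<Sum>e\<in>insert f S. c' e * mono_val n x e) = c' f * mono_val n x f + (\<Sum>e\<in>S - {f}. c' e * mono_val n x e)"
    using S(1) by (subst sum.insert_remove) auto
  also have "(\<Sum>e\<in>S - {f}. c' e * mono_val n x e) = (\<Sum>e\<in>S - {f}. c e * mono_val n x e)"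
    by (intro sum.cong) (auto simp: c'_def)
  also have "c' f * mono_val n x f + (\<Sum>e\<in>S - {f}. c e * mono_val n x e) = r * v + y"
    using S(1) unfolding S(4) f(2) by (cases "f \<in> S") (auto simp: c'_def sum.remove algebra_simps)
  finally show ?case using S f step is_subringD[OF k]
    by (intro exI[of _ "insert f S"] exI[of _ c']) (auto simp: c'_def)
qed

text \<open>Expanding the coefficients of an equation for \<open>x n\<close> into monomials in the
  earlier elements would give a relation among all \<open>n + 1\<close> of them.\<close>

lemma alg_indep_Suc:
  fixes x :: "nat \<Rightarrow> 'a::field"
  assumes k: "is_subring k" and ind: "alg_indep k (Suc n) x"
  shows "alg_indep k n x" "\<not> is_algebraic (ring_hull (k \<union> x ` {..<n})) (x n)"
proof -
  show "alg_indep k n x"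
    unfolding alg_indep_def
  proof (intro allI impI, elim conjE)
    fix S c assume S: "finite S" "S \<subseteq> exps n" "\<forall>e\<in>S. c e \<in> k" "(\<Sum>e\<in>S. c e * mono_val n x e) = 0"
    have "S \<subseteq> exps (Suc n)" using S(2) by (auto simp: exps_def)
    moreover have "(\<Sum>e\<in>S. c e * mono_val (Suc n) x e) = (\<Sum>e\<in>S. c e * mono_val n x e)"
      using S(2) by (intro sum.cong) (auto simp: mono_val_def exps_def)
    ultimately show "\<forall>e\<in>S. c e = 0" using ind S unfolding alg_indep_def by metis
  qed
  show "\<not> is_algebraic (ring_hull (k \<union> x ` {..<n})) (x n)"
  proof
    assume "is_algebraic (ring_hull (k \<union> x ` {..<n})) (x n)"
    then obtain p where p: "p \<in> pol (ring_hull (k \<union> x ` {..<n}))" "p \<noteq> 0" "poly p (x n) = 0"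
      by (auto simp: is_algebraic_def)
    have "coeff p j \<in> lspan k (mono_val n x ` exps n)" for j
      using ring_hull_subset_lspan_monomials[OF k] coeff_pol[OF p(1)] by (rule subsetD)
    then have "\<forall>j. \<exists>S c. finite S \<and> S \<subseteq> exps n \<and> (\<forall>e\<in>S. c e \<in> k) \<and> coeff p j = (\<Sum>e\<in>S. c e * mono_val n x e)"
      using lspan_monomials_sum[OF k] by simp
    then obtain S c where S: "\<And>j. finite (S j)" "\<And>j. S j \<subseteq> exps n" "\<And>j e. e \<in> S j \<Longrightarrow> c j e \<in> k"
      "\<And>j. coeff p j = (\<Sum>e\<in>S j. c j e * mono_val n x e)" by metis
    define d where "d = degree p"
    define T where "T = Sigma {..d} S"
    \<comment> \<open>Writes the power \<open>j\<close> of \<open>x n\<close> into the free slot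
      \<open>n\<close>; \<open>c'\<close> reads it back.\<close>
    define h where "h = (\<lambda>(j, e). e(n := j) :: nat \<Rightarrow> nat)"
    define c' where "c' e = c (e n) (e(n := 0))" for e
    have T: "finite T" unfolding T_def using S by auto
    have e0: "e(n := 0) = e" if "e \<in> S j" for e j
      using subsetD[OF S(2) that] by (intro fun_upd_idem) (simp add: exps_def)
    have c'h: "c' (h (j, e)) = c j e" if "e \<in> S j" for j e
      using e0[OF that] by (simp add: c'_def h_def)
    have inj: "inj_on h T"
    proof (rule inj_onI)
      fix u v assume uv: "u \<in> T" "v \<in> T" "h u = h v"
      obtain j e where u: "u = (j, e)" by (cases u)
      obtain i f where v: "v = (i, f)" by (cases v)
      have eq: "e(n := j) = f(n := i)" using uv by (simp add: u v h_def)
      then have "j = i" by (metis fun_upd_same)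
      moreover have "e(n := 0) = f(n := 0)" using eq by (metis fun_upd_upd)
      then have "e = f" using e0[of e j] e0[of f i] uv by (simp add: u v T_def)
      ultimately show "u = v" using u v by simp
    qed
    have mono: "mono_val (Suc n) x (h (j, e)) = mono_val n x e * x n ^ j" for j e
      by (auto simp: mono_val_def h_def intro!: prod.cong)
    have "(\<Sum>e\<in>h ` T. c' e * mono_val (Suc n) x e) = (\<Sum>u\<in>T. c' (h u) * mono_val (Suc n) x (h u))"
      using inj by (simp add: sum.reindex)
    also have "\<dots> = (\<Sum>(j, e)\<in>T. c j e * mono_val n x e * x n ^ j)"
      by (intro sum.cong) (auto simp: T_def c'h mono)
    also have "\<dots> = (\<Sum>j\<le>d. \<Sum>e\<in>S j. c j e * mono_val n x e * x n ^ j)"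
      unfolding T_def using S(1) by (subst sum.Sigma) auto
    also have "\<dots> = poly p (x n)" by (simp add: poly_altdef d_def S(4) sum_distrib_right)
    finally have "(\<Sum>e\<in>h ` T. c' e * mono_val (Suc n) x e) = 0" using p by simp
    moreover have "h ` T \<subseteq> exps (Suc n)" using S(2) by (fastforce simp: T_def h_def exps_def)
    moreover have "\<forall>e\<in>h ` T. c' e \<in> k" using c'h S(3) by (auto simp: T_def)
    ultimately have 0: "\<forall>e\<in>h ` T. c' e = 0"
      using ind[unfolded alg_indep_def, THEN spec, THEN spec, of "h ` T" c'] finite_imageI[OF T] by blast
    have "c d e = 0" if "e \<in> S d" for e
      using 0 c'h[OF that] that by (auto simp: T_def)
    then have "coeff p d = 0" unfolding S(4) by (intro sum.neutral) auto
    then show False using p(2) by (simp add: d_def)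
  qed
qed

lemma alg_indep_int_closed:
  fixes x :: "nat \<Rightarrow> 'a::alg_closed_field"
  assumes k: "subfield_set k" and "alg_indep k n x"
  shows "int_closed (ring_hull (k \<union> x ` {..<n}))"
  using assms(2)
proof (induction n)
  case 0
  have "Frac k \<subseteq> k" by (rule Frac_least[OF k]) auto
  moreover have "ring_hull k = k" using subfield_setD[OF k] by (rule ring_hull_eq)
  ultimately show ?case by (auto simp: int_closed_def)
next
  case (Suc n)
  note kR = subfield_setD[OF k]
  let ?N = "ring_hull (k \<union> x ` {..<n})"
  have "k \<union> x ` {..<Suc n} = insert (x n) (k \<union> x ` {..<n})" by (auto simp: less_Suc_eq)
  then have "ring_hull (k \<union> x ` {..<Suc n}) = adjoin ?N (x n)" by (simp add: ring_hull_insert)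
  moreover have "noetherian ?N" using kR noetherian_subfield[OF k] by (intro noetherian_ring_hull) auto
  ultimately show ?case
    using int_closed_adjoin_transcendental[OF is_subring_ring_hull] alg_indep_Suc[OF kR Suc.prems] Suc.IH by simp
qed

lemma base_digits_unique:
  fixes r :: nat
  assumes "\<And>i. i < n \<Longrightarrow> e i < r" "\<And>i. i < n \<Longrightarrow> f i < r" "(\<Sum>i<n. e i * r ^ i) = (\<Sum>i<n. f i * r ^ i)"
  shows "\<forall>i<n. e i = f i"
  using assms
proof (induction n arbitrary: e f)
  case (Suc n)
  have split: "(\<Sum>i<Suc n. g i * r ^ i) = g 0 + r * (\<Sum>i<n. g (Suc i) * r ^ i)" for g
    by (subst sum.lessThan_Suc_shift) (simp add: sum_distrib_left mult_ac)
  have r: "e 0 < r" "f 0 < r" using Suc.prems by auto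
  have eq: "e 0 + r * (\<Sum>i<n. e (Suc i) * r ^ i) = f 0 + r * (\<Sum>i<n. f (Suc i) * r ^ i)"
    using Suc.prems(3) unfolding split .
  from arg_cong[OF eq, of "\<lambda>z. z mod r"] have 0: "e 0 = f 0" using r by simp
  with eq r have "(\<Sum>i<n. e (Suc i) * r ^ i) = (\<Sum>i<n. f (Suc i) * r ^ i)" by simp
  then have "\<forall>i<n. e (Suc i) = f (Suc i)" using Suc.prems(1,2) by (intro Suc.IH) auto
  then show ?case using 0 by (auto simp: less_Suc_eq_0_disj)
qed simp

text \<open>Nagata's substitution \<open>y\<^sub>i = x\<^sub>i - x\<^sub>0 ^ r\<^sup>i\<close>, with \<open>r\<close> larger than every exponent of a relation among the
  \<open>x\<^sub>i\<close>: the monomials of the relation get distinct degrees in \<open>x\<^sub>0\<close>.\<close>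

lemma dependent_imp_integral:
  fixes x :: "nat \<Rightarrow> 'a::field"
  assumes k: "subfield_set k" and dep: "\<not> alg_indep k n x"
  shows "\<exists>y. n > 0 \<and> y ` {..<n - 1} \<subseteq> ring_hull (k \<union> x ` {..<n}) \<and>
           (\<forall>z\<in>ring_hull (k \<union> x ` {..<n}). is_integral (ring_hull (k \<union> y ` {..<n - 1})) z)"
proof -
  note kR = subfield_setD[OF k]
  obtain S0 c where S0: "finite S0" "S0 \<subseteq> exps n" "\<forall>e\<in>S0. c e \<in> k" "(\<Sum>e\<in>S0. c e * mono_val n x e) = 0"
      "\<exists>e\<in>S0. c e \<noteq> 0" using dep unfolding alg_indep_def by blast
  define S where "S = {e \<in> S0. c e \<noteq> 0}"
  have S: "finite S" "S \<noteq> {}" "S \<subseteq> exps n" "\<And>e. e \<in> S \<Longrightarrow> c e \<in> k" "\<And>e. e \<in> S \<Longrightarrow> c e \<noteq> 0"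
    using S0 by (auto simp: S_def)
  have "(\<Sum>e\<in>S. c e * mono_val n x e) = (\<Sum>e\<in>S0. c e * mono_val n x e)"
    using S0(1) by (intro sum.mono_neutral_left) (auto simp: S_def)
  then have rel: "(\<Sum>e\<in>S. c e * mono_val n x e) = 0" using S0 by simp
  have n: "n > 0"
  proof (rule ccontr)
    assume "\<not> n > 0"
    then have "n = 0" by simp
    then have "S \<subseteq> {\<lambda>_. 0}" using S(3) by (auto simp: exps_def)
    then have "S = {\<lambda>_. 0}" using S(2) by blast
    then show False using rel S(5) \<open>n = 0\<close> by (simp add: mono_val_def)
  qed
  \<comment> \<open>Exceeds every exponent of the relation, so that exponents are digits in base
    \<open>r\<close>.\<close>
  define r where "r = Suc (\<Sum>e\<in>S. \<Sum>i<n. e i)"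
  have r: "e i < r" if "e \<in> S" "i < n" for e i
  proof -
    have "e i \<le> (\<Sum>i<n. e i)" using that by (intro member_le_sum) auto
    also have "\<dots> \<le> (\<Sum>e\<in>S. \<Sum>i<n. e i)" using that S(1) by (intro member_le_sum[of e S "\<lambda>e. \<Sum>i<n. e i"]) auto
    finally show ?thesis by (simp add: r_def)
  qed
  define W where "W e = (\<Sum>i<n. e i * r ^ i)" for e :: "nat \<Rightarrow> nat"
  have W_inj: "e = f" if "e \<in> S" "f \<in> S" "W e = W f" for e f
  proof
    fix i
    have "\<forall>i<n. e i = f i" using base_digits_unique[of n e r f] r that by (auto simp: W_def)
    moreover have "e i = f i" if "i \<ge> n" using subsetD[OF S(3) \<open>e \<in> S\<close>] subsetD[OF S(3) \<open>f \<in> S\<close>] that by (simp add: exps_def)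
    ultimately show "e i = f i" by (cases "i < n") auto
  qed
  define y where "y i = x i - x 0 ^ (r ^ i)" for i
  \<comment> \<open>Since \<open>r ^ 0 = 1\<close>, index 0 contributes no generator; this is how
    their number drops to \<open>n - 1\<close>.\<close>
  have y0: "y 0 = 0" by (simp add: y_def)
  define R where "R = ring_hull (k \<union> (\<lambda>i. y (Suc i)) ` {..<n - 1})"
  have R: "is_subring R" "noetherian R"
    unfolding R_def using kR noetherian_subfield[OF k] by (auto intro: is_subring_ring_hull noetherian_ring_hull)
  have kR': "k \<subseteq> R" and yR': "(\<lambda>i. y (Suc i)) ` {..<n - 1} \<subseteq> R"
    unfolding R_def using ring_hull_subset[of "k \<union> (\<lambda>i. y (Suc i)) ` {..<n - 1}"] by auto
  have yR: "y i \<in> R" if "i < n" for i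
    using yR' that y0 is_subringD(1)[OF R(1)] by (cases i) auto
  \<comment> \<open>The monomial \<open>e\<close> after substituting
    \<open>y i + X ^ (r ^ i)\<close> for \<open>x i\<close>: monic of degree \<open>W e\<close>, and
    equal to the original monomial at \<open>X = x 0\<close>.\<close>
  define P where "P e = (\<Prod>i<n. (monom 1 (r ^ i) + [:y i:]) ^ e i)" for e :: "nat \<Rightarrow> nat"
  have lin: "degree (monom 1 (r ^ i) + [:y i:]) = r ^ i" "lead_coeff (monom 1 (r ^ i) + [:y i:]) = 1" for i
  proof -
    have d: "degree [:y i:] < degree (monom (1 :: 'a) (r ^ i))" by (simp add: degree_monom_eq r_def)
    show "degree (monom 1 (r ^ i) + [:y i:]) = r ^ i"
      using degree_add_eq_left[OF d] by (simp add: degree_monom_eq)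
    have "lead_coeff ([:y i:] + monom 1 (r ^ i)) = 1"
      unfolding lead_coeff_add_le[OF d] by (simp add: degree_monom_eq)
    then show "lead_coeff (monom 1 (r ^ i) + [:y i:]) = 1" by (simp only: add.commute)
  qed
  have nz: "monom 1 (r ^ i) + [:y i:] \<noteq> 0" for i using lin(2)[of i] by force
  have P_pol: "P e \<in> pol R" for e
    unfolding P_def using R is_subringD(2)[OF R(1)] yR
    by (intro is_subring_prod[OF is_subring_pol] is_subring_power[OF is_subring_pol]
        is_subringD(4)[OF is_subring_pol] monom_pol const_pol) auto
  have P_deg: "degree (P e) = W e" for e
    unfolding P_def W_def using nz
    by (subst degree_prod_sum_eq) (auto simp: degree_power_eq lin)
  have P_lead: "lead_coeff (P e) = 1" for e
    unfolding P_def by (simp only: lead_coeff_prod lead_coeff_power lin(2) power_one prod.neutral_const)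
  have P_val: "poly (P e) (x 0) = mono_val n x e" for e
    by (simp add: P_def mono_val_def poly_prod poly_monom y_def)
  define Q where "Q = (\<Sum>e\<in>S. smult (c e) (P e))"
  have Q: "Q \<in> pol R" unfolding Q_def using S kR' P_pol R
    by (intro is_subring_sum[OF is_subring_pol] smult_pol) auto
  have Q0: "poly Q (x 0) = 0" using rel by (simp add: Q_def poly_sum P_val)
  \<comment> \<open>The weights are distinct, so a single term has the highest degree, and its
    coefficient is invertible in \<open>k\<close>.\<close>
  obtain e where e: "e \<in> S" "\<And>f. f \<in> S \<Longrightarrow> W f \<le> W e"
    using Max_in[of "W ` S"] Max_ge[of "W ` S"] S(1,2) by fastforce
  have "coeff (P f) (W e) = 0" if "f \<in> S" "f \<noteq> e" for f
  proof -
    have "W f < W e" using e(2)[OF that(1)] W_inj[OF that(1) e(1)] that(2) by force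
    then show ?thesis by (simp add: coeff_eq_0 P_deg)
  qed
  then have "coeff Q (W e) = (\<Sum>f\<in>S. if f = e then c e else 0)"
    unfolding Q_def using P_lead[of e] by (auto simp: coeff_sum P_deg intro!: sum.cong)
  then have Qe: "coeff Q (W e) = c e" using e S(1) by simp
  have "degree Q \<le> W e"
    unfolding Q_def using e(2) by (intro degree_sum_le S(1) order_trans[OF degree_smult_le]) (simp add: P_deg)
  then have "degree Q = W e" using Qe S(5)[OF e(1)] le_degree[of Q "W e"] by simp
  then have lQ: "lead_coeff Q = c e" using Qe by simp
  have inv: "inverse (c e) \<in> R" using S(4)[OF e(1)] k kR' by (auto simp: subfield_set_def)
  have x0: "is_integral R (x 0)"
    unfolding is_integral_def using smult_pol[OF R(1) inv Q] lQ S(5)[OF e(1)] Q0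
    by (intro bexI[of _ "smult (inverse (c e)) Q"]) auto
  note I = is_subring_integral[OF R]
  have "is_integral R (x i)" if "i < n" for i
  proof -
    have "x 0 ^ (r ^ i) \<in> {x. is_integral R x}" using x0 by (intro is_subring_power[OF I]) auto
    moreover have "y i \<in> {x. is_integral R x}" using is_integral_base[OF R(1) yR[OF that]] by auto
    ultimately have "y i + x 0 ^ (r ^ i) \<in> {x. is_integral R x}" using is_subringD(4)[OF I] by blast
    then show ?thesis by (simp add: y_def)
  qed
  then have "ring_hull (k \<union> x ` {..<n}) \<subseteq> {x. is_integral R x}"
    using kR' is_integral_base[OF R(1)] by (intro ring_hull_least I) auto
  moreover have "(\<lambda>i. y (Suc i)) ` {..<n - 1} \<subseteq> ring_hull (k \<union> x ` {..<n})"
  proof -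
    let ?A = "ring_hull (k \<union> x ` {..<n})"
    have xA: "x i \<in> ?A" if "i < n" for i using ring_hull_subset[of "k \<union> x ` {..<n}"] that by auto
    have "y i \<in> ?A" if "i < n" for i
      unfolding y_def using is_subringD(5)[OF is_subring_ring_hull xA[OF that]]
        is_subring_power[OF is_subring_ring_hull xA[OF n]] by blast
    then show ?thesis by auto
  qed
  ultimately show ?thesis using n unfolding R_def by (intro exI[of _ "\<lambda>i. y (Suc i)"]) auto
qed

text \<open>Induction on the number of generators: a dependent system is traded for one with
  \<open>n - 1\<close> elements, and integrality is transitive over the Noetherian ring at the
  bottom.\<close>

theorem noether_normalization:
  fixes x :: "nat \<Rightarrow> 'a::field"
  assumes k: "subfield_set k"
  shows "\<exists>d t. alg_indep k d t \<and> t ` {..<d} \<subseteq> ring_hull (k \<union> x ` {..<n}) \<and>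
           (\<forall>z\<in>ring_hull (k \<union> x ` {..<n}). is_integral (ring_hull (k \<union> t ` {..<d})) z)"
proof (induction n arbitrary: x rule: less_induct)
  case (less n)
  show ?case
  proof (cases "alg_indep k n x")
    case True
    then show ?thesis
      using ring_hull_subset[of "k \<union> x ` {..<n}"] is_integral_base[OF is_subring_ring_hull]
      by (intro exI[of _ n] exI[of _ x]) auto
  next
    case False
    obtain y where y: "n > 0" "y ` {..<n - 1} \<subseteq> ring_hull (k \<union> x ` {..<n})"
      "\<forall>z\<in>ring_hull (k \<union> x ` {..<n}). is_integral (ring_hull (k \<union> y ` {..<n - 1})) z"
      using dependent_imp_integral[OF k False] by blast
    let ?R = "ring_hull (k \<union> y ` {..<n - 1})"
    obtain d t where t: "alg_indep k d t" "t ` {..<d} \<subseteq> ?R" "\<forall>z\<in>?R. is_integral (ring_hull (k \<union> t ` {..<d})) z"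
      using less.IH[of "n - 1" y] y(1) by auto
    have "?R \<subseteq> ring_hull (k \<union> x ` {..<n})"
      using y(2) ring_hull_subset[of "k \<union> x ` {..<n}"] by (intro ring_hull_least is_subring_ring_hull) auto
    moreover have "noetherian (ring_hull (k \<union> t ` {..<d}))"
      using subfield_setD[OF k] noetherian_subfield[OF k] by (intro noetherian_ring_hull) auto
    ultimately show ?thesis
      using t y(3) integral_trans[OF is_subring_ring_hull, of "k \<union> t ` {..<d}" ?R]
      by (intro exI[of _ d] exI[of _ t]) blast
  qed
qed

section \<open>Finite generation of integral subalgebras\<close>

text \<open>Normalization of \<open>ring_hull (k \<union> E)\<close> gives the normal Noetherian
  ring \<open>N\<close>, and \<open>E'\<close> bounds the field in which \<open>C\<close> lives. So
  \<open>C\<close> lies in a finite \<open>N\<close>-module, is itself spanned by finitely many of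
  its elements, and these together with the \<open>t i\<close> generate it as an algebra.\<close>

lemma integral_subalgebra_finitely_generated_field:
  fixes k :: "'a::{alg_closed_field,field_char_0} set"
  assumes k: "subfield_set k" and fin: "finite E" "finite E'" and C: "is_subring C"
    "ring_hull (k \<union> E) \<subseteq> C" "C \<subseteq> ring_hull (k \<union> E')" "\<And>z. z \<in> C \<Longrightarrow> is_integral (ring_hull (k \<union> E)) z"
  shows "\<exists>F. finite F \<and> F \<subseteq> C \<and> C = ring_hull (k \<union> F)"
proof -
  obtain x :: "nat \<Rightarrow> 'a" and n where x: "E = x ` {..<n}"
    using finite_imp_nat_seg_image_inj_on[OF fin(1)] unfolding lessThan_def by blast
  obtain d t where t: "alg_indep k d t" "t ` {..<d} \<subseteq> ring_hull (k \<union> E)"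
    "\<forall>z\<in>ring_hull (k \<union> E). is_integral (ring_hull (k \<union> t ` {..<d})) z"
    using noether_normalization[OF k, of x n] unfolding x by blast
  define N where "N = ring_hull (k \<union> t ` {..<d})"
  have N: "is_subring N" "noetherian N" "int_closed N"
    unfolding N_def using subfield_setD[OF k] noetherian_subfield[OF k] alg_indep_int_closed[OF k t(1)]
    by (auto intro: is_subring_ring_hull noetherian_ring_hull)
  obtain xs where xs: "set xs = E'" using finite_list[OF fin(2)] by blast
  obtain V where V: "finite V" "{s \<in> Frac (ring_hull (N \<union> E')). is_integral N s} \<subseteq> lspan N V"
    using integral_closure_finite[OF N, of xs] unfolding xs by blast
  have kN: "k \<subseteq> N" unfolding N_def using ring_hull_subset[of "k \<union> t ` {..<d}"] by blast
  have "C \<subseteq> ring_hull (N \<union> E')" using C(3) ring_hull_mono[of "k \<union> E'" "N \<union> E'"] kN by blast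
  also have "\<dots> \<subseteq> Frac (ring_hull (N \<union> E'))" by (intro Frac_base is_subring_ring_hull)
  finally have "C \<subseteq> Frac (ring_hull (N \<union> E'))" .
  moreover have "is_integral N z" if "z \<in> C" for z
    using integral_trans[OF N(1,2) _ C(4)[OF that]] t(3) by (simp add: N_def)
  ultimately have "C \<subseteq> lspan N V" using V(2) by blast
  from noetherian_module[OF N(1,2) V(1) this]
  obtain W where W: "finite W" "W \<subseteq> C" "C \<subseteq> lspan N W" by blast
  define F where "F = t ` {..<d} \<union> W"
  have F: "F \<subseteq> C" unfolding F_def using W t(2) C(2) by blast
  have "k \<subseteq> C" using C(2) ring_hull_subset[of "k \<union> E"] by blast
  then have "ring_hull (k \<union> F) \<subseteq> C" using F C(1) by (intro ring_hull_least) auto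
  moreover have "N \<subseteq> ring_hull (k \<union> F)" unfolding N_def F_def by (intro ring_hull_mono) auto
  then have "lspan N W \<subseteq> ring_hull (k \<union> F)"
    using ring_hull_subset[of "k \<union> F"] by (intro lspan_subset_subring is_subring_ring_hull) (auto simp: F_def)
  ultimately have "C = ring_hull (k \<union> F)" using W(3) by blast
  then show ?thesis using F W(1) by (intro exI[of _ F]) (auto simp: F_def)
qed

lemma integral_image:
  assumes f: "is_hom f" and x: "is_integral R x"
  shows "is_integral (f ` R) (f x)"
proof -
  obtain p where p: "p \<in> pol R" "lead_coeff p = 1" "poly p x = 0" using x by (auto simp: is_integral_def)
  have f0: "f 0 = 0" using is_homD[OF f] by blast
  have ev: "poly (map_poly f q) (f x) = f (poly q x)" for q
    by (induction q) (simp_all add: map_poly_pCons is_homD[OF f])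
  have c: "coeff (map_poly f p) i = f (coeff p i)" for i by (simp add: coeff_map_poly f0)
  have "coeff (map_poly f p) (degree p) = 1" using p(2) is_homD(1)[OF f] by (simp add: c)
  moreover have "degree (map_poly f p) \<le> degree p" by (rule degree_le) (simp add: c f0 coeff_eq_0)
  ultimately have "lead_coeff (map_poly f p) = 1" using le_degree[of "map_poly f p" "degree p"] by simp
  moreover have "map_poly f p \<in> pol (f ` R)" using p(1) by (auto simp: pol_def c)
  ultimately show ?thesis using ev[of p] p(3) f0 unfolding is_integral_def by auto
qed

text \<open>The field version is applied to the image in the algebraic closure of the fraction
  field; injectivity of \<open>\<iota>\<close> pulls the generators back.\<close>

theorem integral_subalgebra_finitely_generated:
  fixes k :: "'b::{idom,ring_char_0} set"
  assumes k: "is_subring k" "\<And>a. a \<in> k \<Longrightarrow> a \<noteq> 0 \<Longrightarrow> \<exists>b\<in>k. a * b = 1"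
    and fin: "finite E" "finite E'" and C: "is_subring C"
    "ring_hull (k \<union> E) \<subseteq> C" "C \<subseteq> ring_hull (k \<union> E')" "\<And>z. z \<in> C \<Longrightarrow> is_integral (ring_hull (k \<union> E)) z"
  shows "\<exists>F. finite F \<and> F \<subseteq> C \<and> C = ring_hull (k \<union> F)"
proof -
  define \<iota> where "\<iota> b = to_ac (Fraction_Field.Fract b 1)" for b :: 'b
  have hom: "is_hom \<iota>"
    unfolding is_hom_def by (simp add: \<iota>_def One_fract_def[symmetric] flip: to_ac_add to_ac_mult)
  have inj: "inj \<iota>" by (rule injI) (simp add: \<iota>_def eq_fract)
  have im: "\<iota> ` ring_hull (k \<union> S) = ring_hull (\<iota> ` k \<union> \<iota> ` S)" for S
    using ring_hull_image[OF hom, of "k \<union> S"] by (simp add: image_Un)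
  have "subfield_set (\<iota> ` k)"
    unfolding subfield_set_def
  proof (intro conjI ballI is_subring_image hom k)
    fix z assume "z \<in> \<iota> ` k"
    then obtain a where a: "a \<in> k" "z = \<iota> a" by blast
    show "inverse z \<in> \<iota> ` k"
    proof (cases "a = 0")
      case True
      then show ?thesis using a is_homD(4)[OF hom] by auto
    next
      case False
      then obtain b where b: "b \<in> k" "a * b = 1" using k(2) a by blast
      then have "z * \<iota> b = 1" using a is_homD(1,3)[OF hom] by metis
      then show ?thesis using b by (metis imageI inverse_unique)
    qed
  qed
  moreover have "is_integral (ring_hull (\<iota> ` k \<union> \<iota> ` E)) z" if "z \<in> \<iota> ` C" for z
    using that integral_image[OF hom C(4)] unfolding im by auto
  moreover have "ring_hull (\<iota> ` k \<union> \<iota> ` E) \<subseteq> \<iota> ` C" "\<iota> ` C \<subseteq> ring_hull (\<iota> ` k \<union> \<iota> ` E')"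
    using image_mono[OF C(2), of \<iota>] image_mono[OF C(3), of \<iota>] unfolding im by auto
  ultimately obtain F where F: "finite F" "F \<subseteq> \<iota> ` C" "\<iota> ` C = ring_hull (\<iota> ` k \<union> F)"
    using integral_subalgebra_finitely_generated_field[of "\<iota> ` k" "\<iota> ` E" "\<iota> ` E'" "\<iota> ` C"]
      fin is_subring_image[OF hom C(1)] by auto
  obtain G where G: "finite G" "G \<subseteq> C" "F = \<iota> ` G" using finite_subset_image[OF F(1,2)] by blast
  have "\<iota> ` C = \<iota> ` ring_hull (k \<union> G)" using F(3) G(3) im by simp
  then have "C = ring_hull (k \<union> G)" using inj by (simp add: inj_image_eq_iff)
  then show ?thesis using G by blast
qed

section \<open>Sums of squares\<close>

lemma sos_zero: "0 \<in> sums_of_squares K"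
  unfolding sums_of_squares_def by (auto intro!: exI[of _ "0 :: nat"])

lemma sos_step:
  assumes "t \<in> sums_of_squares K" "a \<in> K"
  shows "t + a\<^sup>2 \<in> sums_of_squares K"
proof -
  obtain n :: nat and f where f: "t = (\<Sum>i<n. (f i)\<^sup>2)" "\<forall>i<n. f i \<in> K"
    using assms(1) unfolding sums_of_squares_def by blast
  have "t + a\<^sup>2 = (\<Sum>i<Suc n. ((f(n := a)) i)\<^sup>2)" using f(1) by simp
  moreover have "\<forall>i<Suc n. (f(n := a)) i \<in> K" using f(2) assms(2) by (auto simp: less_Suc_eq)
  ultimately show ?thesis unfolding sums_of_squares_def by blast
qed

lemma sos_induct [consumes 1, case_names zero step]:
  assumes "t \<in> sums_of_squares K" "P 0"
    "\<And>t a. t \<in> sums_of_squares K \<Longrightarrow> P t \<Longrightarrow> a \<in> K \<Longrightarrow> P (t + a\<^sup>2)"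
  shows "P t"
proof -
  obtain n :: nat and f where f: "t = (\<Sum>i<n. (f i)\<^sup>2)" "\<forall>i<n. f i \<in> K"
    using assms(1) unfolding sums_of_squares_def by blast
  have "(\<Sum>i<m. (f i)\<^sup>2) \<in> sums_of_squares K \<and> P (\<Sum>i<m. (f i)\<^sup>2)" if "m \<le> n" for m
    using that
  proof (induction m)
    case (Suc m)
    then have "f m \<in> K" using f(2) by simp
    then show ?case using Suc assms(3) by (simp add: sos_step)
  qed (simp add: sos_zero assms(2))
  then show ?thesis using f(1) by blast
qed

lemma sos_mono: "K \<subseteq> L \<Longrightarrow> sums_of_squares K \<subseteq> sums_of_squares L"
  unfolding sums_of_squares_def by blast

section \<open>Preorderings of a field and bounds for integral elements\<close>

text \<open>A preordering of \<open>K\<close>, with \<open>-1 \<in> T\<close> not excluded. Reading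
  \<open>y - x \<in> T\<close> as \<open>x \<le> y\<close> turns the computations below into
  estimates.\<close>

locale square_cone =
  fixes K T :: "'k::field set"
  assumes K: "subfield_set K"
    and T_K: "T \<subseteq> K"
    and T_add: "s \<in> T \<Longrightarrow> t \<in> T \<Longrightarrow> s + t \<in> T"
    and T_mult: "s \<in> T \<Longrightarrow> t \<in> T \<Longrightarrow> s * t \<in> T"
    and T_square: "a \<in> K \<Longrightarrow> a\<^sup>2 \<in> T"

lemma square_cone_sos:
  fixes K :: "'k::field set"
  assumes K: "subfield_set K"
  shows "square_cone K (sums_of_squares K)"
proof
  note KR = subfield_setD[OF K]
  show "subfield_set K" by (rule K)
  show "sums_of_squares K \<subseteq> K"
  proof
    fix t assume "t \<in> sums_of_squares K"
    then show "t \<in> K" by (induction rule: sos_induct) (auto simp: is_subringD[OF KR] is_subring_power[OF KR])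
  qed
  show add: "s + t \<in> sums_of_squares K" if "s \<in> sums_of_squares K" "t \<in> sums_of_squares K" for s t
    using that(2)
  proof (induction rule: sos_induct)
    case (step t a)
    then have "(s + t) + a\<^sup>2 \<in> sums_of_squares K" by (intro sos_step)
    then show ?case by (simp add: add.assoc)
  qed (use that in auto)
  show sq: "a\<^sup>2 \<in> sums_of_squares K" if "a \<in> K" for a using sos_step[OF sos_zero that] by simp
  have mult1: "s * a\<^sup>2 \<in> sums_of_squares K" if "s \<in> sums_of_squares K" "a \<in> K" for s a
    using that(1)
  proof (induction rule: sos_induct)
    case (step t b)
    then have "t * a\<^sup>2 + (b * a)\<^sup>2 \<in> sums_of_squares K" using that is_subringD[OF KR] by (intro sos_step)
    then show ?case by (simp add: algebra_simps power_mult_distrib)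
  qed (auto intro: sos_zero)
  show "s * t \<in> sums_of_squares K" if "s \<in> sums_of_squares K" "t \<in> sums_of_squares K" for s t
    using that(2)
  proof (induction rule: sos_induct)
    case (step t a)
    then have "s * t + s * a\<^sup>2 \<in> sums_of_squares K" using that mult1 by (intro add)
    then show ?case by (simp add: distrib_left)
  qed (auto intro: sos_zero)
qed

context square_cone
begin

lemmas KR = subfield_setD[OF K]

lemma T_one: "1 \<in> T" and T_zero: "0 \<in> T"
  using T_square[of 1] T_square[of 0] is_subringD[OF KR] by auto

lemma T_of_nat: "of_nat n \<in> T"
  by (induction n) (auto intro: T_zero T_one T_add)

lemma T_power: "t \<in> T \<Longrightarrow> t ^ n \<in> T"
  by (induction n) (auto intro: T_one T_mult)

lemma T_sum: "(\<And>i. i \<in> I \<Longrightarrow> f i \<in> T) \<Longrightarrow> sum f I \<in> T"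
  by (induction I rule: infinite_finite_induct) (auto intro: T_zero T_add)

text \<open>Both factors are \<open>x - y\<close> times an element of \<open>T\<close>, so they have
  the same sign.\<close>

lemma T_power_diff_mult:
  assumes "x \<in> T" "y \<in> T"
  shows "(x ^ i - y ^ i) * (x ^ j - y ^ j) \<in> T"
proof -
  have "(x ^ i - y ^ i) * (x ^ j - y ^ j) =
      (x - y)\<^sup>2 * ((\<Sum>l<i. y ^ (i - Suc l) * x ^ l) * (\<Sum>l<j. y ^ (j - Suc l) * x ^ l))"
    by (simp add: power_diff_sumr2 power2_eq_square mult_ac)
  also have "\<dots> \<in> T"
    using assms T_K is_subringD(5)[OF KR]
    by (intro T_mult T_square T_sum T_power) auto
  finally show ?thesis .
qed

text \<open>A weak Cauchy-Schwarz inequality. The constant doubles in each step because \<open>(s +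
  c)\<^sup>2 = 2 s\<^sup>2 + 2 c\<^sup>2 - (s - c)\<^sup>2\<close>.\<close>

lemma T_square_sum: "(\<And>i. i < n \<Longrightarrow> c i \<in> K) \<Longrightarrow> 2 ^ n * (\<Sum>i<n. (c i)\<^sup>2) - (\<Sum>i<n. c i)\<^sup>2 \<in> T"
proof (induction n)
  case (Suc n)
  let ?s = "\<Sum>i<n. c i" and ?q = "\<Sum>i<n. (c i)\<^sup>2"
  have two: "2 \<in> T" using T_of_nat[of 2] by simp
  have pow: "(2 ^ Suc n - 2 :: 'k) \<in> T"
  proof -
    have "(2 ^ Suc n - 2 :: 'k) = of_nat (2 ^ Suc n - 2)" by (subst of_nat_diff) auto
    then show ?thesis using T_of_nat by metis
  qed
  have "?s \<in> K" using Suc.prems is_subring_sum[OF KR] by (metis lessThan_iff less_SucI)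
  then have "?s - c n \<in> K" using Suc.prems[of n] is_subringD(5)[OF KR] by simp
  then have sq: "(?s - c n)\<^sup>2 \<in> T" by (rule T_square)
  have "2 ^ Suc n * (?q + (c n)\<^sup>2) - (?s + c n)\<^sup>2 =
      2 * (2 ^ n * ?q - ?s\<^sup>2) + ((?s - c n)\<^sup>2 + (2 ^ Suc n - 2) * (c n)\<^sup>2)"
    by (simp add: power2_eq_square algebra_simps)
  also have "\<dots> \<in> T"
    using Suc by (intro T_add T_mult[OF two] T_mult[OF pow] sq T_square) auto
  finally show ?case by simp
qed (simp add: T_zero)

text \<open>From \<open>z\<^sup>n \<le> \<beta> (z\<^sup>n\<^sup>-\<^sup>1 + 1)\<close> with \<open>z = m\<^sup>2\<close> and \<open>\<beta> \<ge> 1\<close> one gets \<open>z \<le> \<beta>\<^sup>n + \<beta>\<close>, because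
  \<open>(z\<^sup>n\<^sup>-\<^sup>1 - \<beta>\<^sup>n\<^sup>-\<^sup>1) (z - \<beta>) \<ge> 0\<close>; here \<open>x \<le> y\<close> stands for \<open>y - x \<in> T\<close>.\<close>

lemma integral_square_bounded:
  assumes R: "is_subring R" "R \<subseteq> K" and m: "m \<in> K" "is_integral R m"
  shows "\<exists>c\<in>R. c - m\<^sup>2 \<in> T"
proof -
  obtain p where p: "p \<in> pol R" "lead_coeff p = 1" "poly p m = 0" using m(2) by (auto simp: is_integral_def)
  define n where "n = degree p"
  have "n \<noteq> 0"
  proof
    assume "n = 0"
    then obtain a where "p = [:a:]" using degree_eq_zeroE unfolding n_def by blast
    then show False using p by simp
  qed
  then obtain k where k: "n = Suc k" by (cases n) auto
  define z where "z = m\<^sup>2"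
  have z: "z \<in> T" unfolding z_def using m T_square by blast
  have zR: "z \<in> K" using z T_K by blast
  have cR: "coeff p i \<in> R" for i using coeff_pol[OF p(1)] .
  have "{..n} = insert n {..<n}" by auto
  then have "m ^ n + (\<Sum>i<n. coeff p i * m ^ i) = 0" using p(2,3) by (simp add: poly_altdef n_def)
  then have "m ^ n = - (\<Sum>i<n. coeff p i * m ^ i)" by (simp add: eq_neg_iff_add_eq_0)
  \<comment> \<open>Squaring moves the equation to \<open>z\<close>, which lies in \<open>T\<close>,
    whereas \<open>m\<close> may have either sign.\<close>
  then have zn: "z ^ n = (\<Sum>i<n. coeff p i * m ^ i)\<^sup>2"
    unfolding z_def power2_eq_square by (simp add: power_mult_distrib)
  have "coeff p i * m ^ i \<in> K" for i
    using cR R(2) m(1) is_subringD(6)[OF KR] is_subring_power[OF KR] by blast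
  then have "2 ^ n * (\<Sum>i<n. (coeff p i * m ^ i)\<^sup>2) - z ^ n \<in> T" unfolding zn by (intro T_square_sum)
  moreover have "(coeff p i * m ^ i)\<^sup>2 = (coeff p i)\<^sup>2 * z ^ i" for i
    by (simp add: z_def power_mult_distrib flip: power_mult) (simp add: mult.commute)
  ultimately have 1: "2 ^ n * (\<Sum>i<n. (coeff p i)\<^sup>2 * z ^ i) - z ^ n \<in> T" by simp
  \<comment> \<open>Once every \<open>z ^ i\<close> is replaced by the larger
    \<open>z ^ k + 1\<close>, the factor in front is \<open>b - 1\<close>; the added 1 gives
    \<open>b \<ge> 1\<close>.\<close>
  define b where "b = 1 + 2 ^ n * (\<Sum>i<n. (coeff p i)\<^sup>2)"
  have sqT: "(coeff p i)\<^sup>2 \<in> T" for i using cR R(2) T_square by blast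
  have twoT: "(2 ^ n :: 'k) \<in> T" using T_power T_of_nat[of 2] by simp
  have bT: "b - 1 \<in> T" unfolding b_def using sqT twoT by (simp add: T_mult T_sum)
  then have b: "b \<in> T" using T_add[OF bT T_one] by simp
  have bR: "b \<in> R"
    unfolding b_def using is_subring_of_nat[OF R(1), of 2] cR
    by (intro is_subringD(4,6)[OF R(1)] is_subring_sum[OF R(1)] is_subring_power[OF R(1)] is_subringD(2)[OF R(1)]) auto
  \<comment> \<open>For \<open>i \<le> k\<close> the elements \<open>z ^ i - 1\<close> and
    \<open>z ^ (k - i) - 1\<close> have the same sign.\<close>
  have mono: "z ^ k + 1 - z ^ i \<in> T" if "i < n" for i
  proof -
    have "(z ^ i - 1 ^ i) * (z ^ (k - i) - 1 ^ (k - i)) + z ^ (k - i) \<in> T"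
      using z T_one by (intro T_add T_power_diff_mult T_power)
    moreover have "z ^ k = z ^ i * z ^ (k - i)" using that k by (simp flip: power_add)
    ultimately show ?thesis by (simp add: algebra_simps)
  qed
  have "2 ^ n * (\<Sum>i<n. (coeff p i)\<^sup>2 * (z ^ k + 1 - z ^ i)) \<in> T"
    using twoT sqT mono by (intro T_mult T_sum) auto
  moreover have "2 ^ n * (\<Sum>i<n. (coeff p i)\<^sup>2 * (z ^ k + 1 - z ^ i)) =
      (b - 1) * (z ^ k + 1) - 2 ^ n * (\<Sum>i<n. (coeff p i)\<^sup>2 * z ^ i)"
    by (simp add: b_def right_diff_distrib sum_subtractf sum_distrib_right mult.assoc)
  ultimately have "(b - 1) * (z ^ k + 1) - 2 ^ n * (\<Sum>i<n. (coeff p i)\<^sup>2 * z ^ i) \<in> T" by simp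
  from T_add[OF this 1] have "(b - 1) * (z ^ k + 1) - z ^ n \<in> T" by simp
  from T_add[OF this T_add[OF T_power[OF z, of k] T_one]] have 2: "b * (z ^ k + 1) - z ^ n \<in> T"
    by (simp add: algebra_simps)
  have 3: "(z ^ k - b ^ k) * (z ^ 1 - b ^ 1) \<in> T" using z b by (rule T_power_diff_mult)
  have "(b * (z ^ k + 1) - z ^ n) + (z ^ k - b ^ k) * (z ^ 1 - b ^ 1) = b + b ^ k * b - b ^ k * z"
    by (simp add: k algebra_simps)
  then have 4: "b + b ^ k * b - b ^ k * z \<in> T" using T_add[OF 2 3] by simp
  \<comment> \<open>Needed to replace \<open>b ^ k * z\<close> by \<open>z\<close> in the
    estimate.\<close>
  have "b ^ k - 1 \<in> T"
  proof -
    have "b ^ k - 1 = (b - 1) * (\<Sum>i<k. 1 ^ (k - Suc i) * b ^ i)" using power_diff_sumr2[of b k 1] by simp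
    also have "\<dots> \<in> T" using bT b T_one by (intro T_mult T_sum T_power) auto
    finally show ?thesis .
  qed
  then have "(b ^ k - 1) * z \<in> T" using z by (rule T_mult)
  from T_add[OF 4 this] have "(b + b ^ k * b) - z \<in> T" by (simp add: algebra_simps)
  moreover have "b + b ^ k * b \<in> R" using bR is_subringD[OF R(1)] is_subring_power[OF R(1)] by simp
  ultimately show ?thesis unfolding z_def by blast
qed

end

section \<open>Central prime ideals\<close>

definition fr :: "'b::idom \<Rightarrow> 'b fract" where
  "fr x = Fraction_Field.Fract x 1"

lemma is_hom_fr: "is_hom fr"
  by (simp add: is_hom_def fr_def One_fract_def)

lemma inj_fr: "inj fr"
  by (rule injI) (simp add: fr_def eq_fract)

lemmas fr_hom = is_homD[OF is_hom_fr]

lemma fraction_field_of_eq: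
  assumes "is_subring A"
  shows "fraction_field_of A = Frac (fr ` A)"
proof
  show "fraction_field_of A \<subseteq> Frac (fr ` A)"
    unfolding fraction_field_of_def Frac_def by (force simp: fr_def)
  show "Frac (fr ` A) \<subseteq> fraction_field_of A"
  proof
    fix x assume "x \<in> Frac (fr ` A)"
    then obtain a b where "a \<in> fr ` A" "b \<in> fr ` A" "b \<noteq> 0" "x = a / b"
      using FracE is_subring_image[OF is_hom_fr assms] by metis
    then show "x \<in> fraction_field_of A"
      unfolding fraction_field_of_def by (fastforce simp: fr_def Zero_fract_def eq_fract)
  qed
qed

lemma subfield_fraction_field_of: "is_subring A \<Longrightarrow> subfield_set (fraction_field_of A)"
  by (simp add: fraction_field_of_eq subfield_Frac is_subring_image is_hom_fr)

lemma fr_in_fraction_field: "is_subring A \<Longrightarrow> a \<in> A \<Longrightarrow> fr a \<in> fraction_field_of A"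
  unfolding fraction_field_of_def fr_def using is_subringD(2)[of A] by (intro CollectI exI[of _ a] exI[of _ 1]) auto

lemma fraction_field_of_mono: "A \<subseteq> D \<Longrightarrow> fraction_field_of A \<subseteq> fraction_field_of D"
  unfolding fraction_field_of_def by blast

section \<open>Ideals as plain sets, and the translation from HOL-Algebra\<close>

definition is_ideal :: "'a::comm_ring_1 set \<Rightarrow> 'a set \<Rightarrow> bool" where
  "is_ideal A I \<longleftrightarrow> I \<subseteq> A \<and> 0 \<in> I \<and> (\<forall>x\<in>I. \<forall>y\<in>I. x + y \<in> I) \<and> (\<forall>a\<in>A. \<forall>x\<in>I. a * x \<in> I)"

definition is_prime :: "'a::comm_ring_1 set \<Rightarrow> 'a set \<Rightarrow> bool" where
  "is_prime A I \<longleftrightarrow> is_ideal A I \<and> 1 \<notin> I \<and> (\<forall>x\<in>A. \<forall>y\<in>A. x * y \<in> I \<longrightarrow> x \<in> I \<or> y \<in> I)"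

lemma is_idealD:
  assumes "is_ideal A I"
  shows "x \<in> I \<Longrightarrow> x \<in> A" "0 \<in> I" "x \<in> I \<Longrightarrow> y \<in> I \<Longrightarrow> x + y \<in> I" "a \<in> A \<Longrightarrow> x \<in> I \<Longrightarrow> a * x \<in> I"
    "x \<in> I \<Longrightarrow> a \<in> A \<Longrightarrow> x * a \<in> I"
  using assms by (auto simp: is_ideal_def mult.commute[of _ a])

lemma is_ideal_uminus: "is_subring A \<Longrightarrow> is_ideal A I \<Longrightarrow> x \<in> I \<Longrightarrow> - x \<in> I"
  using is_idealD(4)[of A I "-1" x] is_subringD(2,3)[of A] by fastforce

lemma is_ideal_diff: "is_subring A \<Longrightarrow> is_ideal A I \<Longrightarrow> x \<in> I \<Longrightarrow> y \<in> I \<Longrightarrow> x - y \<in> I"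
  using is_idealD(3)[of A I x "-y"] is_ideal_uminus[of A I y] by simp

lemma subring_iff_is_subring: "subring C ring_of_type_algebra \<longleftrightarrow> is_subring (C :: 'b::comm_ring_1 set)"
proof -
  interpret R: ring "ring_of_type_algebra :: 'b ring" by (rule ring_from_type_algebra)
  have [simp]: "carrier (ring_of_type_algebra :: 'b ring) = UNIV" "one (ring_of_type_algebra :: 'b ring) = 1"
      "monoid.mult (ring_of_type_algebra :: 'b ring) = (*)" "add (ring_of_type_algebra :: 'b ring) = (+)"
      "ring.zero (ring_of_type_algebra :: 'b ring) = 0"
    by (simp_all add: ring_of_type_algebra_def fun_eq_iff)
  have neg: "a_inv (ring_of_type_algebra :: 'b ring) x = - x" for x
    using R.minus_equality[of "-x" x] by simp
  show ?thesis
  proof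
    assume "subring C ring_of_type_algebra"
    note * = subringE[OF this]
    show "is_subring C" unfolding is_subring_def
      using *(3,6,7) *(5)[unfolded neg] by (metis \<open>add ring_of_type_algebra = (+)\<close> \<open>monoid.mult ring_of_type_algebra = (*)\<close> \<open>one ring_of_type_algebra = 1\<close> diff_conv_add_uminus)
  next
    assume "is_subring C"
    then show "subring C ring_of_type_algebra"
      by (intro R.subringI) (auto simp: is_subringD neg)
  qed
qed

lemma ring_subring_record: "is_subring A \<Longrightarrow> ring (subring_record (A :: 'b::comm_ring_1 set))"
  using ring.subring_is_ring[OF ring_from_type_algebra] subring_iff_is_subring by blast

lemma cring_subring_record: "is_subring A \<Longrightarrow> cring (subring_record (A :: 'b::comm_ring_1 set))"
  by (intro cring.intro ring_subring_record comm_monoid.intro ring.is_monoid)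
     (auto simp: comm_monoid_axioms_def ring_of_type_algebra_def mult.commute)

lemma ideal_iff_is_ideal:
  assumes A: "is_subring (A :: 'b::comm_ring_1 set)"
  shows "ideal I (subring_record A) \<longleftrightarrow> is_ideal A I"
proof
  interpret R: ring "subring_record A" by (rule ring_subring_record[OF A])
  assume "ideal I (subring_record A)"
  then interpret I: ideal I "subring_record A" .
  show "is_ideal A I"
    unfolding is_ideal_def
    using I.a_subset I.zero_closed I.a_closed I.I_l_closed
    by (auto simp: ring_of_type_algebra_def)
next
  interpret R: ring "subring_record A" by (rule ring_subring_record[OF A])
  have neg: "a_inv (subring_record A) x = - x" if "x \<in> A" for x
    using R.minus_equality[of "-x" x] that is_subringD[OF A] by (simp add: ring_of_type_algebra_def)
  assume I: "is_ideal A I"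
  show "ideal I (subring_record A)"
  proof (intro idealI R.ring_axioms)
    show "subgroup I (add_monoid (subring_record A))"
      using is_idealD[OF I] is_ideal_uminus[OF A I] neg
      by (intro R.add.subgroupI) (auto simp: ring_of_type_algebra_def a_inv_def[symmetric])
  qed (use is_idealD[OF I] in \<open>auto simp: ring_of_type_algebra_def\<close>)
qed

lemma primeideal_iff_is_prime:
  assumes A: "is_subring (A :: 'b::comm_ring_1 set)"
  shows "primeideal I (subring_record A) \<longleftrightarrow> is_prime A I"
proof
  assume "primeideal I (subring_record A)"
  then interpret I: primeideal I "subring_record A" .
  have I: "is_ideal A I" using I.ideal_axioms ideal_iff_is_ideal[OF A] by blast
  have "1 \<notin> I"
  proof
    assume "1 \<in> I"
    then have "A \<subseteq> I" using is_idealD(4)[OF I, of _ 1] by auto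
    then show False using I.I_notcarr is_idealD(1)[OF I] by (auto simp: ring_of_type_algebra_def)
  qed
  then show "is_prime A I" unfolding is_prime_def using I I.I_prime by (auto simp: ring_of_type_algebra_def)
next
  assume I: "is_prime A I"
  then show "primeideal I (subring_record A)"
    using is_subringD(2)[OF A]
    by (intro primeidealI cring_subring_record[OF A])
       (auto simp: is_prime_def ideal_iff_is_ideal[OF A], auto simp: ring_of_type_algebra_def)
qed

lemma C_Spec_iff:
  assumes "is_subring A"
  shows "\<qq> \<in> C_Spec A \<longleftrightarrow> is_prime A \<qq> \<and>
    (\<forall>a\<in>A. \<forall>t\<in>sums_of_squares (fraction_field_of A). \<forall>x\<in>\<qq>. (fr a)\<^sup>2 + t = fr x \<longrightarrow> a \<in> \<qq>)"
  unfolding C_Spec_def central_ideal_def fr_def[symmetric]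
  by (simp add: primeideal_iff_is_prime[OF assms] ideal_iff_is_ideal[OF assms] is_prime_def image_iff) blast

lemma is_prime_contract:
  assumes A: "is_subring A" and D: "A \<subseteq> D" and q: "is_prime D \<qq>"
  shows "is_prime A (\<qq> \<inter> A)"
  using q D unfolding is_prime_def is_ideal_def
  by (auto simp: is_subringD[OF A] subset_iff)

lemma C_Spec_contract:
  assumes A: "is_subring A" and D: "is_subring D" "A \<subseteq> D" and q: "\<qq> \<in> C_Spec D"
  shows "\<qq> \<inter> A \<in> C_Spec A"
  unfolding C_Spec_iff[OF A]
proof (intro conjI ballI impI)
  show "is_prime A (\<qq> \<inter> A)" using is_prime_contract[OF A D(2)] q by (simp add: C_Spec_iff[OF D(1)])
  fix a t x assume a: "a \<in> A" and t: "t \<in> sums_of_squares (fraction_field_of A)"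
    and x: "x \<in> \<qq> \<inter> A" "(fr a)\<^sup>2 + t = fr x"
  have "t \<in> sums_of_squares (fraction_field_of D)" using t sos_mono[OF fraction_field_of_mono[OF D(2)]] by blast
  then show "a \<in> \<qq> \<inter> A" using q a x D(2) unfolding C_Spec_iff[OF D(1)] by blast
qed

text \<open>An ideal of \<open>M\<close> maximal among those containing no \<open>s\<^sup>2 + t\<close> with \<open>s \<in> A - \<pp>\<close> and \<open>t\<close> a sum of squares is
  a central prime. The extension of \<open>\<pp>\<close> is such an ideal: the squares of its elements are bounded by
  elements of \<open>\<pp>\<close>, because squares of integral elements are bounded by elements of \<open>A\<close>.\<close>

lemma C_Spec_lying_over:
  fixes A M :: "'b::idom set"
  assumes A: "is_subring A" and M: "is_subring M" "A \<subseteq> M" "\<And>z. z \<in> M \<Longrightarrow> is_integral A z"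
    and birational: "fraction_field_of M = fraction_field_of A" and p: "\<pp> \<in> C_Spec A"
  shows "\<exists>\<qq>\<in>C_Spec M. \<qq> \<inter> A = \<pp>"
proof -
  define K where "K = fraction_field_of A"
  define T where "T = sums_of_squares K"
  interpret square_cone K T
    unfolding T_def K_def using A by (intro square_cone_sos subfield_fraction_field_of)
  have MK: "fr z \<in> K" if "z \<in> M" for z
    using fr_in_fraction_field[OF M(1) that] birational by (simp add: K_def)
  have p_prime: "is_prime A \<pp>" and p_central: "\<And>a t x. a \<in> A \<Longrightarrow> t \<in> T \<Longrightarrow> x \<in> \<pp> \<Longrightarrow> (fr a)\<^sup>2 + t = fr x \<Longrightarrow> a \<in> \<pp>"
    using p unfolding C_Spec_iff[OF A] T_def K_def by auto
  have p_ideal: "is_ideal A \<pp>" using p_prime by (simp add: is_prime_def)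
  have p_mult: "x * y \<in> A - \<pp>" if "x \<in> A - \<pp>" "y \<in> A - \<pp>" for x y
    using that p_prime is_subringD(6)[OF A] unfolding is_prime_def by auto
  define good where "good J \<longleftrightarrow> (\<forall>s\<in>A - \<pp>. \<forall>t\<in>T. \<forall>j\<in>J. (fr s)\<^sup>2 + t \<noteq> fr j)" for J
  have goodD: False if "good J" "s \<in> A - \<pp>" "t \<in> T" "j \<in> J" "(fr s)\<^sup>2 + t = fr j" for J s t j
    using that unfolding good_def by blast
  have bound: "\<exists>c\<in>\<pp>. fr c - (fr x)\<^sup>2 \<in> T" if "x \<in> lspan M \<pp>" for x
    using that
  proof induction
    case zero
    show ?case using is_idealD(2)[OF p_ideal] T_zero by (intro bexI[of _ 0]) (auto simp: fr_hom(4))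
  next
    case (step r v x)
    then obtain c where c: "c \<in> \<pp>" "fr c - (fr x)\<^sup>2 \<in> T" by blast
    have frA: "is_subring (fr ` A)" "fr ` A \<subseteq> K"
      using A is_subring_image[OF is_hom_fr] fr_in_fraction_field by (auto simp: K_def)
    obtain c' where c': "c' \<in> A" "fr c' - (fr r)\<^sup>2 \<in> T"
      using integral_square_bounded[OF frA MK[OF step(1)] integral_image[OF is_hom_fr M(3)[OF step(1)]]] by blast
    \<comment> \<open>From
      \<open>(r v + x)\<^sup>2 \<le> 2 r\<^sup>2 v\<^sup>2 + 2 x\<^sup>2\<close>, where
      \<open>c'\<close> bounds \<open>r\<^sup>2\<close> and \<open>c\<close> bounds
      \<open>x\<^sup>2\<close>; the factor \<open>v\<close> keeps the bound in
      \<open>\<pp>\<close>.\<close>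
    define e where "e = c' * v * v + c"
    have vA: "v \<in> A" using step(2) is_idealD(1)[OF p_ideal] by blast
    have "c' * v * v \<in> \<pp>" using is_subringD(6)[OF A c'(1) vA] step(2) is_idealD(4)[OF p_ideal] by blast
    then have e: "e + e \<in> \<pp>" unfolding e_def using c is_idealD(3)[OF p_ideal] by blast
    have "x \<in> M" using step(3) lspan_subset_subring[OF M(1), of M \<pp>] is_idealD(1)[OF p_ideal] M(2) by blast
    moreover have "v \<in> M" using vA M(2) by blast
    ultimately have K': "fr r \<in> K" "fr v \<in> K" "fr x \<in> K" using MK step(1) by auto
    have sq: "(fr r * fr v - fr x)\<^sup>2 \<in> T"
      by (intro T_square is_subringD(5,6)[OF KR] K')
    have "fr (e + e) - (fr (r * v + x))\<^sup>2 =
        (fr c' - (fr r)\<^sup>2) * (fr v)\<^sup>2 + (fr c' - (fr r)\<^sup>2) * (fr v)\<^sup>2 + (fr c - (fr x)\<^sup>2)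
        + (fr c - (fr x)\<^sup>2) + (fr r * fr v - fr x)\<^sup>2"
      unfolding e_def fr_hom by (simp add: power2_eq_square algebra_simps)
    also have "\<dots> \<in> T" using c c' sq T_square[OF K'(2)] by (intro T_add T_mult)
    finally show ?case using e by blast
  qed
  have good_start: "good (lspan M \<pp>)"
    unfolding good_def
  proof (intro ballI notI)
    fix s t j assume s: "s \<in> A - \<pp>" and t: "t \<in> T" and j: "j \<in> lspan M \<pp>" and eq: "(fr s)\<^sup>2 + t = fr j"
    obtain c where c: "c \<in> \<pp>" "fr c - (fr j)\<^sup>2 \<in> T" using bound[OF j] by blast
    have sK: "fr s \<in> K" using s M(2) MK by blast
    \<comment> \<open>Squaring \<open>s\<^sup>2 + t = j\<close> and adding the gap between
      \<open>c\<close> and \<open>j\<^sup>2\<close> shows that \<open>(s\<^sup>2)\<^sup>2\<close>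
      plus a sum of squares lies in \<open>\<pp>\<close>.\<close>
    have "(fr (s * s))\<^sup>2 + ((fr c - (fr j)\<^sup>2) + ((fr s)\<^sup>2 * t + (fr s)\<^sup>2 * t + t * t)) = fr c"
      unfolding eq[symmetric] fr_hom by (simp add: power2_eq_square algebra_simps)
    moreover have "(fr c - (fr j)\<^sup>2) + ((fr s)\<^sup>2 * t + (fr s)\<^sup>2 * t + t * t) \<in> T"
      using c(2) t T_square[OF sK] by (intro T_add T_mult)
    ultimately have "s * s \<in> \<pp>" using p_central[of "s * s"] s c(1) is_subringD(6)[OF A] by blast
    then show False using p_mult[OF s s] by simp
  qed
  have lspan_ideal: "is_ideal M (lspan M \<pp>)"
    using lspan_subset_subring[OF M(1), of M \<pp>] is_idealD(1)[OF p_ideal] M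
    by (auto simp: is_ideal_def intro: lspan.zero lspan_add lspan_scale)
  define Js where "Js = {J. is_ideal M J \<and> lspan M \<pp> \<subseteq> J \<and> good J}"
  have "\<exists>J\<in>Js. \<forall>Y\<in>Js. J \<subseteq> Y \<longrightarrow> Y = J"
  proof (rule subset_Zorn_nonempty)
    show "Js \<noteq> {}" using lspan_ideal good_start unfolding Js_def by blast
    fix Cs assume ne: "Cs \<noteq> {}" and chain: "subset.chain Js Cs"
    have C: "\<And>J. J \<in> Cs \<Longrightarrow> is_ideal M J \<and> lspan M \<pp> \<subseteq> J \<and> good J"
      using chain unfolding subset.chain_def Js_def by blast
    have "x + y \<in> \<Union>Cs" if xy: "x \<in> \<Union>Cs" "y \<in> \<Union>Cs" for x y
    proof -
      obtain I J where IJ: "I \<in> Cs" "x \<in> I" "J \<in> Cs" "y \<in> J" using xy by blast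
      have "I \<subseteq> J \<or> J \<subseteq> I" using chain IJ unfolding subset.chain_def by blast
      then show ?thesis using IJ C is_idealD(3) by (meson UnionI subsetD)
    qed
    moreover have "\<Union>Cs \<subseteq> M" using C is_idealD(1) by blast
    moreover have "0 \<in> \<Union>Cs" using C ne is_idealD(2) by blast
    moreover have "a * x \<in> \<Union>Cs" if "a \<in> M" "x \<in> \<Union>Cs" for a x using that C is_idealD(4) by blast
    ultimately have "is_ideal M (\<Union>Cs)" unfolding is_ideal_def by blast
    moreover have "good (\<Union>Cs)" using C unfolding good_def by blast
    moreover have "lspan M \<pp> \<subseteq> \<Union>Cs" using C ne by blast
    ultimately show "\<Union>Cs \<in> Js" by (simp add: Js_def)
  qed
  then obtain J where J: "is_ideal M J" "lspan M \<pp> \<subseteq> J" "good J"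
    and maxJ: "\<And>Y. is_ideal M Y \<Longrightarrow> J \<subseteq> Y \<Longrightarrow> good Y \<Longrightarrow> Y = J"
    unfolding Js_def by (metis (mono_tags, lifting) mem_Collect_eq order_trans)
  \<comment> \<open>By maximality, enlarging \<open>J\<close> by \<open>d\<close> creates a
    forbidden element.\<close>
  have escape: "\<exists>s\<in>A - \<pp>. \<exists>t\<in>T. \<exists>j\<in>J. \<exists>m\<in>M. (fr s)\<^sup>2 + t = fr (j + m * d)" if d: "d \<in> M" "d \<notin> J" for d
  proof -
    define Y where "Y = {j + m * d | j m. j \<in> J \<and> m \<in> M}"
    have "is_ideal M Y"
      unfolding is_ideal_def
    proof (intro conjI ballI subsetI)
      show "x \<in> M" if "x \<in> Y" for x
        using that d is_idealD(1)[OF J(1)] is_subringD[OF M(1)] by (auto simp: Y_def)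
      have "0 = 0 + 0 * d" by simp
      then show "0 \<in> Y" unfolding Y_def using is_idealD(2)[OF J(1)] is_subringD(1)[OF M(1)] by blast
      fix x assume "x \<in> Y"
      then obtain j m where x: "j \<in> J" "m \<in> M" "x = j + m * d" by (auto simp: Y_def)
      show "a * x \<in> Y" if "a \<in> M" for a
      proof -
        have "a * x = a * j + (a * m) * d" by (simp add: x algebra_simps)
        then show ?thesis unfolding Y_def using x that is_idealD(4)[OF J(1)] is_subringD(6)[OF M(1)] by blast
      qed
      fix y assume "y \<in> Y"
      then obtain i n where y: "i \<in> J" "n \<in> M" "y = i + n * d" by (auto simp: Y_def)
      have "x + y = (j + i) + (m + n) * d" by (simp add: x y algebra_simps)
      then show "x + y \<in> Y" unfolding Y_def using x y is_idealD(3)[OF J(1)] is_subringD(4)[OF M(1)] by blast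
    qed
    moreover have "J \<subseteq> Y"
    proof
      fix j assume "j \<in> J"
      moreover have "j = j + 0 * d" by simp
      ultimately show "j \<in> Y" unfolding Y_def using is_subringD(1)[OF M(1)] by blast
    qed
    moreover have "d \<in> Y"
    proof -
      have "d = 0 + 1 * d" by simp
      then show ?thesis unfolding Y_def using is_idealD(2)[OF J(1)] is_subringD(2)[OF M(1)] by blast
    qed
    ultimately have "\<not> good Y" using maxJ d(2) by blast
    then show ?thesis unfolding good_def Y_def by blast
  qed
  have one: "1 \<in> A - \<pp>" using p_prime is_subringD(2)[OF A] by (simp add: is_prime_def)
  have "is_prime M J"
    unfolding is_prime_def
  proof (intro conjI ballI impI J(1))
    show "1 \<notin> J" using goodD[OF J(3) one T_zero, of 1] by (auto simp: fr_hom(1))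
    fix d e assume d: "d \<in> M" and e: "e \<in> M" and de: "d * e \<in> J"
    show "d \<in> J \<or> e \<in> J"
    proof (rule ccontr)
      assume "\<not> (d \<in> J \<or> e \<in> J)"
      then obtain s t j m s' t' j' m' where
        st: "s \<in> A - \<pp>" "t \<in> T" "j \<in> J" "m \<in> M" "(fr s)\<^sup>2 + t = fr (j + m * d)" and
        st': "s' \<in> A - \<pp>" "t' \<in> T" "j' \<in> J" "m' \<in> M" "(fr s')\<^sup>2 + t' = fr (j' + m' * e)"
        using escape[OF d] escape[OF e] by blast
      \<comment> \<open>The product of the two forbidden elements, arranged so that each summand
        lies in \<open>J\<close>; it is forbidden again.\<close>
      define x where "x = j * (j' + m' * e) + (m * d) * j' + (m * m') * (d * e)"
      have "j' + m' * e \<in> M" "m * d \<in> M" "m * m' \<in> M"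
        using st st' d e is_idealD(1)[OF J(1)] is_subringD[OF M(1)] by auto
      then have "j * (j' + m' * e) \<in> J" "(m * d) * j' \<in> J" "(m * m') * (d * e) \<in> J"
        using st(3) st'(3) de is_idealD(4,5)[OF J(1)] by blast+
      then have "x \<in> J" unfolding x_def by (intro is_idealD(3)[OF J(1)])
      have sK: "(fr s)\<^sup>2 \<in> T" "(fr s')\<^sup>2 \<in> T" using st st' M(2) MK T_square by blast+
      have "fr x = ((fr s)\<^sup>2 + t) * ((fr s')\<^sup>2 + t')"
        unfolding st(5) st'(5) x_def fr_hom by (simp add: algebra_simps)
      then have "(fr (s * s'))\<^sup>2 + ((fr s)\<^sup>2 * t' + t * (fr s')\<^sup>2 + t * t') = fr x"
        by (simp add: fr_hom power2_eq_square algebra_simps)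
      moreover have "(fr s)\<^sup>2 * t' + t * (fr s')\<^sup>2 + t * t' \<in> T" using sK st st' by (intro T_add T_mult)
      ultimately show False using goodD[OF J(3) p_mult[OF st(1) st'(1)]] \<open>x \<in> J\<close> by blast
    qed
  qed
  moreover have "a \<in> J" if a: "a \<in> M" and t: "b \<in> T" and x: "x \<in> J" and eq: "(fr a)\<^sup>2 + b = fr x" for a b x
  proof (rule ccontr)
    assume "a \<notin> J"
    then obtain s t j m where
      st: "s \<in> A - \<pp>" "t \<in> T" "j \<in> J" "m \<in> M" "(fr s)\<^sup>2 + t = fr (j + m * a)"
      using escape[OF a] by blast
    define u where "u = j + m * a"
    have u: "u \<in> M" unfolding u_def using st a is_idealD(1)[OF J(1)] is_subringD[OF M(1)] by auto
    \<comment> \<open>This is \<open>u\<^sup>2 + m\<^sup>2 b\<close>: replacing \<open>u\<close> by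
      \<open>m * a\<close> changes the square by an element of \<open>J\<close>, and
      \<open>m\<^sup>2 (a\<^sup>2 + b) = m\<^sup>2 x\<close> lies in \<open>J\<close>.\<close>
    define y where "y = j * (u + u) - j * j + m * m * x"
    have "u + u \<in> M" "m * m \<in> M" "j \<in> M"
      using st u is_idealD(1)[OF J(1)] is_subringD(4,6)[OF M(1)] by blast+
    then have "j * (u + u) \<in> J" "j * j \<in> J" "m * m * x \<in> J"
      using st(3) x is_idealD(4,5)[OF J(1)] by blast+
    then have "y \<in> J" unfolding y_def by (intro is_idealD(3)[OF J(1)] is_ideal_diff[OF M(1) J(1)])
    have "fr m ^ 2 * b = fr (m * m * x) - (fr (m * a))\<^sup>2"
      unfolding fr_hom eq[symmetric] by (simp add: power2_eq_square algebra_simps)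
    moreover have "(fr u)\<^sup>2 = fr (j * (u + u) - j * j) + (fr (m * a))\<^sup>2"
      unfolding u_def fr_hom by (simp add: power2_eq_square algebra_simps)
    ultimately have *: "(fr u)\<^sup>2 + (fr m)\<^sup>2 * b = fr y"
      unfolding y_def fr_hom(2)[of _ "m * m * x"] by simp
    have sK: "(fr s)\<^sup>2 \<in> T" "(fr m)\<^sup>2 \<in> T" using st M(2) MK T_square by blast+
    have "(fr (s * s))\<^sup>2 + ((fr s)\<^sup>2 * t + (fr s)\<^sup>2 * t + t * t + (fr m)\<^sup>2 * b) = (fr u)\<^sup>2 + (fr m)\<^sup>2 * b"
      unfolding u_def st(5)[symmetric] fr_hom(3) by (simp add: power2_eq_square algebra_simps)
    then have "(fr (s * s))\<^sup>2 + ((fr s)\<^sup>2 * t + (fr s)\<^sup>2 * t + t * t + (fr m)\<^sup>2 * b) = fr y" using * by simp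
    moreover have "(fr s)\<^sup>2 * t + (fr s)\<^sup>2 * t + t * t + (fr m)\<^sup>2 * b \<in> T" using sK st t by (intro T_add T_mult)
    ultimately show False using goodD[OF J(3) p_mult[OF st(1) st(1)]] \<open>y \<in> J\<close> by blast
  qed
  \<comment> \<open>Birationality: centrality in \<open>M\<close> is tested with the same set
    \<open>T\<close>.\<close>
  ultimately have "J \<in> C_Spec M"
    unfolding C_Spec_iff[OF M(1)] birational K_def[symmetric] T_def[symmetric] by blast
  moreover have "J \<inter> A = \<pp>"
  proof
    show "\<pp> \<subseteq> J \<inter> A" using J(2) lspan_base[OF M(1), of _ \<pp>] is_idealD(1)[OF p_ideal] by blast
    show "J \<inter> A \<subseteq> \<pp>"
    proof
      fix s assume s: "s \<in> J \<inter> A"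
      then have "s * s \<in> J" using M(2) is_idealD(4)[OF J(1)] by blast
      then show "s \<in> \<pp>" using goodD[OF J(3) _ T_zero, of s "s * s"] s by (auto simp: fr_hom(3) power2_eq_square)
    qed
  qed
  ultimately show ?thesis by blast
qed

section \<open>Residue fields\<close>

lemma residue_rel_iff:
  "((a, s), (b, t)) \<in> residue_rel C \<qq> \<longleftrightarrow>
     a \<in> C \<and> s \<in> C - \<qq> \<and> b \<in> C \<and> t \<in> C - \<qq> \<and> a * t - b * s \<in> \<qq>"
  by (simp add: residue_rel_def)

locale residue =
  fixes C \<qq> :: "'b::comm_ring_1 set"
  assumes C: "is_subring C" and q_prime: "is_prime C \<qq>"
begin

lemma q_ideal: "is_ideal C \<qq>"
  using q_prime by (simp add: is_prime_def)

lemmas q_closed = is_idealD[OF q_ideal] is_ideal_diff[OF C q_ideal] is_ideal_uminus[OF C q_ideal]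

lemmas C_closed = is_subringD[OF C]

lemma q_cancel: "x \<in> C \<Longrightarrow> s \<in> C - \<qq> \<Longrightarrow> x * s \<in> \<qq> \<Longrightarrow> x \<in> \<qq>"
  using q_prime by (auto simp: is_prime_def)

lemma denominator_mult: "s \<in> C - \<qq> \<Longrightarrow> t \<in> C - \<qq> \<Longrightarrow> s * t \<in> C - \<qq>"
  using q_prime C_closed(6) by (auto simp: is_prime_def)

lemma one_denominator: "1 \<in> C - \<qq>"
  using q_prime C_closed(2) by (simp add: is_prime_def)

abbreviation "E \<equiv> residue_rel C \<qq>"
abbreviation "P \<equiv> C \<times> (C - \<qq>)"

lemma E_refl: "u \<in> P \<Longrightarrow> (u, u) \<in> E"
  using q_closed(2) by (cases u) (auto simp: residue_rel_iff)

lemma E_sym: "(u, v) \<in> E \<Longrightarrow> (v, u) \<in> E"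
proof -
  assume uv: "(u, v) \<in> E"
  obtain a s b t where "u = (a, s)" "v = (b, t)" by (cases u, cases v)
  then show "(v, u) \<in> E" using uv q_closed(7)[of "a * t - b * s"] by (auto simp: residue_rel_iff)
qed

lemma E_trans:
  assumes "(u, v) \<in> E" "(v, w) \<in> E"
  shows "(u, w) \<in> E"
proof -
  obtain a s b t c r where uvw: "u = (a, s)" "v = (b, t)" "w = (c, r)" by (cases u, cases v, cases w)
  have 1: "a \<in> C" "s \<in> C - \<qq>" "b \<in> C" "t \<in> C - \<qq>" "c \<in> C" "r \<in> C - \<qq>" "a * t - b * s \<in> \<qq>" "b * r - c * t \<in> \<qq>"
    using assms by (auto simp: uvw residue_rel_iff)
  have "r * (a * t - b * s) + s * (b * r - c * t) \<in> \<qq>"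
    using 1 by (intro q_closed(3) q_closed(4)[OF _ 1(7)] q_closed(4)[OF _ 1(8)]) auto
  then have "(a * r - c * s) * t \<in> \<qq>" by (simp add: algebra_simps)
  moreover have "a * r - c * s \<in> C" using 1 C_closed(5,6) by simp
  ultimately have "a * r - c * s \<in> \<qq>" using 1(4) q_cancel by blast
  then show ?thesis using 1 by (simp add: uvw residue_rel_iff)
qed

lemma E_dom: "(u, v) \<in> E \<Longrightarrow> u \<in> P \<and> v \<in> P"
  by (cases u, cases v) (auto simp: residue_rel_iff)

lemma E_class_eq: "u \<in> P \<Longrightarrow> E `` {u} = E `` {v} \<longleftrightarrow> (u, v) \<in> E"
proof
  assume u: "u \<in> P" and eq: "E `` {u} = E `` {v}"
  have "u \<in> E `` {v}" unfolding eq[symmetric] using E_refl[OF u] by simp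
  then show "(u, v) \<in> E" using E_sym by simp
next
  assume uv: "(u, v) \<in> E"
  show "E `` {u} = E `` {v}"
    using E_trans[OF uv] E_trans[OF E_sym[OF uv]] by blast
qed

text \<open>The residue field operations are unions over all representatives; for a compatible
  operation all members of the union coincide.\<close>

lemma class_op:
  assumes F: "\<And>u u' v v'. (u, u') \<in> E \<Longrightarrow> (v, v') \<in> E \<Longrightarrow> (F u v, F u' v') \<in> E"
    and uv: "u \<in> P" "v \<in> P"
  shows "(\<Union>u'\<in>E `` {u}. \<Union>v'\<in>E `` {v}. E `` {F u' v'}) = E `` {F u v}"
proof -
  have "E `` {F u' v'} = E `` {F u v}" if "u' \<in> E `` {u}" "v' \<in> E `` {v}" for u' v'
  proof -
    have "(F u v, F u' v') \<in> E" using F that by blast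
    then show ?thesis using E_class_eq E_dom by blast
  qed
  moreover have "u \<in> E `` {u}" "v \<in> E `` {v}" using uv E_refl by auto
  ultimately show ?thesis by blast
qed

lemma mult_class:
  assumes "a \<in> C" "s \<in> C - \<qq>" "b \<in> C" "t \<in> C - \<qq>"
  shows "monoid.mult (residue_field C \<qq>) (E `` {(a, s)}) (E `` {(b, t)}) = E `` {(a * b, s * t)}"
proof -
  have "((fst u * fst v, snd u * snd v), (fst u' * fst v', snd u' * snd v')) \<in> E"
    if "(u, u') \<in> E" "(v, v') \<in> E" for u u' v v'
  proof -
    obtain a s a' s' where u: "u = (a, s)" "u' = (a', s')" by (cases u, cases u')
    obtain b t b' t' where v: "v = (b, t)" "v' = (b', t')" by (cases v, cases v')
    have 1: "a \<in> C" "s \<in> C - \<qq>" "a' \<in> C" "s' \<in> C - \<qq>" "a * s' - a' * s \<in> \<qq>"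
      "b \<in> C" "t \<in> C - \<qq>" "b' \<in> C" "t' \<in> C - \<qq>" "b * t' - b' * t \<in> \<qq>"
      using that by (auto simp: u v residue_rel_iff)
    have "(b * t') * (a * s' - a' * s) + (a' * s) * (b * t' - b' * t) \<in> \<qq>"
      using 1 C_closed by (intro q_closed(3) q_closed(4)) auto
    then have "a * b * (s' * t') - a' * b' * (s * t) \<in> \<qq>" by (simp add: algebra_simps)
    then show ?thesis using 1 C_closed(6) denominator_mult by (simp add: u v residue_rel_iff)
  qed
  then show ?thesis
    using class_op[of "\<lambda>u v. (fst u * fst v, snd u * snd v)" "(a, s)" "(b, t)"] assms
    by (simp add: residue_field_def split_beta)
qed

lemma add_class:
  assumes "a \<in> C" "s \<in> C - \<qq>" "b \<in> C" "t \<in> C - \<qq>"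
  shows "add (residue_field C \<qq>) (E `` {(a, s)}) (E `` {(b, t)}) = E `` {(a * t + b * s, s * t)}"
proof -
  have "((fst u * snd v + fst v * snd u, snd u * snd v), (fst u' * snd v' + fst v' * snd u', snd u' * snd v')) \<in> E"
    if "(u, u') \<in> E" "(v, v') \<in> E" for u u' v v'
  proof -
    obtain a s a' s' where u: "u = (a, s)" "u' = (a', s')" by (cases u, cases u')
    obtain b t b' t' where v: "v = (b, t)" "v' = (b', t')" by (cases v, cases v')
    have 1: "a \<in> C" "s \<in> C - \<qq>" "a' \<in> C" "s' \<in> C - \<qq>" "a * s' - a' * s \<in> \<qq>"
      "b \<in> C" "t \<in> C - \<qq>" "b' \<in> C" "t' \<in> C - \<qq>" "b * t' - b' * t \<in> \<qq>"
      using that by (auto simp: u v residue_rel_iff)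
    have "(t * t') * (a * s' - a' * s) + (s * s') * (b * t' - b' * t) \<in> \<qq>"
      using 1 C_closed by (intro q_closed(3) q_closed(4)) auto
    then have "(a * t + b * s) * (s' * t') - (a' * t' + b' * s') * (s * t) \<in> \<qq>" by (simp add: algebra_simps)
    then show ?thesis using 1 C_closed(4,6) denominator_mult by (simp add: u v residue_rel_iff)
  qed
  then show ?thesis
    using class_op[of "\<lambda>u v. (fst u * snd v + fst v * snd u, snd u * snd v)" "(a, s)" "(b, t)"] assms
    by (simp add: residue_field_def split_beta)
qed

lemma one_class: "one (residue_field C \<qq>) = E `` {(1, 1)}"
  by (simp add: residue_field_def)

lemma carrier_residue_field: "carrier (residue_field C \<qq>) = {E `` {(a, s)} | a s. a \<in> C \<and> s \<in> C - \<qq>}"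
  by (auto simp: residue_field_def quotient_def)

end

text \<open>Surjectivity of the residue map, tested on classes with denominator 1.\<close>

definition residue_onto :: "'b::comm_ring_1 set \<Rightarrow> 'b set \<Rightarrow> 'b set \<Rightarrow> bool" where
  "residue_onto A D \<qq> \<longleftrightarrow> (\<forall>d\<in>D. \<exists>a\<in>A. \<exists>s\<in>A - \<qq>. s * d - a \<in> \<qq>)"

text \<open>The canonical map is always an injective homomorphism, so only surjectivity is at
  stake.\<close>

lemma residue_map_ring_iso_iff:
  fixes A D :: "'b::comm_ring_1 set"
  assumes A: "is_subring A" and D: "is_subring D" "A \<subseteq> D" and q: "is_prime D \<qq>"
  shows "residue_map D \<qq> \<in> ring_iso (residue_field A (\<qq> \<inter> A)) (residue_field D \<qq>) \<longleftrightarrow> residue_onto A D \<qq>"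
proof -
  let ?p = "\<qq> \<inter> A"
  interpret D: residue D \<qq> by unfold_locales (rule D q)+
  interpret A: residue A ?p by unfold_locales (rule A is_prime_contract[OF A D(2) q])+
  have sub: "A.E \<subseteq> D.E" using D(2) by (auto simp: residue_rel_def)
  have dom: "(a, s) \<in> D.P" if "a \<in> A" "s \<in> A - ?p" for a s using that D(2) by auto
  have map: "residue_map D \<qq> (A.E `` {(a, s)}) = D.E `` {(a, s)}" if "a \<in> A" "s \<in> A - ?p" for a s
  proof
    show "residue_map D \<qq> (A.E `` {(a, s)}) \<subseteq> D.E `` {(a, s)}"
      unfolding residue_map_def using sub D.E_trans by blast
    have "(a, s) \<in> A.E `` {(a, s)}" using A.E_refl that by blast
    then show "D.E `` {(a, s)} \<subseteq> residue_map D \<qq> (A.E `` {(a, s)})"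
      unfolding residue_map_def by blast
  qed
  show ?thesis
  proof
    assume "residue_map D \<qq> \<in> ring_iso (residue_field A ?p) (residue_field D \<qq>)"
    then have surj: "residue_map D \<qq> ` carrier (residue_field A ?p) = carrier (residue_field D \<qq>)"
      by (simp add: ring_iso_def bij_betw_def)
    show "residue_onto A D \<qq>"
      unfolding residue_onto_def
    proof
      fix d assume d: "d \<in> D"
      have "D.E `` {(d, 1)} \<in> carrier (residue_field D \<qq>)"
        unfolding D.carrier_residue_field using d D.one_denominator by blast
      then obtain a s where as: "a \<in> A" "s \<in> A - ?p" "D.E `` {(d, 1)} = residue_map D \<qq> (A.E `` {(a, s)})"
        unfolding surj[symmetric] A.carrier_residue_field by blast
      then have "((d, 1), (a, s)) \<in> D.E"
        using D.E_class_eq[of "(d, 1)" "(a, s)"] map[OF as(1,2)] d D.one_denominator by blast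
      then have "s * d - a \<in> \<qq>" by (simp add: residue_rel_iff mult.commute)
      then show "\<exists>a\<in>A. \<exists>s\<in>A - \<qq>. s * d - a \<in> \<qq>" using as by blast
    qed
  next
    assume onto: "residue_onto A D \<qq>"
    have closed: "residue_map D \<qq> U \<in> carrier (residue_field D \<qq>)" if "U \<in> carrier (residue_field A ?p)" for U
    proof -
      obtain a s where U: "a \<in> A" "s \<in> A - ?p" "U = A.E `` {(a, s)}"
        using \<open>U \<in> carrier (residue_field A ?p)\<close> unfolding A.carrier_residue_field by blast
      show ?thesis
        unfolding U(3) map[OF U(1,2)] D.carrier_residue_field using U D(2) by blast
    qed
    show "residue_map D \<qq> \<in> ring_iso (residue_field A ?p) (residue_field D \<qq>)"
      unfolding ring_iso_def
    proof (intro CollectI conjI ring_hom_memI)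
      fix U assume "U \<in> carrier (residue_field A ?p)"
      then show "residue_map D \<qq> U \<in> carrier (residue_field D \<qq>)" by (rule closed)
      obtain a s where U: "a \<in> A" "s \<in> A - ?p" "U = A.E `` {(a, s)}"
        using \<open>U \<in> carrier (residue_field A ?p)\<close> unfolding A.carrier_residue_field by blast
      fix V assume "V \<in> carrier (residue_field A ?p)"
      then obtain b t where V: "b \<in> A" "t \<in> A - ?p" "V = A.E `` {(b, t)}" unfolding A.carrier_residue_field by blast
      have ABs: "a \<in> D" "s \<in> D - \<qq>" "b \<in> D" "t \<in> D - \<qq>" using U V D(2) by auto
      note st = A.denominator_mult[OF U(2) V(2)]
      have "a * b \<in> A" "a * t + b * s \<in> A" using U V A.C_closed(4,6) by auto
      then show "residue_map D \<qq> (U \<otimes>\<^bsub>residue_field A ?p\<^esub> V) = residue_map D \<qq> U \<otimes>\<^bsub>residue_field D \<qq>\<^esub> residue_map D \<qq> V"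
        "residue_map D \<qq> (U \<oplus>\<^bsub>residue_field A ?p\<^esub> V) = residue_map D \<qq> U \<oplus>\<^bsub>residue_field D \<qq>\<^esub> residue_map D \<qq> V"
        unfolding U(3) V(3) A.mult_class[OF U(1,2) V(1,2)] A.add_class[OF U(1,2) V(1,2)]
          map[OF U(1,2)] map[OF V(1,2)] D.mult_class[OF ABs] D.add_class[OF ABs]
        using map st by blast+
    next
      show "residue_map D \<qq> \<one>\<^bsub>residue_field A ?p\<^esub> = \<one>\<^bsub>residue_field D \<qq>\<^esub>"
        unfolding A.one_class D.one_class using map A.one_denominator by blast
      show "bij_betw (residue_map D \<qq>) (carrier (residue_field A ?p)) (carrier (residue_field D \<qq>))"
        unfolding bij_betw_def
      proof
        show "inj_on (residue_map D \<qq>) (carrier (residue_field A ?p))"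
        proof (rule inj_onI)
          fix U V assume UV: "U \<in> carrier (residue_field A ?p)" "V \<in> carrier (residue_field A ?p)"
            and eq: "residue_map D \<qq> U = residue_map D \<qq> V"
          obtain a s where U: "a \<in> A" "s \<in> A - ?p" "U = A.E `` {(a, s)}"
            using UV unfolding A.carrier_residue_field by blast
          obtain b t where V: "b \<in> A" "t \<in> A - ?p" "V = A.E `` {(b, t)}"
            using UV unfolding A.carrier_residue_field by blast
          have "((a, s), (b, t)) \<in> D.E"
            using eq D.E_class_eq[OF dom[OF U(1,2)]] map[OF U(1,2)] map[OF V(1,2)] U(3) V(3) by simp
          then have "((a, s), (b, t)) \<in> A.E" using U V A.C_closed by (auto simp: residue_rel_iff)
          then show "U = V" using A.E_class_eq U V A.E_dom by blast
        qed
        show "residue_map D \<qq> ` carrier (residue_field A ?p) = carrier (residue_field D \<qq>)"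
        proof
          show "residue_map D \<qq> ` carrier (residue_field A ?p) \<subseteq> carrier (residue_field D \<qq>)"
            using closed by (rule image_subsetI)
          show "carrier (residue_field D \<qq>) \<subseteq> residue_map D \<qq> ` carrier (residue_field A ?p)"
          proof
            fix U assume "U \<in> carrier (residue_field D \<qq>)"
            then obtain d e where U: "d \<in> D" "e \<in> D - \<qq>" "U = D.E `` {(d, e)}"
              unfolding D.carrier_residue_field by blast
            \<comment> \<open>Numerator and denominator are represented separately,
              \<open>d = a / s\<close> and \<open>e = b / t\<close>, so that
              \<open>d / e = (a * t) / (s * b)\<close>.\<close>
            obtain a s where as: "a \<in> A" "s \<in> A - \<qq>" "s * d - a \<in> \<qq>"
              using onto U(1) unfolding residue_onto_def by blast
            have "e \<in> D" using U by simp
            then obtain b t where bt: "b \<in> A" "t \<in> A - \<qq>" "t * e - b \<in> \<qq>"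
              using onto unfolding residue_onto_def by blast
            have bq: "b \<notin> \<qq>"
            proof
              assume "b \<in> \<qq>"
              from D.q_closed(3)[OF bt(3) this] have "e * t \<in> \<qq>" by (simp add: mult.commute)
              then show False using D.q_cancel[of e t] U bt D(2) by blast
            qed
            have sb: "s * b \<in> A - ?p" using A.denominator_mult[of s b] as bt bq by blast
            have at: "a * t \<in> A" using as bt A.C_closed(6) by blast
            have "b * (s * d - a) - a * (t * e - b) \<in> \<qq>"
              using as bt D(2) by (intro D.q_closed(6) D.q_closed(4)[OF _ as(3)] D.q_closed(4)[OF _ bt(3)]) auto
            then have "((d, e), (a * t, s * b)) \<in> D.E"
              using U sb at D(2) by (auto simp: residue_rel_iff algebra_simps)
            then have "U = D.E `` {(a * t, s * b)}" using U(3) D.E_class_eq D.E_dom by blast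
            then have "U = residue_map D \<qq> (A.E `` {(a * t, s * b)})" using map[OF at sb] by simp
            then show "U \<in> residue_map D \<qq> ` carrier (residue_field A ?p)"
              unfolding A.carrier_residue_field using at sb by blast
          qed
        qed
      qed
    qed
  qed
qed

section \<open>The central seminormalization\<close>

lemma integral_extension_iff: "integral_extension A C \<longleftrightarrow> (\<forall>c\<in>C. is_integral A c)"
  by (auto simp: integral_extension_def is_integral_def pol_def)

lemma centrally_subintegral_iff:
  assumes A: "is_subring A" and D: "is_subring D" "A \<subseteq> D"
  shows "centrally_subintegral A D \<longleftrightarrow> (\<forall>d\<in>D. is_integral A d) \<and>
    bij_betw (\<lambda>\<qq>. \<qq> \<inter> A) (C_Spec D) (C_Spec A) \<and> (\<forall>\<qq>\<in>C_Spec D. residue_onto A D \<qq>)"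
  using residue_map_ring_iso_iff[OF A D] C_Spec_iff[OF D(1)]
  unfolding centrally_subintegral_def integral_extension_iff by blast

text \<open>If {0} is not central, dividing the witness \<open>a\<^sup>2 + t = 0\<close> by
  \<open>a\<^sup>2\<close> makes \<open>-1\<close> a sum of squares; centrality then forces 1 into
  every central prime of \<open>D\<close>.\<close>

lemma C_Spec_empty:
  assumes A: "is_subring A" "{0} \<notin> C_Spec A" and D: "is_subring D" "A \<subseteq> D"
  shows "C_Spec D = {}"
proof -
  have "is_prime A {0}" using is_subringD[OF A(1)] by (auto simp: is_prime_def is_ideal_def)
  then obtain a t where a: "a \<in> A" "a \<noteq> 0" "t \<in> sums_of_squares (fraction_field_of A)" "(fr a)\<^sup>2 + t = fr 0"
    using A(2) unfolding C_Spec_iff[OF A(1)] by auto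
  let ?K = "fraction_field_of D"
  note K = subfield_fraction_field_of[OF D(1)]
  interpret square_cone ?K "sums_of_squares ?K" by (rule square_cone_sos[OF K])
  have t: "t \<in> sums_of_squares ?K" using a(3) sos_mono[OF fraction_field_of_mono[OF D(2)]] by blast
  have fa: "fr a \<noteq> 0" using a(2) inj_fr fr_hom(4) by (metis injD)
  have "False" if q: "\<qq> \<in> C_Spec D" for \<qq>
  proof -
    have "1 / fr a \<in> ?K"
      using a D fr_in_fraction_field[OF D(1)] is_subringD(2)[OF KR] by (intro subfield_set_divide[OF K]) auto
    then have "t * (1 / fr a)\<^sup>2 \<in> sums_of_squares ?K" using t by (intro T_mult T_square)
    moreover have "(fr 1)\<^sup>2 + t * (1 / fr a)\<^sup>2 = fr 0"
    proof -
      have "((fr a)\<^sup>2 + t) * (1 / fr a)\<^sup>2 = 0" unfolding a(4) fr_hom(4) by simp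
      moreover have "(fr a)\<^sup>2 * (1 / fr a)\<^sup>2 = 1" using fa by (simp add: power_divide)
      ultimately show ?thesis by (simp only: fr_hom(1,4) distrib_right power_one)
    qed
    moreover have "is_prime D \<qq>" using q C_Spec_iff[OF D(1)] by blast
    ultimately have "1 \<in> \<qq>" "1 \<notin> \<qq>"
      using q is_subringD(2)[OF D(1)] unfolding C_Spec_iff[OF D(1)] is_prime_def is_ideal_def by blast+
    then show False by blast
  qed
  then show ?thesis by blast
qed

text \<open>In an equation of least degree for \<open>x\<close> the constant coefficient lies in
  \<open>\<qq> \<inter> A\<close>, hence vanishes; for \<open>x \<noteq> 0\<close> a factor
  \<open>x\<close> could then be divided off.\<close>

lemma ideal_over_zero:
  fixes A D :: "'b::idom set"
  assumes D: "is_subring D" "A \<subseteq> D" "\<And>d. d \<in> D \<Longrightarrow> is_integral A d"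
    and q: "is_ideal D \<qq>" "\<qq> \<inter> A \<subseteq> {0}" and x: "x \<in> \<qq>"
  shows "x = 0"
proof (rule ccontr)
  assume x0: "x \<noteq> 0"
  have xD: "x \<in> D" using is_idealD(1)[OF q(1) x] .
  have "\<exists>p. p \<in> pol A \<and> p \<noteq> 0 \<and> poly p x = 0"
    using D(3)[OF xD] unfolding is_integral_def by (metis leading_coeff_0_iff zero_neq_one)
  then obtain p where p: "p \<in> pol A" "p \<noteq> 0" "poly p x = 0"
    and least: "\<And>q. q \<in> pol A \<Longrightarrow> q \<noteq> 0 \<Longrightarrow> poly q x = 0 \<Longrightarrow> degree p \<le> degree q"
    using ex_has_least_nat[of "\<lambda>p. p \<in> pol A \<and> p \<noteq> 0 \<and> poly p x = 0" _ degree] by blast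
  obtain a r where ar: "p = pCons a r" by (cases p)
  have r: "r \<in> pol A" "a \<in> A" using p ar by (auto simp: pCons_pol)
  have "poly r x \<in> D" using r pol_mono[OF D(2)] by (intro poly_in_subring[OF D(1) _ xD]) blast
  then have "- (x * poly r x) \<in> \<qq>" using is_ideal_uminus[OF D(1) q(1)] is_idealD(5)[OF q(1) x] by blast
  moreover have "a = - (x * poly r x)" using p ar by (simp add: eq_neg_iff_add_eq_0)
  ultimately have "a = 0" using r q(2) by blast
  then have "r \<noteq> 0" "poly r x = 0" using p ar x0 by auto
  then have "degree p \<le> degree r" using least r by blast
  then show False using ar \<open>r \<noteq> 0\<close> by simp
qed

text \<open>The central prime over {0} is {0} itself, where \<open>residue_onto\<close> says that
  every element of \<open>D\<close> is a fraction of elements of \<open>A\<close>.\<close>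

lemma subintegral_birational:
  fixes A D :: "'b::idom set"
  assumes A: "is_subring A" "{0} \<in> C_Spec A" and D: "is_subring D" "A \<subseteq> D" "centrally_subintegral A D"
  shows "fr ` D \<subseteq> fraction_field_of A"
proof
  note cs = D(3)[unfolded centrally_subintegral_iff[OF A(1) D(1,2)]]
  have "{0} \<in> (\<lambda>\<qq>. \<qq> \<inter> A) ` C_Spec D" using cs A(2) by (simp add: bij_betw_def)
  then obtain \<qq> where q: "\<qq> \<in> C_Spec D" "\<qq> \<inter> A = {0}" by auto
  have "is_ideal D \<qq>" using q by (simp add: C_Spec_iff[OF D(1)] is_prime_def)
  then have q0: "x = 0" if "x \<in> \<qq>" for x using ideal_over_zero[OF D(1,2), of \<qq> x] q(2) cs that by blast
  fix y assume "y \<in> fr ` D"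
  then obtain d where d: "d \<in> D" "y = fr d" by blast
  obtain a s where as: "a \<in> A" "s \<in> A - \<qq>" "s * d - a \<in> \<qq>" using cs q(1) d(1) unfolding residue_onto_def by blast
  have "s \<noteq> 0" using as(2) q(2) by blast
  moreover have "fr s * fr d = fr a" using q0[OF as(3)] by (simp flip: fr_hom(3))
  ultimately have "y = fr a / fr s" using d(2) inj_fr fr_hom(4) by (metis injD nonzero_mult_div_cancel_left)
  then show "y \<in> fraction_field_of A"
    using as fr_in_fraction_field[OF A(1)] by (auto intro!: subfield_set_divide[OF subfield_fraction_field_of[OF A(1)]])
qed

text \<open>Elements whose residues at both primes come from one fraction \<open>a / s\<close> over
  \<open>A\<close>. In the application the primes have the same trace on \<open>A\<close>, so
  \<open>s\<close> avoids \<open>\<rr>\<close> as well.\<close>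

definition common_residues :: "'b::comm_ring_1 set \<Rightarrow> 'b set \<Rightarrow> 'b set \<Rightarrow> 'b set \<Rightarrow> 'b set" where
  "common_residues A M \<qq> \<rr> = {d \<in> M. \<exists>a\<in>A. \<exists>s\<in>A - \<qq>. s * d - a \<in> \<qq> \<inter> \<rr>}"

lemma is_subring_common_residues:
  assumes A: "is_subring A" and M: "is_subring M" "A \<subseteq> M" and q: "is_prime M \<qq>" "is_prime M \<rr>"
  shows "is_subring (common_residues A M \<qq> \<rr>)" "A \<subseteq> common_residues A M \<qq> \<rr>"
proof -
  have I: "is_ideal M \<qq>" "is_ideal M \<rr>" using q by (auto simp: is_prime_def)
  have one: "1 \<in> A - \<qq>" using q is_subringD(2)[OF A] by (simp add: is_prime_def)
  show sub: "A \<subseteq> common_residues A M \<qq> \<rr>"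
  proof
    fix a assume a: "a \<in> A"
    have "1 * a - a \<in> \<qq> \<inter> \<rr>" using is_idealD(2)[OF I(1)] is_idealD(2)[OF I(2)] by simp
    then show "a \<in> common_residues A M \<qq> \<rr>"
      unfolding common_residues_def using a one M(2) by blast
  qed
  show "is_subring (common_residues A M \<qq> \<rr>)"
    unfolding is_subring_def
  proof (intro conjI ballI)
    show "1 \<in> common_residues A M \<qq> \<rr>" using sub is_subringD(2)[OF A] by blast
    fix d e assume "d \<in> common_residues A M \<qq> \<rr>" "e \<in> common_residues A M \<qq> \<rr>"
    then obtain a s b t where d: "d \<in> M" "a \<in> A" "s \<in> A - \<qq>" "s * d - a \<in> \<qq> \<inter> \<rr>"
      and e: "e \<in> M" "b \<in> A" "t \<in> A - \<qq>" "t * e - b \<in> \<qq> \<inter> \<rr>"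
      unfolding common_residues_def by blast
    have M': "a \<in> M" "s \<in> M" "b \<in> M" "t \<in> M" using d e M(2) by auto
    have st: "s * t \<in> A - \<qq>"
      using d e q(1) M' is_subringD(6)[OF A] unfolding is_prime_def by blast
    have diff: "t * (s * d - a) - s * (t * e - b) \<in> J" "t * e * (s * d - a) + a * (t * e - b) \<in> J"
      if "is_ideal M J" "s * d - a \<in> J" "t * e - b \<in> J" for J
      using that M' e(1) is_subringD(6)[OF M(1)] is_idealD(3,4)[OF that(1)] is_ideal_diff[OF M(1) that(1)] by auto
    have "s * t * (d - e) - (a * t - b * s) \<in> \<qq> \<inter> \<rr>"
      using diff(1)[OF I(1)] diff(1)[OF I(2)] d(4) e(4) by (simp add: algebra_simps)
    moreover have "s * t * (d * e) - a * b \<in> \<qq> \<inter> \<rr>"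
      using diff(2)[OF I(1)] diff(2)[OF I(2)] d(4) e(4) by (simp add: algebra_simps)
    moreover have "d - e \<in> M" "d * e \<in> M" "a * t - b * s \<in> A" "a * b \<in> A"
      using d e is_subringD[OF M(1)] is_subringD[OF A] by auto
    ultimately show "d - e \<in> common_residues A M \<qq> \<rr>" "d * e \<in> common_residues A M \<qq> \<rr>"
      unfolding common_residues_def using st by blast+
  qed
qed

lemma unique_maximal_if_greatest:
  assumes "M \<in> \<S>" "\<And>N. N \<in> \<S> \<Longrightarrow> N \<subseteq> M"
  shows "unique_maximal \<S> M"
  unfolding unique_maximal_def using assms by blast

text \<open>Integrality, birationality and \<open>common_residues\<close> each cut out a subring, so
  they pass from the candidates to the ring they generate, without any comparison of the candidates
  with each other.\<close>

theorem greatest_centrally_subintegral: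
  fixes A B :: "'b::idom set"
  assumes A: "is_subring A" "noetherian A" and B: "is_subring B" "A \<subseteq> B"
  defines "\<D> \<equiv> {D. is_subring D \<and> A \<subseteq> D \<and> D \<subseteq> B \<and> centrally_subintegral A D}"
  shows "\<exists>M\<in>\<D>. \<forall>D\<in>\<D>. D \<subseteq> M"
proof -
  define M where "M = ring_hull (A \<union> \<Union>\<D>)"
  have M: "is_subring M" "A \<subseteq> M" "\<And>D. D \<in> \<D> \<Longrightarrow> D \<subseteq> M"
    unfolding M_def using is_subring_ring_hull ring_hull_subset[of "A \<union> \<Union>\<D>"] by blast+
  have least: "M \<subseteq> R" if "is_subring R" "A \<subseteq> R" "\<And>D. D \<in> \<D> \<Longrightarrow> D \<subseteq> R" for R
    unfolding M_def using that by (intro ring_hull_least) auto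
  have MB: "M \<subseteq> B" by (rule least) (use B in \<open>auto simp: \<D>_def\<close>)
  have int_D: "is_integral A d" if "D \<in> \<D>" "d \<in> D" for D d
    using that centrally_subintegral_iff[OF A(1)] unfolding \<D>_def by blast
  have "M \<subseteq> {x. is_integral A x}"
    using is_integral_base[OF A(1)] int_D by (intro least is_subring_integral A) auto
  then have int: "is_integral A z" if "z \<in> M" for z using that by blast
  have "bij_betw (\<lambda>\<qq>. \<qq> \<inter> A) (C_Spec M) (C_Spec A) \<and> (\<forall>\<qq>\<in>C_Spec M. residue_onto A M \<qq>)"
  proof (cases "{0} \<in> C_Spec A")
    case False
    then show ?thesis using C_Spec_empty[OF A(1) False] A(1) M(1,2) by (simp add: bij_betw_def)
  next
    case True
    have "M \<subseteq> fr -` fraction_field_of A"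
    proof (rule least)
      show "is_subring (fr -` fraction_field_of A)"
        using subfield_setD[OF subfield_fraction_field_of[OF A(1)]] by (rule is_subring_vimage[OF is_hom_fr])
      show "A \<subseteq> fr -` fraction_field_of A" using fr_in_fraction_field[OF A(1)] by blast
      show "D \<subseteq> fr -` fraction_field_of A" if "D \<in> \<D>" for D
        using subintegral_birational[OF A(1) True, of D] that unfolding \<D>_def by blast
    qed
    then have "fraction_field_of M \<subseteq> fraction_field_of A"
      unfolding fraction_field_of_eq[OF M(1)]
      by (intro Frac_least subfield_fraction_field_of A) blast
    then have birational: "fraction_field_of M = fraction_field_of A"
      using fraction_field_of_mono[OF M(2)] by blast
    have glue: "M \<subseteq> common_residues A M \<qq> \<rr>"
      if q: "\<qq> \<in> C_Spec M" "\<rr> \<in> C_Spec M" "\<qq> \<inter> A = \<rr> \<inter> A" for \<qq> \<rr>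
    proof (rule least)
      have "is_prime M \<qq>" "is_prime M \<rr>" using q C_Spec_iff[OF M(1)] by auto
      then show "is_subring (common_residues A M \<qq> \<rr>)" "A \<subseteq> common_residues A M \<qq> \<rr>"
        using is_subring_common_residues[OF A(1) M(1,2)] by auto
      fix D assume "D \<in> \<D>"
      then have D: "is_subring D" "A \<subseteq> D" "D \<subseteq> M" "centrally_subintegral A D"
        using M(3) by (auto simp: \<D>_def)
      note cs = D(4)[unfolded centrally_subintegral_iff[OF A(1) D(1,2)]]
      have qD: "\<qq> \<inter> D \<in> C_Spec D" "\<rr> \<inter> D \<in> C_Spec D" using C_Spec_contract[OF D(1) M(1) D(3)] q by auto
      have "\<qq> \<inter> D \<inter> A = \<rr> \<inter> D \<inter> A" using q(3) D(2) by blast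
      \<comment> \<open>Injectivity for \<open>D\<close> identifies the two traces on
        \<open>D\<close>, so a representative modulo one is a representative modulo the
        other.\<close>
      then have eq: "\<qq> \<inter> D = \<rr> \<inter> D" using cs qD unfolding bij_betw_def inj_on_def by blast
      show "D \<subseteq> common_residues A M \<qq> \<rr>"
      proof
        fix d assume d: "d \<in> D"
        obtain a s where "a \<in> A" "s \<in> A - \<qq> \<inter> D" "s * d - a \<in> \<qq> \<inter> D"
          using cs qD(1) d unfolding residue_onto_def by blast
        then show "d \<in> common_residues A M \<qq> \<rr>"
          unfolding common_residues_def using d D(2,3) eq by blast
      qed
    qed
    \<comment> \<open>If \<open>d \<in> \<qq>\<close>, its common representative \<open>a\<close>
      lies in \<open>\<qq> \<inter> A = \<rr> \<inter> A\<close>, which forces \<open>s * d\<close>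
      and then \<open>d\<close> into \<open>\<rr>\<close>.\<close>
    have "\<qq> \<subseteq> \<rr>" if q: "\<qq> \<in> C_Spec M" "\<rr> \<in> C_Spec M" "\<qq> \<inter> A = \<rr> \<inter> A" for \<qq> \<rr>
    proof
      have prime: "is_prime M \<qq>" "is_prime M \<rr>" and ideal: "is_ideal M \<qq>" "is_ideal M \<rr>"
        using q C_Spec_iff[OF M(1)] by (auto simp: is_prime_def)
      fix d assume d: "d \<in> \<qq>"
      then have dM: "d \<in> M" using is_idealD(1)[OF ideal(1)] by blast
      then obtain a s where as: "a \<in> A" "s \<in> A - \<qq>" "s * d - a \<in> \<qq>" "s * d - a \<in> \<rr>"
        using glue[OF q] unfolding common_residues_def by blast
      have sM: "s \<in> M" using as M(2) by blast
      then have "s * d \<in> \<qq>" using is_idealD(4)[OF ideal(1)] d by blast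
      then have "s * d - (s * d - a) \<in> \<qq>" using is_ideal_diff[OF M(1) ideal(1)] as(3) by blast
      then have "a \<in> \<rr>" using as(1) q(3) by auto
      then have "(s * d - a) + a \<in> \<rr>" using is_idealD(3)[OF ideal(2)] as(4) by blast
      then have "s * d \<in> \<rr>" by simp
      moreover have "s \<notin> \<rr>" using as(2) q(3) by blast
      ultimately show "d \<in> \<rr>" using prime(2) sM dM unfolding is_prime_def by blast
    qed
    then have "inj_on (\<lambda>\<qq>. \<qq> \<inter> A) (C_Spec M)" by (intro inj_onI) (metis subset_antisym)
    moreover have "(\<lambda>\<qq>. \<qq> \<inter> A) ` C_Spec M = C_Spec A"
      using C_Spec_contract[OF A(1) M(1,2)] C_Spec_lying_over[OF A(1) M(1,2) int birational] by blast
    moreover have "residue_onto A M \<qq>" if "\<qq> \<in> C_Spec M" for \<qq>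
      using glue[OF that that refl] unfolding residue_onto_def common_residues_def by blast
    ultimately show ?thesis by (simp add: bij_betw_def)
  qed
  then have "centrally_subintegral A M" using int centrally_subintegral_iff[OF A(1) M(1,2)] by blast
  then have "M \<in> \<D>" using M(1,2) MB by (simp add: \<D>_def)
  then show ?thesis using M(3) by blast
qed

section \<open>Transfer to coordinate rings over the reals\<close>

lemma generate_ring_eq_ring_hull: "generate_ring ring_of_type_algebra S = ring_hull (S :: 'b::comm_ring_1 set)"
proof -
  interpret R: ring "ring_of_type_algebra :: 'b ring" by (rule ring_from_type_algebra)
  have "S \<subseteq> carrier ring_of_type_algebra" by (simp add: ring_of_type_algebra_def)
  from R.generate_ring_min_subring2[OF this] show ?thesis
    by (simp add: ring_hull_def hull_def subring_iff_is_subring)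
qed

lemma is_hom_if_ring_hom: "\<phi> \<in> ring_hom ring_of_type_algebra ring_of_type_algebra \<Longrightarrow> is_hom \<phi>"
  by (auto simp: ring_hom_def is_hom_def ring_of_type_algebra_def)

lemma is_subring_Reals: "is_subring (\<real> :: 'a::{comm_ring_1,real_algebra_1} set)"
  by (simp add: is_subring_def)

lemma Reals_inverse:
  assumes "a \<in> (\<real> :: 'a::{comm_ring_1,real_algebra_1} set)" "a \<noteq> 0"
  shows "\<exists>b\<in>\<real>. a * b = 1"
proof -
  obtain r where "a = of_real r" using assms(1) by (rule Reals_cases)
  then show ?thesis using assms(2)
    by (intro bexI[of _ "of_real (inverse r)"]) (auto simp flip: of_real_mult)
qed

lemma noetherian_Reals: "noetherian (\<real> :: 'a::{comm_ring_1,real_algebra_1} set)"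
proof -
  have "is_hom (of_real :: real \<Rightarrow> 'a)" by (simp add: is_hom_def)
  moreover have "noetherian (UNIV :: real set)"
    by (intro noetherian_subfield) (simp add: subfield_set_def is_subring_def)
  ultimately show ?thesis unfolding Reals_def by (rule noetherian_image)
qed

theorem theorem8p6:
  fixes \<phi> :: "'a::{idom,real_algebra_1} \<Rightarrow> 'b::{idom,real_algebra_1}"
  assumes "finite_type \<real> (UNIV :: 'a set)"
    and "finite_type \<real> (UNIV :: 'b set)"
    and "\<phi> \<in> ring_hom ring_of_type_algebra ring_of_type_algebra"
    and "linear \<phi>"
    and "inj \<phi>"
    and "finite_type (range \<phi>) UNIV"
  shows "\<exists>V. central_seminormalization_variety (range \<phi>) UNIV V \<and>
             central_seminormalization_ring (range \<phi>) UNIV V"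
proof -
  define A where "A = range \<phi>"
  have hom: "is_hom \<phi>" using assms(3) by (rule is_hom_if_ring_hom)
  have "\<phi> (of_real r) = of_real r" for r
    using linear_scale[OF assms(4), of r 1] is_homD(1)[OF hom] by (simp add: of_real_def)
  \<comment> \<open>Linearity fixes the constants, so \<open>A\<close> is generated over the reals
    by the images of \<open>E\<close>.\<close>
  then have reals: "\<phi> ` \<real> = \<real>" unfolding Reals_def by (auto simp: image_image)
  obtain E where E: "finite E" "(UNIV :: 'a set) = ring_hull (\<real> \<union> E)"
    using assms(1) unfolding finite_type_def generate_ring_eq_ring_hull by blast
  obtain E' where E': "finite E'" "(UNIV :: 'b set) = ring_hull (\<real> \<union> E')"
    using assms(2) unfolding finite_type_def generate_ring_eq_ring_hull by blast
  have A_eq: "A = ring_hull (\<real> \<union> \<phi> ` E)"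
    unfolding A_def by (subst E(2)) (simp add: ring_hull_image[OF hom] image_Un reals)
  have A: "is_subring A" "noetherian A"
    unfolding A_eq using E(1) is_subring_Reals noetherian_Reals
    by (auto intro: is_subring_ring_hull noetherian_ring_hull)
  have UNIV: "is_subring (UNIV :: 'b set)" by (simp add: is_subring_def)
  obtain M where M: "is_subring M" "A \<subseteq> M" "centrally_subintegral A M"
    and greatest: "\<And>D. is_subring D \<Longrightarrow> A \<subseteq> D \<Longrightarrow> centrally_subintegral A D \<Longrightarrow> D \<subseteq> M"
    using greatest_centrally_subintegral[OF A UNIV subset_UNIV] by auto
  have "is_integral A z" if "z \<in> M" for z
    using M(3) that unfolding centrally_subintegral_def integral_extension_iff by blast
  then obtain F where F: "finite F" "F \<subseteq> M" "M = ring_hull (\<real> \<union> F)"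
    using integral_subalgebra_finitely_generated[OF is_subring_Reals Reals_inverse, of "\<phi> ` E" E' M]
      E(1) E' M(1,2) unfolding A_eq by auto
  have "finite_type \<real> M"
    unfolding finite_type_def generate_ring_eq_ring_hull
    using F ring_hull_subset[of "\<real> \<union> F"] by blast
  \<comment> \<open>The candidate varieties are a subfamily of the candidate rings. It contains the
    greatest ring \<open>M\<close>, so \<open>M\<close> is greatest in both, and a greatest element
    is the only maximal one.\<close>
  then have "central_seminormalization_variety A UNIV M" "central_seminormalization_ring A UNIV M"
    unfolding central_seminormalization_variety_def central_seminormalization_ring_def
      intermediate_variety_def intermediate_ring_def subring_iff_is_subring
    using M greatest by (auto intro!: unique_maximal_if_greatest)
  then show ?thesis unfolding A_def by blast
qed

end
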